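(* Let $\lambda,\mu>0$ with $\lambda\mu<1$, and let $L_{\lambda,\mu}$ be the Hammersley process with sources of intensity $\lambda$, sinks of intensity $\mu$ and $\alpha$-points of intensity $1$. Let $X'_t$ be the $x$-coordinate at time $t$ of a dual second class particle starting at zero. Then for every $a\ge 0$, $$\lim_{x\to\infty}P(X'_{ax}>x)=\begin{cases} 1, & a\ge 1/\mu^2,\\[2pt] \dfrac{1/\lambda-\sqrt{1/a}}{1/\lambda-\mu}, & 1/\mu^2>a\ge\lambda^2,\\[4pt] 0, & \lambda^2>a\ge 0.\end{cases}$$
   Context: Hammersley process with sources and sinks. Take three independent homogeneous Poisson processes: a process of "sources" on the positive $x$-axis $(0,\infty)\times\{0\}$ with intensity $\lambda$, a process of "sinks" on the positive $t$-axis $\{0\}\times(0,\infty)$ with intensity $\mu$, and a process of "$\alpha$-points" in $(0,\infty)^2$ with intensity $1$ (Lebesgue measure). The vertical coordinate $t$ is time. The Hammersley process is the evolving (locally finite) particle configuration $\eta_t$ on $(0,\infty)$ defined as follows. At time $0$ the particles are located at the sources. When an $\alpha$-point $(u,s)$ occurs, the particle immediately to the right of $u$ jumps at time $s$ to $u$. When a sink $(0,s)$ occurs, the leftmost particle disappears at time $s$ (it exits through the $t$-axis). Nothing else changes. This is well defined because for each $R>0$ the restriction of $\eta_t$ to $(0,R]$ evolves autonomously: at an $\alpha$-point $(u,s)$ with $u\le R$, the leftmost particle in $(u,R]$, if any, is removed and a particle is put at $u$; at a sink, the leftmost particle in $(0,R]$, if any, is removed; these restrictions are consistent as $R$ varies.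 Dual second class particle. It is created by putting an extra sink at the origin, i.e. removing the leftmost particle at time $0$: let $\eta^-_t$ evolve by the same rules with the same sinks and $\alpha$-points, but started from the sources with the leftmost source removed. Almost surely, for all $t$, $\eta_t$ consists of the particles of $\eta^-_t$ plus exactly one more particle, whose location is $X'_t$. Equivalently, $X'_0$ is the position of the leftmost source, $X'_t$ always sits at the position of a particle of $\eta_t$, and whenever that particle jumps (because of an $\alpha$-point) or exits through a sink at time $s$, $X'_s$ is the position of the next particle of $\eta$ to the right of $X'_{s-}$. *)

theory Defs
  imports "HOL-Probability.Probability"
begin

definition locally_finite :: "'a::euclidean_space set \<Rightarrow> bool" where
  "locally_finite A \<longleftrightarrow> (\<forall>B. bounded B \<longrightarrow> finite (A \<inter> B))"

text \<open>The space of locally finite point configurations, with the sigma-algebra generated by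
  the numbers of points in bounded Borel sets.\<close>

definition configurations :: "'a::euclidean_space set measure" where
  "configurations = sigma {A. locally_finite A}
     {{A. locally_finite A \<and> card (A \<inter> B) = k} | B k. B \<in> sets borel \<and> bounded B}"

text \<open>Homogeneous Poisson process on \<open>D\<close> with intensity \<open>c\<close> with respect to Lebesgue measure.
  A homogeneous Poisson process almost surely has no multiple points, so it is represented by
  its random set of points.\<close>

definition poisson_process ::
    "'w measure \<Rightarrow> real \<Rightarrow> 'a::euclidean_space set \<Rightarrow> ('w \<Rightarrow> 'a set) \<Rightarrow> bool" where
  "poisson_process M c D S \<longleftrightarrow>
     S \<in> measurable M configurations \<and>
     (\<forall>\<omega>\<in>space M. S \<omega> \<subseteq> D) \<and>
     (\<forall>B k. B \<in> sets borel \<and> bounded B \<and> B \<subseteq> D \<longrightarrow>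
        measure M {\<omega>\<in>space M. card (S \<omega> \<inter> B) = k} =
          (c * measure lborel B) ^ k / fact k * exp (- (c * measure lborel B))) \<and>
     (\<forall>B :: nat \<Rightarrow> 'a set.
        (\<forall>i. B i \<in> sets borel \<and> bounded (B i) \<and> B i \<subseteq> D) \<and> disjoint_family B \<longrightarrow>
        prob_space.indep_vars M (\<lambda>_. count_space UNIV) (\<lambda>i \<omega>. card (S \<omega> \<inter> B i)) UNIV)"

definition process_events :: "'w measure \<Rightarrow> ('w \<Rightarrow> 'a::euclidean_space set) \<Rightarrow> 'w set set" where
  "process_events M S = sets (vimage_algebra (space M) S configurations)"

text \<open>Points of the plane are pairs (position, time).\<close>

locale hammersley_sources_sinks = prob_space M
  for M :: "'w measure" +
  fixes lambda mu :: real
    and Src Snk :: "'w \<Rightarrow> real set"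
    and Alp :: "'w \<Rightarrow> (real \<times> real) set"
  assumes sources: "poisson_process M lambda {0<..} Src"
    and sinks: "poisson_process M mu {0<..} Snk"
    and alpha_points: "poisson_process M 1 ({0<..} \<times> {0<..}) Alp"
    and independent: "indep_sets
          (\<lambda>i. [process_events M Src, process_events M Snk, process_events M Alp] ! i) {..<3::nat}"

text \<open>Removes the particle immediately to the right of \<open>u\<close>, if there is one.\<close>

definition remove_next :: "real \<Rightarrow> real set \<Rightarrow> real set" where
  "remove_next u A = A - {y \<in> A. u < y \<and> (\<forall>z\<in>A. u < z \<longrightarrow> y \<le> z)}"

text \<open>Effect of an event at position \<open>u\<close>: an alpha-point if \<open>u > 0\<close>, a sink if \<open>u = 0\<close>.\<close>

definition jump :: "real \<Rightarrow> real set \<Rightarrow> real set" where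
  "jump u A = (if u > 0 then insert u (remove_next u A) else remove_next 0 A)"

text \<open>The points of a finite set in order of time.  Almost surely no two events have
  the same time; ties are broken from left to right.\<close>

definition chronological :: "(real \<times> real) set \<Rightarrow> (real \<times> real) list" where
  "chronological E =
     [(u, s). s \<leftarrow> sorted_list_of_set (snd ` E), u \<leftarrow> sorted_list_of_set {u. (u, s) \<in> E}]"

text \<open>The restriction to \<open>(0, R]\<close> of the configuration at time \<open>t\<close>, started from \<open>init\<close>, with
  sinks at times \<open>snk\<close> and alpha-points \<open>alp\<close>; events at time \<open>t\<close> have already taken effect.\<close>

definition hammersley_upto ::
    "real \<Rightarrow> real set \<Rightarrow> real set \<Rightarrow> (real \<times> real) set \<Rightarrow> real \<Rightarrow> real set" where
  "hammersley_upto R init snk alp t =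
     fold (\<lambda>(u, s). jump u)
       (chronological (({0} \<times> snk \<union> alp) \<inter> ({0..R} \<times> {0<..t}))) (init \<inter> {0<..R})"

text \<open>The restrictions are consistent as \<open>R\<close> varies, so the whole configuration is their union.\<close>

definition hammersley ::
    "real set \<Rightarrow> real set \<Rightarrow> (real \<times> real) set \<Rightarrow> real \<Rightarrow> real set" where
  "hammersley init snk alp t = (\<Union>R\<in>{0<..}. hammersley_upto R init snk alp t)"

text \<open>The particle by which the process exceeds the one started without the leftmost source.
  It exists almost surely; the description is arbitrary outside that event.\<close>

definition dual_second_class ::
    "real set \<Rightarrow> real set \<Rightarrow> (real \<times> real) set \<Rightarrow> real \<Rightarrow> real" where
  "dual_second_class src snk alp t =
     (THE y. y \<notin> hammersley (remove_next 0 src) snk alp t \<and>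
             hammersley src snk alp t = insert y (hammersley (remove_next 0 src) snk alp t))"

end

theory Submission
  imports Defs "HOL-Real_Asymp.Real_Asymp"
begin

text \<open>Let \<open>L(x, t)\<close> be the flux of the process, i.e. the number of sinks up to time \<open>t\<close> plus the number of
  particles in \<open>(0, x]\<close> at time \<open>t\<close>; it is a last-passage time.  An extra sink at the origin increases \<open>L(x, t)\<close>
  exactly if \<open>X'\<^sub>t > x\<close>.  Comparing with sinks of the stationary intensity \<open>1 / \<lambda>\<close> during a short initial time,
  as Ferrari and Kipnis did for exclusion processes, gives
  \<open>\<partial>\<^sub>t E L(x, t) = 1 / \<lambda> - (1 / \<lambda> - \<mu>) P(X'\<^sub>t > x)\<close>.  Since \<open>P(X'\<^sub>t > x)\<close> increases with \<open>t\<close>, it suffices to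
  know that \<open>E L(x, a x) / x\<close> tends to \<open>2 \<surd>a\<close> for \<open>\<lambda>\<^sup>2 < a < 1 / \<mu>\<^sup>2\<close>.  The upper bound is domination by the stationary
  process with source intensity \<open>\<surd>a\<close>.  For the lower bound, exit points far along the axes are
  excluded by sprinkling additional sources or sinks, so that the stationary process is
  dominated by the paths that use \<open>\<alpha>\<close>-points only, up to a small error.

  All of this is done for a lattice model with Bernoulli variables, the occupied cells of a mesh of width
  \<open>1 / N\<close>.  As \<open>N\<close> tends to infinity, no row or column of the mesh contains two points with high probability, and
  then the lattice model and the continuous process agree.\<close>

text \<open>On the lattice time advances row by row, and Burke's property becomes a finite table for
  one cell. The derivative formula comes from the first row rather than the last: with sinks of
  stationary density it hands on sources of the same law and adds that density to the mean flux;
  thinning its sinks costs the difference of the densities times the probability that an extra sink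
  at the origin raises the flux. Monotonicity in time turns difference quotients of the mean flux
  into one-sided bounds on the probability at the two ends of an interval, so convergence of the
  means suffices and nothing is differentiated. Between r^2 x and s^2 x the quotient is about 2 / (r
  + s); letting r tend to s, with s^2 = a, gives 1 / s and hence the middle formula. The stationary
  mean \<nu> x + t / \<nu> is minimal at \<nu>^2 = t / x, with value 2 \<surd>(t x). Changing \<nu>
  there by a factor 1 + \<delta> costs a relative amount of order \<delta>^2, whereas a path staying
  on an axis for a fraction \<epsilon> of its length is rewarded by order \<epsilon> \<delta>; with
  \<epsilon> = 2 \<delta> the reward wins.\<close>

text \<open>Last-passage time in a unit cell of the lattice grows by \<open>x\<close> along the bottom and by \<open>y\<close> along the
  left side, and \<open>z\<close> tells whether the cell contains a point.  The growth is then \<open>cell_up x y z\<close> along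
  the top and \<open>cell_right x y z\<close> along the right side.  In terms of particles, \<open>x\<close> is a particle in the
  column and \<open>y\<close> says that the next particle to the right has to be removed in this row.\<close>

definition "cell_right x y z \<longleftrightarrow> (if x then False else y \<or> z)" for x y z :: bool

definition "cell_up x y z \<longleftrightarrow> (if y then False else x \<or> z)" for x y z :: bool

primrec lrow :: "bool \<Rightarrow> bool list \<Rightarrow> bool list \<Rightarrow> bool list" where
  "lrow y [] zs = []"
| "lrow y (x # xs) zs = cell_up x y (hd zs) # lrow (cell_right x y (hd zs)) xs (tl zs)"

definition lrows :: "(bool \<times> bool list) list \<Rightarrow> bool list \<Rightarrow> bool list" where
  "lrows rs xs = fold (\<lambda>(y, zs) xs. lrow y xs zs) rs xs"

primrec drop_first :: "bool list \<Rightarrow> bool list" where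
  "drop_first [] = []"
| "drop_first (x # xs) = (if x then False # xs else x # drop_first xs)"

definition cnt :: "bool list \<Rightarrow> nat \<Rightarrow> int" where
  "cnt xs i = int (length (filter id (take i xs)))"

definition ntrue :: "bool list \<Rightarrow> int" where
  "ntrue xs = int (length (filter id xs))"

text \<open>\<open>heights rs h i\<close> is the last-passage time to column \<open>i\<close> when the rows \<open>rs\<close> (a sink and a list of points
  each) are put on top of the profile \<open>h\<close>; the value at column \<open>0\<close> counts the sinks.\<close>

primrec hrow :: "int \<Rightarrow> bool list \<Rightarrow> (nat \<Rightarrow> int) \<Rightarrow> nat \<Rightarrow> int" where
  "hrow c zs h 0 = c"
| "hrow c zs h (Suc i) = max (hrow c zs h i) (max (h (Suc i)) (h i + of_bool (zs ! i)))"

abbreviation hstep :: "bool \<Rightarrow> bool list \<Rightarrow> (nat \<Rightarrow> int) \<Rightarrow> nat \<Rightarrow> int" where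
  "hstep y zs h \<equiv> hrow (h 0 + of_bool y) zs h"

definition heights :: "(bool \<times> bool list) list \<Rightarrow> (nat \<Rightarrow> int) \<Rightarrow> nat \<Rightarrow> int" where
  "heights rs h = fold (\<lambda>(y, zs). hstep y zs) rs h"

definition no_sinks :: "(bool \<times> bool list) list \<Rightarrow> (bool \<times> bool list) list" where
  "no_sinks = map (\<lambda>(y, zs). (False, zs))"

lemma no_sinks_simps [simp]:
  "no_sinks [] = []" "no_sinks (r # rs) = (False, snd r) # no_sinks rs"
  "no_sinks (rs @ rs') = no_sinks rs @ no_sinks rs'" "no_sinks (no_sinks rs) = no_sinks rs"
  by (auto simp: no_sinks_def case_prod_unfold)

lemma length_lrow [simp]: "length (lrow y xs zs) = length xs"
  by (induction xs arbitrary: y zs) auto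

lemma length_drop_first [simp]: "length (drop_first xs) = length xs"
  by (induction xs) auto

lemma lrows_simps [simp]:
  "lrows [] xs = xs"
  "lrows (r # rs) xs = lrows rs (lrow (fst r) xs (snd r))"
  "lrows (rs @ rs') xs = lrows rs' (lrows rs xs)"
  by (auto simp: lrows_def case_prod_unfold)

lemma length_lrows [simp]: "length (lrows rs xs) = length xs"
  by (induction rs arbitrary: xs) auto

lemma heights_simps [simp]:
  "heights [] h = h"
  "heights (r # rs) h = heights rs (hstep (fst r) (snd r) h)"
  "heights (rs @ rs') h = heights rs' (heights rs h)"
  by (auto simp: heights_def case_prod_unfold)

lemma cnt_simps [simp]:
  "cnt xs 0 = 0" "cnt (x # xs) (Suc i) = of_bool x + cnt xs i" "cnt [] i = 0"
  by (auto simp: cnt_def)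

lemma ntrue_simps [simp]:
  "ntrue [] = 0" "ntrue (x # xs) = of_bool x + ntrue xs" "ntrue (xs @ ys) = ntrue xs + ntrue ys"
  by (auto simp: ntrue_def)

lemma ntrue_nonneg [simp]: "0 \<le> ntrue xs"
  by (simp add: ntrue_def)

lemma cnt_length: "length xs = m \<Longrightarrow> cnt xs m = ntrue xs"
  by (auto simp: cnt_def ntrue_def)

lemma mono_cnt: "i \<le> j \<Longrightarrow> cnt xs i \<le> cnt xs j"
proof (induction xs arbitrary: i j)
  case (Cons x xs) then show ?case by (cases i; cases j) (auto simp: cnt_def)
qed auto

lemma cnt_nonneg [simp]: "0 \<le> cnt xs i"
  by (auto simp: cnt_def)

subsection \<open>Particles and heights\<close>

text \<open>Peels off the first column: the rest is a row of the same kind whose left boundary value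
  is the height reached in column 1. This permits induction on the lists although
  \<open>hrow\<close> recurses on the column index.\<close>

lemma hrow_Cons: "hrow c (z # zs) h (Suc i) =
    hrow (max c (max (h (Suc 0)) (h 0 + of_bool z))) zs (\<lambda>j. h (Suc j)) i"
proof (induction i)
  case (Suc i)
  show ?case
    unfolding hrow.simps(2)[of c "z # zs" h "Suc i"] Suc.IH by simp
qed simp

lemma hrow_cong: "(\<And>j. j \<le> i \<Longrightarrow> h j = k j) \<Longrightarrow> hrow c zs h i = hrow c zs k i"
  by (induction i) simp_all

text \<open>In a single cell, \<open>carry\<close> is the rise along the bottom and the right side,
  and \<open>conserve\<close> says that the way along the left side and the top leads to the same
  passage time.\<close>

lemma hrow_cnt:
  assumes "length zs = length xs" "i \<le> length xs"
  shows "hrow (c + of_bool y) zs (\<lambda>j. c + cnt xs j) i = c + of_bool y + cnt (lrow y xs zs) i"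
  using assms
proof (induction xs arbitrary: y zs c i)
  case (Cons x xs)
  then obtain z zs' where zs: "zs = z # zs'" by (cases zs) auto
  show ?case
  proof (cases i)
    case (Suc j)
    have carry: "max (c + of_bool y) (max (c + of_bool x) (c + of_bool z)) =
        (c + of_bool x) + (of_bool (cell_right x y z) :: int)"
      by (auto simp: cell_right_def)
    have conserve: "(c + of_bool x) + (of_bool (cell_right x y z) :: int) =
        c + of_bool y + of_bool (cell_up x y z)"
      by (auto simp: cell_right_def cell_up_def)
    have "hrow (c + of_bool y) zs (\<lambda>j. c + cnt (x # xs) j) i =
        hrow (max (c + of_bool y) (max (c + of_bool x) (c + of_bool z))) zs' (\<lambda>j. (c + of_bool x) + cnt xs j) j"
      unfolding zs Suc hrow_Cons by (simp add: add.assoc)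
    also have "\<dots> = (c + of_bool x) + of_bool (cell_right x y z) + cnt (lrow (cell_right x y z) xs zs') j"
      unfolding carry using Cons.prems by (intro Cons.IH) (auto simp: zs Suc)
    also have "\<dots> = c + of_bool y + cnt (lrow y (x # xs) zs) i"
      unfolding conserve by (simp add: zs Suc)
    finally show ?thesis .
  qed simp
qed simp

lemma heights_cnt:
  assumes "\<And>r. r \<in> set rs \<Longrightarrow> length (snd r) = length xs" "i \<le> length xs"
  shows "heights rs (\<lambda>j. c + cnt xs j) i = c + ntrue (map fst rs) + cnt (lrows rs xs) i"
proof -
  have cong: "heights rs h i = heights rs k i" if "\<And>j. j \<le> m \<Longrightarrow> h j = k j" "i \<le> m" for h k i m rs
    using that
  proof (induction rs arbitrary: h k i)
    case (Cons r rs)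
    show ?case unfolding heights_simps
      using Cons.prems by (intro Cons.IH) (auto intro!: hrow_cong)
  qed auto
  show ?thesis
    using assms
  proof (induction rs arbitrary: xs c)
    case (Cons r rs)
    have "heights (r # rs) (\<lambda>j. c + cnt xs j) i =
        heights rs (\<lambda>j. (c + of_bool (fst r)) + cnt (lrow (fst r) xs (snd r)) j) i"
      unfolding heights_simps using Cons.prems
      by (intro cong[of "length xs"]) (auto simp: hrow_cnt)
    also have "\<dots> = c + of_bool (fst r) + ntrue (map fst rs) + cnt (lrows rs (lrow (fst r) xs (snd r))) i"
      using Cons.prems by (intro Cons.IH) auto
    finally show ?case by simp
  qed auto
qed

subsection \<open>Max-plus linearity\<close>

lemma hrow_mono: "c \<le> d \<Longrightarrow> (\<And>j. h j \<le> k j) \<Longrightarrow> hrow c zs h i \<le> hrow d zs k i"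
proof (induction i)
  case (Suc i)
  then have "hrow c zs h i \<le> hrow d zs k i" "h (Suc i) \<le> k (Suc i)" "h i \<le> k i" by auto
  then show ?case by (simp add: max_def)
qed auto

lemma hrow_shift: "hrow (c + d) zs (\<lambda>j. h j + d) i = hrow c zs h i + d"
  by (induction i) (simp_all add: max_add_distrib_left add_ac)

text \<open>Only a path that starts in column 0 can collect the sink, and there \<open>k\<close> is
  at least as high as \<open>h\<close>. So the sink can be charged to \<open>k\<close>
  alone.\<close>

lemma hstep_max:
  "h 0 \<le> k 0 \<Longrightarrow> hstep y zs (\<lambda>j. max (h j) (k j)) i \<le> max (hstep False zs h i) (hstep y zs k i)"
proof (induction i)
  case (Suc i)
  have *: "a \<le> max b c \<Longrightarrow> max a (max (max p q) (max p' q' + r)) \<le>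
      max (max b (max p (p' + r))) (max c (max q (q' + r)))"
    for a b c p q p' q' r :: int
    by linarith
  show ?case unfolding hrow.simps(2) by (rule *[OF Suc.IH[OF Suc.prems]])
qed simp

lemma hrow_Suc_le: "hrow (c + of_bool y) zs h i \<le> hrow c zs h i + of_bool y"
proof (induction i)
  case (Suc i)
  have *: "a \<le> b + r \<Longrightarrow> 0 \<le> r \<Longrightarrow> max a p \<le> max b p + r" for a b p r :: int
    by linarith
  show ?case unfolding hrow.simps(2) by (rule *[OF Suc]) simp
qed simp

lemma hrow_ge: "c \<le> hrow c zs h i"
  by (induction i) (simp, simp only: hrow.simps le_max_iff_disj simp_thms)

definition rows_le :: "(bool \<times> bool list) list \<Rightarrow> (bool \<times> bool list) list \<Rightarrow> bool" where
  "rows_le = list_all2 (\<lambda>r r'. fst r \<le> fst r' \<and> snd r = snd r')"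

lemma heights_mono:
  "rows_le rs rs' \<Longrightarrow> (\<And>j. h j \<le> k j) \<Longrightarrow> heights rs h i \<le> heights rs' k i"
  unfolding rows_le_def
proof (induction rs rs' arbitrary: h k rule: list_all2_induct)
  case (Cons r rs r' rs')
  have "(of_bool (fst r) :: int) \<le> of_bool (fst r')" using Cons by auto
  then have "h 0 + of_bool (fst r) \<le> k 0 + of_bool (fst r')" using Cons by (intro add_mono) auto
  then have "hstep (fst r) (snd r) h j \<le> hstep (fst r') (snd r') k j" for j
    using Cons by (metis hrow_mono)
  then show ?case unfolding heights_simps by (rule Cons.IH)
qed auto

lemma rows_le_refl [simp]: "rows_le rs rs"
  by (auto simp: rows_le_def list_all2_refl)

lemma rows_le_no_sinks [simp]: "rows_le (no_sinks rs) rs"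
  unfolding rows_le_def by (induction rs) auto

lemma heights_shift: "heights rs (\<lambda>j. h j + d) i = heights rs h i + d"
proof (induction rs arbitrary: h)
  case (Cons r rs)
  have "hstep (fst r) (snd r) (\<lambda>j. h j + d) = (\<lambda>i. hstep (fst r) (snd r) h i + d)"
    using hrow_shift[of "h 0 + of_bool (fst r)" d "snd r" h] by (auto simp: algebra_simps)
  then show ?case using Cons by simp
qed auto

lemma heights_const: "heights rs (\<lambda>j. d) i = heights rs (\<lambda>j. 0) i + d"
  using heights_shift[of rs "\<lambda>j. 0" d i] by simp

lemma heights_max:
  "h 0 \<le> k 0 \<Longrightarrow> heights rs (\<lambda>j. max (h j) (k j)) i \<le> max (heights (no_sinks rs) h i) (heights rs k i)"
proof (induction rs arbitrary: h k)
  case (Cons r rs)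
  have "heights (r # rs) (\<lambda>j. max (h j) (k j)) i \<le>
      heights rs (\<lambda>j. max (hstep False (snd r) h j) (hstep (fst r) (snd r) k j)) i"
    unfolding heights_simps using Cons.prems by (intro heights_mono hstep_max) auto
  also have "\<dots> \<le> max (heights (no_sinks rs) (hstep False (snd r) h) i) (heights rs (hstep (fst r) (snd r) k) i)"
    using Cons.prems by (intro Cons.IH) auto
  finally show ?case by (simp add: case_prod_unfold)
qed auto

lemma heights_sinks_le: "heights rs h i \<le> heights (no_sinks rs) h i + ntrue (map fst rs)"
proof (induction rs arbitrary: h)
  case (Cons r rs)
  have "heights (r # rs) h i \<le> heights (no_sinks rs) (hstep (fst r) (snd r) h) i + ntrue (map fst rs)"
    using Cons by simp
  also have "heights (no_sinks rs) (hstep (fst r) (snd r) h) i \<le>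
     heights (no_sinks rs) (\<lambda>j. hstep False (snd r) h j + of_bool (fst r)) i"
    using hrow_Suc_le[of "h 0" "fst r" "snd r" h] by (intro heights_mono) simp_all
  also have "\<dots> = heights (no_sinks rs) (hstep False (snd r) h) i + of_bool (fst r)"
    by (rule heights_shift)
  finally show ?case by (simp add: case_prod_unfold)
qed auto

lemma heights_0: "heights rs h 0 = h 0 + ntrue (map fst rs)"
  by (induction rs arbitrary: h) auto

lemma heights_ge_0: "(\<And>j. h 0 \<le> h j) \<Longrightarrow> heights rs h 0 \<le> heights rs h i"
proof (induction rs arbitrary: h)
  case (Cons r rs)
  then show ?case by (auto intro!: Cons.IH hrow_ge)
qed auto

text \<open>The source profile and the zero profile agree in column 0, so the alternative applies: a
  longest path collects sources or sinks, never both.\<close>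

lemma heights_sources_or_sinks:
  "heights rs (cnt xs) i \<le> max (heights (no_sinks rs) (cnt xs) i) (heights rs (\<lambda>_. 0) i)"
proof -
  have "cnt xs = (\<lambda>j. max (cnt xs j) 0)" by (simp add: max_absorb1)
  then show ?thesis using heights_max[of "cnt xs" "\<lambda>_. 0" rs i] by simp
qed

text \<open>The excess of a larger configuration only accumulates from left to right, so a path that
  leaves the axis late gains at least the excess up to the threshold.\<close>

lemma cnt_diff_mono:
  assumes "list_all2 (\<le>) xs xs'" "i \<le> j"
  shows "cnt xs' i - cnt xs i \<le> cnt xs' j - cnt xs j"
  using assms
proof (induction xs xs' arbitrary: i j rule: list_all2_induct)
  case (Cons x xs x' xs')
  have base: "cnt xs' 0 - cnt xs 0 \<le> cnt xs' j - cnt xs j" for j using Cons.IH[of 0 j] by simp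
  have x: "(of_bool x :: int) \<le> of_bool x'" using Cons.hyps by simp
  show ?case
  proof (cases i)
    case 0
    then show ?thesis using x base[of "j - 1"] by (cases j) auto
  next
    case (Suc i')
    then show ?thesis using Cons.prems Cons.IH[of i' "j - 1"] by (cases j) auto
  qed
qed auto

text \<open>The alternative is whether the longest path leaves the lower axis before or after column \<open>e\<close>; in the
  latter case it gains all sources that \<open>xs'\<close> has in excess of \<open>xs\<close> up to there.\<close>

lemma heights_sources_split:
  assumes "list_all2 (\<le>) xs xs'"
  shows "heights (no_sinks rs) (cnt xs) i \<le>
    max (heights (no_sinks rs) (\<lambda>_. 0) i + cnt xs e)
        (heights (no_sinks rs) (cnt xs') i - (cnt xs' e - cnt xs e))"
proof -
  have le: "cnt xs j \<le> max (cnt xs' j + (cnt xs e - cnt xs' e)) (cnt xs e)" for j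
    using mono_cnt[of j e xs] cnt_diff_mono[OF assms, of e j] by (cases "j \<le> e") auto
  have "0 + (cnt xs e - cnt xs' e) \<le> cnt xs e" by simp
  then have "heights (no_sinks rs) (\<lambda>j. max (cnt xs' j + (cnt xs e - cnt xs' e)) (cnt xs e)) i
     \<le> max (heights (no_sinks (no_sinks rs)) (\<lambda>j. cnt xs' j + (cnt xs e - cnt xs' e)) i)
           (heights (no_sinks rs) (\<lambda>_. cnt xs e) i)"
    by (intro heights_max) simp
  moreover have "heights (no_sinks rs) (cnt xs) i \<le>
      heights (no_sinks rs) (\<lambda>j. max (cnt xs' j + (cnt xs e - cnt xs' e)) (cnt xs e)) i"
    by (intro heights_mono le) simp
  ultimately show ?thesis
    by (simp add: heights_shift heights_const[of _ "cnt xs e"])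
qed

text \<open>The same alternative on the other axis, with the rows cut at the threshold time. A path
  leaving the axis during \<open>rs1\<close> gains at most the sinks of \<open>rs1\<close>. A later
  one enters \<open>rs2\<close> from a constant profile, which would be higher by the excess if the
  sinks were those of \<open>rs1'\<close>.\<close>

lemma heights_sinks_split:
  assumes "rows_le rs1 rs1'" "rows_le rs2 rs2'"
  shows "heights (rs1 @ rs2) (\<lambda>_. 0) i \<le>
    max (heights (no_sinks (rs1 @ rs2)) (\<lambda>_. 0) i + ntrue (map fst rs1))
        (heights (rs1' @ rs2') (\<lambda>_. 0) i - (ntrue (map fst rs1') - ntrue (map fst rs1)))"
proof -
  let ?K = "ntrue (map fst rs1)" and ?K' = "ntrue (map fst rs1')"
  let ?h = "heights rs1 (\<lambda>_. 0)" and ?h' = "heights rs1' (\<lambda>_. 0)"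
  have "?h j \<ge> ?K" for j using heights_ge_0[of "\<lambda>_. 0" rs1 j] by (simp add: heights_0)
  then have "?h = (\<lambda>j. max (?h j) ?K)" by (simp add: max_absorb1)
  then have "heights rs2 ?h i \<le> max (heights (no_sinks rs2) ?h i) (heights rs2 (\<lambda>_. ?K) i)"
    using heights_max[of ?h "\<lambda>_. ?K" rs2 i] by (simp add: heights_0)
  moreover have "heights (no_sinks rs2) ?h i \<le>
      heights (no_sinks rs2) (\<lambda>j. heights (no_sinks rs1) (\<lambda>_. 0) j + ?K) i"
    by (intro heights_mono heights_sinks_le) auto
  moreover have "heights rs2 (\<lambda>_. ?K') i \<le> heights rs2' ?h' i"
  proof (intro heights_mono assms)
    show "?K' \<le> ?h' j" for j using heights_ge_0[of "\<lambda>_. 0" rs1' j] by (simp add: heights_0)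
  qed
  ultimately show ?thesis
    by (simp add: heights_shift heights_const[of _ ?K] heights_const[of _ ?K'])
qed

subsection \<open>The discrepancy\<close>

definition discrepancy :: "bool list \<Rightarrow> bool list \<Rightarrow> bool" where
  "discrepancy xs zs \<longleftrightarrow> (\<exists>as bs. xs = as @ True # bs \<and> zs = as @ False # bs)"

lemma discrepancy_Cons: "discrepancy (x # xs) (z # zs) \<longleftrightarrow> (x = z \<and> discrepancy xs zs) \<or> (x \<and> \<not> z \<and> xs = zs)"
  (is "?L \<longleftrightarrow> ?R")
proof
  assume ?L
  then obtain as bs where *: "x # xs = as @ True # bs" "z # zs = as @ False # bs"
    by (auto simp: discrepancy_def)
  then show ?R by (cases as) (auto simp: discrepancy_def)
next
  assume ?R
  then show ?L
  proof
    assume "x = z \<and> discrepancy xs zs"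
    then obtain as bs where "x # xs = (x # as) @ True # bs" "z # zs = (x # as) @ False # bs"
      by (auto simp: discrepancy_def)
    then show ?L unfolding discrepancy_def by blast
  next
    assume "x \<and> \<not> z \<and> xs = zs"
    then have "x # xs = [] @ True # xs" "z # zs = [] @ False # xs" by auto
    then show ?L unfolding discrepancy_def by blast
  qed
qed

lemma discrepancy_Nil [simp]: "\<not> discrepancy [] zs" "\<not> discrepancy xs []"
  by (auto simp: discrepancy_def)

text \<open>The carries differ up to the first cell with a particle or a point, where only the row
  without the extra sink ends up with a particle; beyond it the carries agree. If there is no such
  cell, the lists are equal.\<close>

lemma discrepancy_lrow_same:
  "discrepancy (lrow False xs ws) (lrow True xs ws) \<or> lrow False xs ws = lrow True xs ws"
proof (induction xs arbitrary: ws)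
  case (Cons x xs)
  then show ?case
    by (cases x; cases "hd ws") (auto simp: discrepancy_Cons cell_up_def cell_right_def)
qed auto

text \<open>At the discrepant cell the extra particle either stays put or turns into different
  carries over equal configurations, the situation of \<open>discrepancy_lrow_same\<close>. Equality
  arises when it is pushed beyond the right end.\<close>

lemma discrepancy_lrow:
  "discrepancy xs zs \<Longrightarrow> discrepancy (lrow y xs ws) (lrow y zs ws) \<or> lrow y xs ws = lrow y zs ws"
proof (induction xs arbitrary: y zs ws)
  case (Cons x xs)
  then obtain z zs' where zs: "zs = z # zs'" by (cases zs) auto
  show ?case
    using Cons discrepancy_lrow_same[of xs "tl ws"]
    by (cases x; cases z; cases y; cases "hd ws") (auto simp: zs discrepancy_Cons cell_up_def cell_right_def)
qed auto

lemma discrepancy_lrows: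
  "discrepancy xs zs \<or> xs = zs \<Longrightarrow> discrepancy (lrows rs xs) (lrows rs zs) \<or> lrows rs xs = lrows rs zs"
proof (induction rs arbitrary: xs zs)
  case (Cons r rs)
  then show ?case unfolding lrows_simps using discrepancy_lrow by (intro Cons.IH) blast
qed auto

lemma discrepancy_ntrue: "discrepancy xs zs \<Longrightarrow> ntrue xs = ntrue zs + 1"
  by (auto simp: discrepancy_def)

lemma discrepancy_irrefl: "discrepancy xs zs \<Longrightarrow> xs \<noteq> zs"
  by (auto simp: discrepancy_def)

lemma ntrue_diff:
  "discrepancy xs zs \<or> xs = zs \<Longrightarrow> ntrue xs - ntrue zs = of_bool (xs \<noteq> zs)"
  by (auto simp: discrepancy_ntrue dest: discrepancy_irrefl)

text \<open>In a row without points an extra sink is the removal of the first particle. This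
  connects sinks of the first row with the start of the dual second class particle.\<close>

lemma lrow_no_points:
  assumes "\<not> (\<exists>z\<in>set ws. z)" "length ws = length xs"
  shows "lrow False xs ws = xs" "lrow True xs ws = drop_first xs"
  using assms
proof (induction xs arbitrary: ws)
  case (Cons x xs)
  {
    case 1
    then show ?case using Cons.IH(1)[of "tl ws"]
      by (cases ws) (auto simp: cell_up_def cell_right_def)
  next
    case 2
    then show ?case using Cons.IH[of "tl ws"]
      by (cases ws) (auto simp: cell_up_def cell_right_def)
  }
qed auto

subsection \<open>Finitely supported expectations\<close>

abbreviation "fin_pmf p \<equiv> finite (set_pmf p)"

abbreviation pexp :: "'a pmf \<Rightarrow> ('a \<Rightarrow> real) \<Rightarrow> real" where
  "pexp p f \<equiv> measure_pmf.expectation p f"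

abbreviation pprob :: "'a pmf \<Rightarrow> 'a set \<Rightarrow> real" where
  "pprob p A \<equiv> measure_pmf.prob p A"

lemma fin_pmf_replicate [simp]: "fin_pmf p \<Longrightarrow> fin_pmf (replicate_pmf n p)"
proof -
  assume "fin_pmf p"
  then have "finite {xs. set xs \<subseteq> set_pmf p \<and> length xs = n}" by (rule finite_lists_length_eq)
  moreover have "set_pmf (replicate_pmf n p) = {xs. set xs \<subseteq> set_pmf p \<and> length xs = n}"
    by (auto simp: set_replicate_pmf)
  ultimately show ?thesis by simp
qed

lemma fin_pmf_bool [simp]: "fin_pmf (p :: bool pmf)"
  by (rule finite_subset[of _ UNIV]) auto

lemma integrable_fin_pmf [simp]: "fin_pmf p \<Longrightarrow> integrable (measure_pmf p) (f :: _ \<Rightarrow> real)"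
  by (rule integrable_measure_pmf_finite)

lemma expectation_bind:
  fixes h :: "'b \<Rightarrow> real"
  assumes "fin_pmf p" "\<And>x. x \<in> set_pmf p \<Longrightarrow> fin_pmf (f x)"
  shows "pexp (bind_pmf p f) h = pexp p (\<lambda>x. pexp (f x) h)"
  using pmf_expectation_bind[of "set_pmf p" f p h] assms by (simp add: integral_measure_pmf[of "set_pmf p"])

lemma expectation_pair:
  fixes h :: "'a \<times> 'b \<Rightarrow> real"
  assumes "fin_pmf p" "fin_pmf q"
  shows "pexp (pair_pmf p q) h = pexp p (\<lambda>x. pexp q (\<lambda>y. h (x, y)))"
  unfolding pair_pmf_def using assms by (simp add: expectation_bind)

lemma expectation_mono_pmf:
  fixes f g :: "'a \<Rightarrow> real"
  assumes "fin_pmf p" "\<And>x. x \<in> set_pmf p \<Longrightarrow> f x \<le> g x"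
  shows "pexp p f \<le> pexp p g"
  using assms by (intro integral_mono_AE) (auto simp: AE_measure_pmf_iff)

lemma expectation_cong_pmf:
  fixes f g :: "'a \<Rightarrow> real"
  assumes "\<And>x. x \<in> set_pmf p \<Longrightarrow> f x = g x"
  shows "pexp p f = pexp p g"
  using assms by (intro integral_cong_AE) (auto simp: AE_measure_pmf_iff)

lemma prob_mono_pmf:
  assumes "\<And>x. x \<in> set_pmf p \<Longrightarrow> x \<in> A \<Longrightarrow> x \<in> B"
  shows "pprob p A \<le> pprob p B"
  using assms by (intro measure_pmf.finite_measure_mono_AE) (auto simp: AE_measure_pmf_iff)

lemma prob_le_expectation:
  assumes "fin_pmf p" "\<And>x. x \<in> set_pmf p \<Longrightarrow> indicator A x \<le> (f x :: real)"
  shows "pprob p A \<le> pexp p f"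
proof -
  have "pprob p A = pexp p (indicator A)" by simp
  also have "\<dots> \<le> pexp p f" by (rule expectation_mono_pmf[OF assms])
  finally show ?thesis .
qed

lemma map_replicate_pmf: "map_pmf (map f) (replicate_pmf n p) = replicate_pmf n (map_pmf f p)"
proof (induction n)
  case (Suc n)
  show ?case by (simp add: map_bind_pmf bind_map_pmf flip: Suc)
qed simp

lemma replicate_pmf_Suc_right:
  "replicate_pmf (Suc n) p = do {xs \<leftarrow> replicate_pmf n p; x \<leftarrow> p; return_pmf (xs @ [x])}"
  using replicate_pmf_distrib[of n 1 p]
  by (simp add: bind_assoc_pmf bind_return_pmf del: replicate_pmf.simps(2))
     (simp add: bind_assoc_pmf bind_return_pmf)

lemma map_take_replicate_pmf:
  assumes "e \<le> n" shows "map_pmf (take e) (replicate_pmf n p) = replicate_pmf e p"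
proof -
  have "map_pmf (take e) (replicate_pmf (e + (n - e)) p) =
      do {xs \<leftarrow> replicate_pmf e p; ys \<leftarrow> replicate_pmf (n - e) p; return_pmf (take e (xs @ ys))}"
    unfolding replicate_pmf_distrib by (simp add: map_bind_pmf)
  also have "\<dots> = do {xs \<leftarrow> replicate_pmf e p; return_pmf xs}"
    by (intro bind_pmf_cong refl) (auto simp: set_replicate_pmf bind_pmf_const)
  finally show ?thesis using assms by (simp add: bind_return_pmf')
qed

lemma rel_replicate_pmf: "rel_pmf R p q \<Longrightarrow> rel_pmf (list_all2 R) (replicate_pmf n p) (replicate_pmf n q)"
  by (induction n) (auto intro!: rel_pmf_bindI)

lemma rel_pair_pmf: "rel_pmf R p q \<Longrightarrow> rel_pmf S p' q' \<Longrightarrow> rel_pmf (rel_prod R S) (pair_pmf p p') (pair_pmf q q')"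
  by (subst rel_pmf_rel_prod) auto

lemma rel_bernoulli_pmf:
  assumes "0 \<le> q" "q \<le> q'" "q' \<le> 1"
  shows "rel_pmf (\<le>) (bernoulli_pmf q) (bernoulli_pmf q')"
proof (cases "q = 1")
  case True
  then have "q' = q" using assms by simp
  then show ?thesis by (auto intro!: rel_pmf_reflI)
next
  case False
  \<comment> \<open>\<open>d\<close> solves 1 - (1 - q) (1 - d) = \<open>q'\<close>, so that
    \<open>x \<or> y\<close> has success probability \<open>q'\<close>.\<close>
  define d where "d = (q' - q) / (1 - q)"
  have d: "0 \<le> d" "d \<le> 1" using assms False by (auto simp: d_def field_simps)
  define r where "r = do {x \<leftarrow> bernoulli_pmf q; y \<leftarrow> bernoulli_pmf d; return_pmf (x, x \<or> y)}"
  show ?thesis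
  proof (rule rel_pmf.intros[of r])
    show "x \<le> y" if "(x, y) \<in> set_pmf r" for x y using that by (auto simp: r_def)
    show "map_pmf fst r = bernoulli_pmf q"
      by (simp add: r_def map_bind_pmf bind_pmf_const bind_return_pmf')
    show "map_pmf snd r = bernoulli_pmf q'"
    proof (rule pmf_eqI)
      have "q + (1 - q) * d = q'" "(1 - q) * (1 - d) = 1 - q'" using False by (auto simp: d_def field_simps)
      then show "pmf (map_pmf snd r) b = pmf (bernoulli_pmf q') b" for b
        using assms d by (cases b) (simp_all add: r_def map_bind_pmf pmf_bind measure_pmf_single algebra_simps)
    qed
  qed
qed

lemma expectation_mono_rel:
  fixes f :: "'a \<Rightarrow> real" and g :: "'b \<Rightarrow> real"
  assumes "rel_pmf R p q" "fin_pmf p" "fin_pmf q"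
    and "\<And>x y. x \<in> set_pmf p \<Longrightarrow> y \<in> set_pmf q \<Longrightarrow> R x y \<Longrightarrow> f x \<le> g y"
  shows "pexp p f \<le> pexp q g"
  using assms(1)
proof cases
  case (1 pq)
  have set: "set_pmf p = fst ` set_pmf pq" "set_pmf q = snd ` set_pmf pq"
    using 1 by (auto simp flip: pmf.set_map)
  have "fin_pmf pq"
  proof (rule finite_subset)
    show "set_pmf pq \<subseteq> set_pmf p \<times> set_pmf q" unfolding set by (auto intro: rev_image_eqI)
  qed (use assms in auto)
  then have "pexp pq (\<lambda>x. f (fst x)) \<le> pexp pq (\<lambda>x. g (snd x))"
    using 1 assms(4) set by (intro expectation_mono_pmf) force+
  then show ?thesis using 1 by (metis integral_map_pmf)
qed

subsection \<open>Bernoulli lists\<close>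

definition conf_pmf :: "real \<Rightarrow> nat \<Rightarrow> bool list pmf" where
  "conf_pmf q m = replicate_pmf m (bernoulli_pmf q)"

definition rows_pmf :: "real \<Rightarrow> real \<Rightarrow> nat \<Rightarrow> nat \<Rightarrow> (bool \<times> bool list) list pmf" where
  "rows_pmf b p m n = replicate_pmf n (pair_pmf (bernoulli_pmf b) (conf_pmf p m))"

definition lattice_pmf :: "real \<Rightarrow> real \<Rightarrow> real \<Rightarrow> nat \<Rightarrow> nat \<Rightarrow> (bool list \<times> (bool \<times> bool list) list) pmf" where
  "lattice_pmf a b p m n = pair_pmf (conf_pmf a m) (rows_pmf b p m n)"

lemma fin_pmfs [simp]: "fin_pmf (conf_pmf q m)" "fin_pmf (rows_pmf b p m n)" "fin_pmf (lattice_pmf a b p m n)"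
  by (simp_all add: conf_pmf_def rows_pmf_def lattice_pmf_def)

lemma length_conf_pmf: "xs \<in> set_pmf (conf_pmf q m) \<Longrightarrow> length xs = m"
  by (auto simp: conf_pmf_def set_replicate_pmf)

lemma length_rows_pmf:
  assumes "rs \<in> set_pmf (rows_pmf b p m n)"
  shows "length rs = n" "\<And>r. r \<in> set rs \<Longrightarrow> length (snd r) = m"
  using assms by (auto simp: rows_pmf_def set_replicate_pmf in_lists_conv_set dest!: length_conf_pmf bspec)

lemma conf_pmf_Suc: "conf_pmf q (Suc m) = do {x \<leftarrow> bernoulli_pmf q; xs \<leftarrow> conf_pmf q m; return_pmf (x # xs)}"
  by (simp add: conf_pmf_def)

lemma expectation_conf_Suc:
  fixes f :: "bool list \<Rightarrow> real"
  assumes "0 \<le> q" "q \<le> 1"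
  shows "pexp (conf_pmf q (Suc m)) f =
    q * pexp (conf_pmf q m) (\<lambda>xs. f (True # xs)) +
    (1 - q) * pexp (conf_pmf q m) (\<lambda>xs. f (False # xs))"
  using assms by (simp add: conf_pmf_Suc expectation_bind)

lemma expectation_ntrue_conf:
  fixes q :: real
  assumes "0 \<le> q" "q \<le> 1"
  shows "pexp (conf_pmf q m) (\<lambda>xs. real_of_int (ntrue xs)) = m * q"
proof (induction m)
  case (Suc m)
  then show ?case using assms
    by (simp add: expectation_conf_Suc algebra_simps)
qed (simp add: conf_pmf_def)

lemma variance_ntrue_conf:
  fixes q :: real
  assumes "0 \<le> q" "q \<le> 1"
  shows "pexp (conf_pmf q m) (\<lambda>xs. (ntrue xs - m * q)\<^sup>2) = m * q * (1 - q)"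
proof (induction m)
  case (Suc m)
  let ?E = "pexp (conf_pmf q m)"
  let ?T = "\<lambda>xs. real_of_int (ntrue xs) - m * q"
  have T: "?E ?T = 0" using assms by (simp add: expectation_ntrue_conf)
  have sq: "?E (\<lambda>xs. (?T xs + c)\<^sup>2) = ?E (\<lambda>xs. (?T xs)\<^sup>2) + c\<^sup>2" for c
  proof -
    have "?E (\<lambda>xs. (?T xs + c)\<^sup>2) = ?E (\<lambda>xs. (?T xs)\<^sup>2 + (2 * c * ?T xs + c\<^sup>2))"
      by (intro expectation_cong_pmf) (simp add: power2_eq_square algebra_simps)
    also have "\<dots> = ?E (\<lambda>xs. (?T xs)\<^sup>2) + (2 * c * ?E ?T + c\<^sup>2)"
      by (subst Bochner_Integration.integral_add; simp)+
    finally show ?thesis using T by simp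
  qed
  have "pexp (conf_pmf q (Suc m)) (\<lambda>xs. (ntrue xs - Suc m * q)\<^sup>2) =
     q * ?E (\<lambda>xs. (?T xs + (1 - q))\<^sup>2) + (1 - q) * ?E (\<lambda>xs. (?T xs + (- q))\<^sup>2)"
    unfolding expectation_conf_Suc[OF assms]
    by (intro arg_cong2[where f="(+)"] arg_cong2[where f="(*)"] refl expectation_cong_pmf)
       (simp_all add: algebra_simps)
  also have "\<dots> = Suc m * q * (1 - q)"
    unfolding sq Suc.IH by (simp add: power2_eq_square algebra_simps)
  finally show ?case .
qed (simp add: conf_pmf_def)

text \<open>Chebyshev's inequality. The factor \<open>1 - q\<close> of the variance is dropped so
  that the bound is linear in the mean and errors of several counts add up.\<close>

lemma ntrue_conf_deviation:
  fixes q \<theta> :: real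
  assumes "0 \<le> q" "q \<le> 1" "\<theta> > 0"
  shows "pprob (conf_pmf q m) {xs. \<theta> \<le> \<bar>ntrue xs - m * q\<bar>} \<le> m * q / \<theta>\<^sup>2"
proof -
  have "pprob (conf_pmf q m) {xs. \<theta> \<le> \<bar>ntrue xs - m * q\<bar>} \<le>
      pexp (conf_pmf q m) (\<lambda>xs. (ntrue xs - m * q)\<^sup>2 / \<theta>\<^sup>2)"
    using assms(3) abs_le_square_iff[of \<theta>] by (intro prob_le_expectation) (auto simp: indicator_def)
  also have "\<dots> = m * q * (1 - q) / \<theta>\<^sup>2" using assms by (simp add: variance_ntrue_conf)
  also have "\<dots> \<le> m * q / \<theta>\<^sup>2"
    using assms by (intro divide_right_mono) (auto simp: mult_left_le)
  finally show ?thesis .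
qed

subsection \<open>Stationarity\<close>

text \<open>With a = \<lambda> / N, b = \<mu> / N and p = 1 / N^2 the equation becomes \<lambda>
  \<mu> = 1 up to terms of order 1 / N, the stationarity condition of the continuous
  process.\<close>

definition stationary :: "real \<Rightarrow> real \<Rightarrow> real \<Rightarrow> bool" where
  "stationary a b p \<longleftrightarrow> 0 \<le> a \<and> a \<le> 1 \<and> 0 \<le> b \<and> b \<le> 1 \<and> 0 \<le> p \<and> p \<le> 1 \<and> (1 - a) * (1 - b) * p = a * b"

text \<open>Burke's property of a single cell.\<close>

lemma stationary_cell:
  assumes "stationary a b p"
  shows "do {x \<leftarrow> bernoulli_pmf a; y \<leftarrow> bernoulli_pmf b; z \<leftarrow> bernoulli_pmf p;
             return_pmf (cell_up x y z, cell_right x y z)} =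
         do {x \<leftarrow> bernoulli_pmf a; y \<leftarrow> bernoulli_pmf b; return_pmf (x, y)}" (is "?L = ?R")
proof (rule pmf_eqI)
  fix i :: "bool \<times> bool"
  have ineq: "0 \<le> a" "a \<le> 1" "0 \<le> b" "b \<le> 1" "0 \<le> p" "p \<le> 1"
    and eq: "(1 - a) * (1 - b) * p = a * b" using assms by (auto simp: stationary_def)
  have "a * b + (1 - a) * (1 - b) * (1 - p) = (1 - a) * (1 - b)" using eq by (simp add: algebra_simps)
  then show "pmf ?L i = pmf ?R i" using ineq eq
    by (cases i; cases "fst i"; cases "snd i")
      (simp_all add: pmf_bind cell_up_def cell_right_def algebra_simps)
qed

text \<open>The right output of the first cell is independent of its upper output and distributed
  like a sink, so the remaining columns form a shorter row of the same kind.\<close>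

lemma stationary_lrow:
  assumes "stationary a b p"
  shows "do {y \<leftarrow> bernoulli_pmf b; xs \<leftarrow> conf_pmf a m; zs \<leftarrow> conf_pmf p m; return_pmf (lrow y xs zs)} =
      conf_pmf a m"
proof (induction m)
  case (Suc m)
  have "do {y \<leftarrow> bernoulli_pmf b; xs \<leftarrow> conf_pmf a (Suc m); zs \<leftarrow> conf_pmf p (Suc m); return_pmf (lrow y xs zs)} =
    do {y \<leftarrow> bernoulli_pmf b; x \<leftarrow> bernoulli_pmf a; xs \<leftarrow> conf_pmf a m; z \<leftarrow> bernoulli_pmf p; zs \<leftarrow> conf_pmf p m;
        return_pmf (cell_up x y z # lrow (cell_right x y z) xs zs)}"
    by (simp add: conf_pmf_Suc bind_assoc_pmf bind_return_pmf)
  \<comment> \<open>All three inputs of the first cell are drawn before the rest of the row, so that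
    \<open>stationary_cell\<close> applies.\<close>
  also have "\<dots> = do {x \<leftarrow> bernoulli_pmf a; y \<leftarrow> bernoulli_pmf b; z \<leftarrow> bernoulli_pmf p; xs \<leftarrow> conf_pmf a m;
      zs \<leftarrow> conf_pmf p m;
        return_pmf (cell_up x y z # lrow (cell_right x y z) xs zs)}"
    by (subst bind_commute_pmf) (subst (3) bind_commute_pmf, rule refl)
  also have "\<dots> = do {(u, r) \<leftarrow> do {x \<leftarrow> bernoulli_pmf a; y \<leftarrow> bernoulli_pmf b; z \<leftarrow> bernoulli_pmf p;
             return_pmf (cell_up x y z, cell_right x y z)}; xs \<leftarrow> conf_pmf a m; zs \<leftarrow> conf_pmf p m;
                 return_pmf (u # lrow r xs zs)}"
    by (simp add: bind_assoc_pmf bind_return_pmf)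
  also have "\<dots> = do {x \<leftarrow> bernoulli_pmf a; xs' \<leftarrow> do {y \<leftarrow> bernoulli_pmf b; xs \<leftarrow> conf_pmf a m;
      zs \<leftarrow> conf_pmf p m; return_pmf (lrow y xs zs)}; return_pmf (x # xs')}"
    unfolding stationary_cell[OF assms] by (simp add: bind_assoc_pmf bind_return_pmf)
  also have "\<dots> = conf_pmf a (Suc m)" unfolding Suc.IH by (simp add: conf_pmf_Suc)
  finally show ?case .
qed (simp add: conf_pmf_def bind_return_pmf)

lemma rows_pmf_Suc: "rows_pmf b p m (Suc n) =
   do {y \<leftarrow> bernoulli_pmf b; zs \<leftarrow> conf_pmf p m; rs \<leftarrow> rows_pmf b p m n; return_pmf ((y, zs) # rs)}"
  by (simp add: rows_pmf_def pair_pmf_def bind_assoc_pmf bind_return_pmf)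

lemma stationary_lrows:
  assumes "stationary a b p"
  shows "map_pmf (\<lambda>(xs, rs). lrows rs xs) (lattice_pmf a b p m n) = conf_pmf a m"
proof (induction n)
  case 0
  then show ?case by (simp add: lattice_pmf_def rows_pmf_def pair_return_pmf2 pmf.map_comp comp_def)
next
  case (Suc n)
  have "map_pmf (\<lambda>(xs, rs). lrows rs xs) (lattice_pmf a b p m (Suc n)) =
    do {xs \<leftarrow> conf_pmf a m; y \<leftarrow> bernoulli_pmf b; zs \<leftarrow> conf_pmf p m; rs \<leftarrow> rows_pmf b p m n;
        return_pmf (lrows rs (lrow y xs zs))}"
    by (simp add: lattice_pmf_def rows_pmf_Suc pair_pmf_def map_bind_pmf bind_assoc_pmf bind_return_pmf)
  also have "\<dots> = do {y \<leftarrow> bernoulli_pmf b; xs \<leftarrow> conf_pmf a m; zs \<leftarrow> conf_pmf p m; rs \<leftarrow> rows_pmf b p m n;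
      return_pmf (lrows rs (lrow y xs zs))}"
    by (rule bind_commute_pmf)
  also have "\<dots> = do {xs' \<leftarrow> do {y \<leftarrow> bernoulli_pmf b; xs \<leftarrow> conf_pmf a m; zs \<leftarrow> conf_pmf p m;
      return_pmf (lrow y xs zs)};
      rs \<leftarrow> rows_pmf b p m n; return_pmf (lrows rs xs')}"
    by (simp add: bind_assoc_pmf bind_return_pmf)
  also have "\<dots> = map_pmf (\<lambda>(xs, rs). lrows rs xs) (lattice_pmf a b p m n)"
    unfolding stationary_lrow[OF assms]
    by (simp add: lattice_pmf_def pair_pmf_def map_bind_pmf)
  also have "\<dots> = conf_pmf a m" by (rule Suc)
  finally show ?case .
qed

lemma map_fst_rows_pmf: "map_pmf (map fst) (rows_pmf b p m n) = conf_pmf b n"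
  by (simp add: rows_pmf_def map_replicate_pmf map_fst_pair_pmf conf_pmf_def)

lemma take_rows_pmf: "e \<le> n \<Longrightarrow> map_pmf (take e) (rows_pmf b p m n) = rows_pmf b p m e"
  by (simp add: rows_pmf_def map_take_replicate_pmf)

lemma take_conf_pmf: "e \<le> n \<Longrightarrow> map_pmf (take e) (conf_pmf b n) = conf_pmf b e"
  by (simp add: conf_pmf_def map_take_replicate_pmf)

lemma no_sinks_rows_pmf: "map_pmf no_sinks (rows_pmf b p m n) = rows_pmf 0 p m n"
proof -
  have "map_pmf (\<lambda>(y, zs). (False, zs)) (pair_pmf (bernoulli_pmf b) (conf_pmf p m)) =
      pair_pmf (map_pmf (\<lambda>_. False) (bernoulli_pmf b)) (map_pmf (\<lambda>x. x) (conf_pmf p m))"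
    by (rule map_pair)
  also have "map_pmf (\<lambda>_. False) (bernoulli_pmf b) = bernoulli_pmf 0"
  proof -
    have "map_pmf (\<lambda>_. False) (bernoulli_pmf b) = return_pmf False" by (simp add: map_pmf_const)
    also have "\<dots> = bernoulli_pmf 0"
    proof (rule pmf_eqI)
      show "pmf (return_pmf False) b = pmf (bernoulli_pmf 0) b" for b by (cases b) simp_all
    qed
    finally show ?thesis .
  qed
  finally show ?thesis by (simp add: rows_pmf_def map_replicate_pmf no_sinks_def)
qed

section \<open>Concentration of the stationary passage time\<close>

definition passage :: "bool list \<Rightarrow> (bool \<times> bool list) list \<Rightarrow> int" where
  "passage xs rs = heights rs (cnt xs) (length xs)"

lemma passage_eq:
  assumes "xs \<in> set_pmf (conf_pmf a m)" "rs \<in> set_pmf (rows_pmf b p m n)"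
  shows "passage xs rs = ntrue (map fst rs) + ntrue (lrows rs xs)"
  using heights_cnt[of rs xs "length xs" 0] length_conf_pmf[OF assms(1)] length_rows_pmf(2)[OF assms(2)]
  by (simp add: passage_def cnt_length)

lemma prob_pair_snd: "pprob (pair_pmf p q) {x. P (snd x)} = pprob q {y. P y}"
proof -
  have "pprob (map_pmf snd (pair_pmf p q)) {y. P y} = pprob (pair_pmf p q) {x. P (snd x)}"
    by (simp add: vimage_def)
  then show ?thesis by (simp add: map_snd_pair_pmf)
qed

lemma prob_pair_fst: "pprob (pair_pmf p q) {x. P (fst x)} = pprob p {y. P y}"
proof -
  have "pprob (map_pmf fst (pair_pmf p q)) {y. P y} = pprob (pair_pmf p q) {x. P (fst x)}"
    by (simp add: vimage_def)
  then show ?thesis by (simp add: map_fst_pair_pmf)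
qed

text \<open>Sinks and surviving particles are dependent, but each count is binomial, the second one
  by stationarity. Chebyshev for each and a union bound bypass the variance of the passage time; the
  price is the factor 2 in front of \<theta>.\<close>

lemma passage_deviation:
  fixes a b p \<theta> :: real
  assumes "stationary a b p" "\<theta> > 0"
  shows "pprob (lattice_pmf a b p m n) {(xs, rs). 2 * \<theta> \<le> \<bar>passage xs rs - (m * a + n * b)\<bar>} \<le>
      (m * a + n * b) / \<theta>\<^sup>2"
proof -
  let ?P = "pprob (lattice_pmf a b p m n)"
  have st: "0 \<le> a" "a \<le> 1" "0 \<le> b" "b \<le> 1" using assms by (auto simp: stationary_def)
  let ?A = "{w. \<theta> \<le> \<bar>ntrue (case w of (xs, rs) \<Rightarrow> lrows rs xs) - m * a\<bar>}"
  let ?B = "{w. \<theta> \<le> \<bar>ntrue (map fst (snd w)) - n * b\<bar>}"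
  have "?P {(xs, rs). 2 * \<theta> \<le> \<bar>passage xs rs - (m * a + n * b)\<bar>} \<le> ?P (?A \<union> ?B)"
    by (intro prob_mono_pmf) (auto simp: lattice_pmf_def passage_eq)
  also have "\<dots> \<le> ?P ?A + ?P ?B" by (rule measure_Un_le) auto
  also have "?P ?A = pprob (map_pmf (\<lambda>(xs, rs). lrows rs xs) (lattice_pmf a b p m n)) {xs. \<theta> \<le>
      \<bar>ntrue xs - m * a\<bar>}"
    by (simp add: vimage_def)
  also have "\<dots> \<le> m * a / \<theta>\<^sup>2"
    unfolding stationary_lrows[OF assms(1)] by (rule ntrue_conf_deviation) (use st assms in auto)
  also have "?P ?B = pprob (map_pmf (map fst) (rows_pmf b p m n)) {xs. \<theta> \<le> \<bar>ntrue xs - n * b\<bar>}"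
    unfolding lattice_pmf_def prob_pair_snd[of _ _ "\<lambda>rs. \<theta> \<le> \<bar>ntrue (map fst rs) - n * b\<bar>"]
        by (simp add: vimage_def)
  also have "\<dots> \<le> n * b / \<theta>\<^sup>2"
    unfolding map_fst_rows_pmf by (rule ntrue_conf_deviation) (use st assms in auto)
  finally show ?thesis by (simp add: add_divide_distrib)
qed

subsection \<open>Growth in time and the second class particle\<close>

definition mean_passage :: "real \<Rightarrow> real \<Rightarrow> real \<Rightarrow> nat \<Rightarrow> nat \<Rightarrow> real" where
  "mean_passage a b p m n = pexp (lattice_pmf a b p m n) (\<lambda>(xs, rs). real_of_int (passage xs rs))"

text \<open>The lattice counterpart of \<open>P(X'\<^sub>t > x)\<close>: the processes with and
  without the first source agree on the first \<open>m\<close> columns when the second class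
  particle has moved beyond them.\<close>

definition merge_prob :: "real \<Rightarrow> real \<Rightarrow> real \<Rightarrow> nat \<Rightarrow> nat \<Rightarrow> real" where
  "merge_prob a b p m n = pprob (lattice_pmf a b p m n) {(xs, rs). lrows rs xs = lrows rs (drop_first xs)}"

lemma expectation_lattice:
  "pexp (lattice_pmf a b p m n) (\<lambda>(xs, rs). f xs rs :: real) =
   pexp (conf_pmf a m) (\<lambda>xs. pexp (rows_pmf b p m n) (f xs))"
  by (simp add: lattice_pmf_def expectation_pair)

lemma mean_passage_eq:
  assumes "0 \<le> b" "b \<le> 1"
  shows "mean_passage a b p m n = n * b +
     pexp (lattice_pmf a b p m n) (\<lambda>(xs, rs). real_of_int (ntrue (lrows rs xs)))"
proof -
  have "mean_passage a b p m n = pexp (lattice_pmf a b p m n)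
      (\<lambda>w. real_of_int (ntrue (map fst (snd w))) + (case w of (xs, rs) \<Rightarrow> real_of_int (ntrue (lrows rs xs))))"
    unfolding mean_passage_def
    by (intro expectation_cong_pmf) (auto simp: lattice_pmf_def passage_eq)
  also have "\<dots> = pexp (lattice_pmf a b p m n) (\<lambda>w. real_of_int (ntrue (map fst (snd w)))) +
      pexp (lattice_pmf a b p m n) (\<lambda>(xs, rs). real_of_int (ntrue (lrows rs xs)))"
    by (rule Bochner_Integration.integral_add) auto
  also have "pexp (lattice_pmf a b p m n) (\<lambda>w. real_of_int (ntrue (map fst (snd w)))) =
      pexp (map_pmf (map fst) (rows_pmf b p m n)) (\<lambda>ys. real_of_int (ntrue ys))"
    unfolding lattice_pmf_def by (simp add: expectation_pair)
  also have "\<dots> = n * b"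
    unfolding map_fst_rows_pmf by (rule expectation_ntrue_conf[OF assms])
  finally show ?thesis .
qed

lemma mean_passage_stationary:
  assumes "stationary a b p"
  shows "mean_passage a b p m n = m * a + n * b"
proof -
  have "pexp (lattice_pmf a b p m n) (\<lambda>(xs, rs). real_of_int (ntrue (lrows rs xs))) =
     pexp (map_pmf (\<lambda>(xs, rs). lrows rs xs) (lattice_pmf a b p m n)) (\<lambda>xs. real_of_int (ntrue xs))"
    by (simp add: case_prod_unfold)
  also have "\<dots> = m * a" unfolding stationary_lrows[OF assms]
    using assms by (intro expectation_ntrue_conf) (auto simp: stationary_def)
  finally show ?thesis using assms mean_passage_eq[of b a p m n] by (simp add: stationary_def)
qed

lemma prob_point_conf_le:
  assumes "0 \<le> p" "p \<le> 1"
  shows "pprob (conf_pmf p m) {zs. \<exists>z\<in>set zs. z} \<le> m * p"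
proof -
  have "1 \<le> ntrue zs" if "z \<in> set zs" "z" for z zs
    using that by (induction zs) auto
  then have "pprob (conf_pmf p m) {zs. \<exists>z\<in>set zs. z} \<le> pexp (conf_pmf p m) (\<lambda>zs. real_of_int (ntrue zs))"
    by (intro prob_le_expectation) (auto simp: indicator_def)
  then show ?thesis using expectation_ntrue_conf[OF assms] by simp
qed

text \<open>If the sinks of the first row had the stationary intensity \<open>bs\<close>, the first row would reproduce the law
  of the sources and only shift the passage time.  The correction for the intensity \<open>b\<close> is the effect
  of a single sink at the origin, that is, of a dual second class particle.\<close>

lemma mean_passage_Suc:
  assumes st: "stationary a bs p" and b: "0 \<le> b" "b \<le> 1"
  obtains w where "mean_passage a b p m (Suc n) - mean_passage a b p m n = b + (bs - b) * w"
    "\<bar>w - (1 - merge_prob a b p m n)\<bar> \<le> m * p"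
proof -
  have ineq: "0 \<le> p" "p \<le> 1" "0 \<le> bs" "bs \<le> 1" using st by (auto simp: stationary_def)
  define Ex Ez where "Ex = pexp (conf_pmf a m)"
    and "Ez = pexp (conf_pmf p m)"
  define Er where "Er = pexp (rows_pmf b p m n)"
  note E_defs = Ex_def Ez_def Er_def
  define W where "W y = Ex (\<lambda>xs. Ez (\<lambda>zs. Er (\<lambda>rs. real_of_int (ntrue (lrows rs (lrow y xs zs))))))" for y
  define Q where "Q n = pexp (lattice_pmf a b p m n) (\<lambda>(xs, rs). real_of_int (ntrue (lrows rs xs)))" for n
  have Q_Suc: "Q (Suc n) = b * W True + (1 - b) * W False"
    unfolding Q_def W_def expectation_lattice using b
    by (simp add: rows_pmf_Suc expectation_bind E_defs)
  have "Q n = pexp (conf_pmf a m) (\<lambda>xs. Er (\<lambda>rs. real_of_int (ntrue (lrows rs xs))))"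
    by (simp add: Q_def expectation_lattice E_defs)
  \<comment> \<open>\<open>stationary_lrow\<close> is read from right to left: the sources are
    regarded as the output of an additional first row with sinks of density
    \<open>bs\<close>.\<close>
  also have "\<dots> = bs * W True + (1 - bs) * W False"
    unfolding W_def using ineq
    by (subst stationary_lrow[OF st, symmetric]) (simp add: expectation_bind E_defs)
  finally have Q: "Q n = bs * W True + (1 - bs) * W False" .
  define d where "d xs xs' = (\<lambda>rs. of_bool (lrows rs xs \<noteq> lrows rs xs') :: real)" for xs xs'
  have diff: "W False - W True = Ex (\<lambda>xs. Ez (\<lambda>zs. Er (d (lrow False xs zs) (lrow True xs zs))))"
  proof -
    have "real_of_int (ntrue (lrows rs (lrow False xs zs))) - real_of_int (ntrue (lrows rs (lrow True xs zs))) =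
      d (lrow False xs zs) (lrow True xs zs) rs" for rs xs zs
      using ntrue_diff[OF discrepancy_lrows[OF discrepancy_lrow_same[of xs zs], of rs]]
      by (simp add: d_def flip: of_int_diff)
    then show ?thesis
      by (simp add: W_def E_defs flip: Bochner_Integration.integral_diff)
  qed
  have merge: "1 - merge_prob a b p m n = Ex (\<lambda>xs. Ez (\<lambda>zs. Er (d xs (drop_first xs))))"
  proof -
    have "1 - merge_prob a b p m n = pprob (lattice_pmf a b p m n) (- {(xs, rs). lrows rs xs =
        lrows rs (drop_first xs)})"
      using measure_pmf.prob_compl[of "{(xs, rs). lrows rs xs = lrows rs (drop_first xs)}"
          "lattice_pmf a b p m n"]
      by (simp add: merge_prob_def Compl_eq_Diff_UNIV)
    also have "\<dots> = pexp (lattice_pmf a b p m n) (indicator (- {(xs, rs). lrows rs xs =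
        lrows rs (drop_first xs)}))" by simp
    also have "\<dots> = pexp (lattice_pmf a b p m n) (\<lambda>(xs, rs). d xs (drop_first xs) rs)"
      by (intro expectation_cong_pmf) (auto simp: d_def indicator_def)
    also have "\<dots> = Ex (\<lambda>xs. Ez (\<lambda>zs. Er (d xs (drop_first xs))))"
      unfolding expectation_lattice by (simp add: E_defs)
    finally show ?thesis .
  qed
  have d01: "0 \<le> d xs xs' rs" "d xs xs' rs \<le> 1" for xs xs' rs by (auto simp: d_def)
  have Er01: "0 \<le> Er (d xs xs')" "Er (d xs xs') \<le> 1" for xs xs'
    using expectation_mono_pmf[of "rows_pmf b p m n" "\<lambda>_. 0"
        "d xs xs'"] expectation_mono_pmf[of "rows_pmf b p m n" "d xs xs'" "\<lambda>_. 1"] d01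
    by (auto simp: E_defs)
  let ?D = "\<lambda>xs zs. Er (d (lrow False xs zs) (lrow True xs zs)) - Er (d xs (drop_first xs))"
  have "W False - W True - (1 - merge_prob a b p m n) = Ex (\<lambda>xs. Ez (?D xs))"
    unfolding diff merge by (simp add: E_defs)
  moreover have "\<bar>Ex (\<lambda>xs. Ez (?D xs))\<bar> \<le> m * p"
  proof -
    \<comment> \<open>Without points in the first row the two comparisons coincide by
      \<open>lrow_no_points\<close>; otherwise the difference of two probabilities is at most
      1.\<close>
    have D: "\<bar>?D xs zs\<bar> \<le> indicator {zs. \<exists>z\<in>set zs. z} zs"
      if "xs \<in> set_pmf (conf_pmf a m)" "zs \<in> set_pmf (conf_pmf p m)" for xs zs
    proof (cases "\<exists>z\<in>set zs. z")
      case True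
      then show ?thesis using Er01[of "lrow False xs zs" "lrow True xs zs"] Er01[of xs "drop_first xs"]
          by (auto simp: indicator_def)
    next
      case False
      then show ?thesis using lrow_no_points[of zs xs] that by (simp add: length_conf_pmf)
    qed
    have Ez: "\<bar>Ez (?D xs)\<bar> \<le> m * p" if "xs \<in> set_pmf (conf_pmf a m)" for xs
    proof -
      have "\<bar>Ez (?D xs)\<bar> \<le> Ez (\<lambda>zs. \<bar>?D xs zs\<bar>)" unfolding E_defs by (rule integral_abs_bound)
      also have "\<dots> \<le> Ez (indicator {zs. \<exists>z\<in>set zs. z})"
        unfolding Ez_def by (intro expectation_mono_pmf D that) auto
      also have "\<dots> \<le> m * p" using prob_point_conf_le[of p m] ineq by (simp add: Ez_def)
      finally show ?thesis .
    qed
    have "\<bar>Ex (\<lambda>xs. Ez (?D xs))\<bar> \<le> Ex (\<lambda>xs. \<bar>Ez (?D xs)\<bar>)" unfolding Ex_def by (rule integral_abs_bound)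
    also have "\<dots> \<le> Ex (\<lambda>_. m * p)" unfolding Ex_def by (intro expectation_mono_pmf Ez) auto
    finally show ?thesis by (simp add: Ex_def)
  qed
  moreover have "mean_passage a b p m (Suc n) - mean_passage a b p m n = b + (bs - b) * (W False - W True)"
    using mean_passage_eq[OF b, of a p m "Suc n"] mean_passage_eq[OF b, of a p m n] Q Q_Suc
    by (simp add: Q_def[symmetric] algebra_simps)
  ultimately show ?thesis using that[of "W False - W True"] by simp
qed

text \<open>Merged configurations stay merged when a later row is appended. As
  \<open>replicate_pmf\<close> grows at the front, the new row is first moved to the end.\<close>

lemma merge_prob_Suc: "merge_prob a b p m n \<le> merge_prob a b p m (Suc n)"
proof -
  let ?A = "\<lambda>n. pexp (lattice_pmf a b p m n) (\<lambda>(xs, rs). of_bool (lrows rs xs =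
      lrows rs (drop_first xs)) :: real)"
  have eq: "merge_prob a b p m n = ?A n" for n
  proof -
    have "merge_prob a b p m n = pexp (lattice_pmf a b p m n) (indicator {(xs, rs). lrows rs xs =
        lrows rs (drop_first xs)})"
      by (simp add: merge_prob_def)
    also have "\<dots> = ?A n" by (intro expectation_cong_pmf) (auto simp: indicator_def)
    finally show ?thesis .
  qed
  have "?A n \<le> ?A (Suc n)"
    unfolding expectation_lattice
  proof (intro expectation_mono_pmf fin_pmfs)
    fix xs
    let ?p = "pair_pmf (bernoulli_pmf b) (conf_pmf p m)"
    let ?e = "\<lambda>rs. of_bool (lrows rs xs = lrows rs (drop_first xs)) :: real"
    have "pexp (rows_pmf b p m (Suc n)) ?e =
      pexp (rows_pmf b p m n) (\<lambda>rs. pexp ?p (\<lambda>r. ?e (rs @ [r])))"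
      unfolding rows_pmf_def replicate_pmf_Suc_right by (simp add: expectation_bind)
    moreover have "pexp (rows_pmf b p m n) ?e \<le> \<dots>"
    proof (intro expectation_mono_pmf fin_pmfs)
      fix rs
      have "?e rs = pexp ?p (\<lambda>r. ?e rs)" by simp
      also have "\<dots> \<le> pexp ?p (\<lambda>r. ?e (rs @ [r]))"
        by (intro expectation_mono_pmf) auto
      finally show "?e rs \<le> pexp ?p (\<lambda>r. ?e (rs @ [r]))" .
    qed
    ultimately show "pexp (rows_pmf b p m n) ?e \<le> pexp (rows_pmf b p m (Suc n)) ?e" by simp
  qed
  then show ?thesis by (simp add: eq)
qed

lemma merge_prob_mono: "n1 \<le> n2 \<Longrightarrow> merge_prob a b p m n1 \<le> merge_prob a b p m n2"
  by (rule lift_Suc_mono_le[of "merge_prob a b p m"]) (rule merge_prob_Suc)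

text \<open>Telescoping over single rows. By monotonicity of \<open>merge_prob\<close> its value at
  \<open>n1\<close> serves for all upper bounds and its value at \<open>n2\<close> for all lower
  bounds, which takes the place of differentiation in time.\<close>

lemma mean_passage_increment:
  assumes st: "stationary a bs p" and b: "0 \<le> b" "b \<le> bs" and n: "n1 \<le> n2"
  shows "mean_passage a b p m n2 - mean_passage a b p m n1 \<le>
      (real n2 - real n1) * (b + (bs - b) * (1 - merge_prob a b p m n1 + m * p))"
    and "mean_passage a b p m n2 - mean_passage a b p m n1 \<ge> (real n2 - real n1) *
        (b + (bs - b) * (1 - merge_prob a b p m n2 - m * p))"
proof -
  have b1: "b \<le> 1" using st b by (auto simp: stationary_def)
  have up: "mean_passage a b p m (Suc k) - mean_passage a b p m k \<le>
      b + (bs - b) * (1 - merge_prob a b p m k + m * p)" (is "?U k")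
    and lo: "mean_passage a b p m (Suc k) - mean_passage a b p m k \<ge> b + (bs - b) *
        (1 - merge_prob a b p m k - m * p)" (is "?L k") for k
  proof -
    obtain w where w: "mean_passage a b p m (Suc k) - mean_passage a b p m k = b + (bs - b) * w"
      "\<bar>w - (1 - merge_prob a b p m k)\<bar> \<le> m * p"
      by (rule mean_passage_Suc[OF st b(1) b1])
    show "?U k" "?L k" unfolding w(1) using w(2) b by (auto intro!: mult_left_mono)
  qed
  have mono: "k \<le> l \<Longrightarrow> b + (bs - b) * (1 - merge_prob a b p m l + c) \<le>
      b + (bs - b) * (1 - merge_prob a b p m k + c)" for k l c
    using b merge_prob_mono[of k l a b p m] by (intro add_left_mono mult_left_mono) auto
  show "mean_passage a b p m n2 - mean_passage a b p m n1 \<le>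
      (real n2 - real n1) * (b + (bs - b) * (1 - merge_prob a b p m n1 + m * p))"
    using n
  proof (induction n2 rule: dec_induct)
    case (step k)
    then show ?case using up[of k] mono[of n1 k "m * p"]
      by (simp add: algebra_simps)
  qed simp
  have "mean_passage a b p m n - mean_passage a b p m n1 \<ge> (real n - real n1) *
      (b + (bs - b) * (1 - merge_prob a b p m n2 - m * p))"
    if "n1 \<le> n" "n \<le> n2" for n
    using that
  proof (induction n rule: dec_induct)
    case (step k)
    then show ?case using lo[of k] mono[of k n2 "- (m * p)"]
      by (simp add: algebra_simps)
  qed simp
  then show "mean_passage a b p m n2 - mean_passage a b p m n1 \<ge> (real n2 - real n1) *
      (b + (bs - b) * (1 - merge_prob a b p m n2 - m * p))"
    using n by blast
qed

subsection \<open>Monotonicity in the intensities\<close>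

lemma cnt_mono: "list_all2 (\<le>) xs xs' \<Longrightarrow> cnt xs i \<le> cnt xs' i"
  using cnt_diff_mono[of xs xs' 0 i] by simp

lemma passage_mono: "list_all2 (\<le>) xs xs' \<Longrightarrow> rows_le rs rs' \<Longrightarrow> passage xs rs \<le> passage xs' rs'"
  unfolding passage_def list_all2_lengthD[of "(\<le>)" xs xs'] by (intro heights_mono cnt_mono)

lemma rel_conf_pmf: "0 \<le> a \<Longrightarrow> a \<le> a' \<Longrightarrow> a' \<le> 1 \<Longrightarrow> rel_pmf (list_all2 (\<le>)) (conf_pmf a m) (conf_pmf a' m)"
  unfolding conf_pmf_def by (intro rel_replicate_pmf rel_bernoulli_pmf)

lemma rel_rows_pmf:
  assumes "0 \<le> b" "b \<le> b'" "b' \<le> 1"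
  shows "rel_pmf rows_le (rows_pmf b p m n) (rows_pmf b' p m n)"
proof -
  have "rel_pmf (rel_prod (\<le>) (=)) (pair_pmf (bernoulli_pmf b) (conf_pmf p m))
      (pair_pmf (bernoulli_pmf b') (conf_pmf p m))"
    using assms by (intro rel_pair_pmf rel_bernoulli_pmf) (auto simp: pmf.rel_eq)
  moreover have "rel_prod (\<le>) (=) = (\<lambda>(r :: bool \<times> bool list) r'. fst r \<le> fst r' \<and> snd r = snd r')"
    by (auto simp: fun_eq_iff rel_prod_conv)
  ultimately show ?thesis unfolding rows_le_def rows_pmf_def
    by (intro rel_replicate_pmf) simp
qed

lemma mean_passage_le:
  assumes "stationary a' b' p" "0 \<le> a" "a \<le> a'" "0 \<le> b" "b \<le> b'"
  shows "mean_passage a b p m n \<le> m * a' + n * b'"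
proof -
  have "mean_passage a b p m n \<le> mean_passage a' b' p m n"
    unfolding mean_passage_def lattice_pmf_def
  proof (rule expectation_mono_rel)
    show "rel_pmf (rel_prod (list_all2 (\<le>)) rows_le) (pair_pmf (conf_pmf a m) (rows_pmf b p m n))
        (pair_pmf (conf_pmf a' m) (rows_pmf b' p m n))"
      using assms by (intro rel_pair_pmf rel_conf_pmf rel_rows_pmf) (auto simp: stationary_def)
  qed (auto intro: passage_mono)
  then show ?thesis using mean_passage_stationary[OF assms(1)] by simp
qed

subsection \<open>The last exit from the axes\<close>

lemma take_cnt: "e \<le> length xs \<Longrightarrow> cnt xs e = ntrue (take e xs)"
  by (simp add: cnt_def ntrue_def)

lemma cnt_deviation:
  fixes a \<theta> :: real
  assumes "0 \<le> a" "a \<le> 1" "\<theta> > 0" "e \<le> m"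
  shows "pprob (conf_pmf a m) {xs. \<theta> \<le> \<bar>cnt xs e - e * a\<bar>} \<le> e * a / \<theta>\<^sup>2"
proof -
  have "pprob (conf_pmf a m) {xs. \<theta> \<le> \<bar>cnt xs e - e * a\<bar>} \<le> pprob (map_pmf (take e) (conf_pmf a m)) {xs. \<theta> \<le>
      \<bar>ntrue xs - e * a\<bar>}"
    using assms by (simp add: vimage_def) (intro prob_mono_pmf, auto simp: take_cnt length_conf_pmf)
  then show ?thesis
    using ntrue_conf_deviation[of a \<theta> e] assms by (simp add: take_conf_pmf)
qed

lemma sinks_deviation:
  fixes b \<theta> :: real
  assumes "0 \<le> b" "b \<le> 1" "\<theta> > 0" "e \<le> n"
  shows "pprob (rows_pmf b p m n) {rs. \<theta> \<le> \<bar>ntrue (map fst (take e rs)) - e * b\<bar>} \<le> e * b / \<theta>\<^sup>2"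
proof -
  have "map_pmf (\<lambda>rs. map fst (take e rs)) (rows_pmf b p m n) = conf_pmf b e"
    using take_rows_pmf[OF assms(4), of b p m] map_fst_rows_pmf[of b p m e]
    by (metis (no_types, lifting) ext pmf.map_comp comp_def)
  then have "pprob (rows_pmf b p m n) {rs. \<theta> \<le> \<bar>ntrue (map fst (take e rs)) - e * b\<bar>} =
      pprob (conf_pmf b e) {xs. \<theta> \<le> \<bar>ntrue xs - e * b\<bar>}"
    by (metis (mono_tags, lifting) measure_map_pmf vimage_Collect_eq Collect_cong)
  then show ?thesis using ntrue_conf_deviation[of b \<theta> e] assms by simp
qed

lemma measure_Un3_le:
  assumes "A \<subseteq> B1 \<union> B2 \<union> B3"
  shows "pprob p A \<le> pprob p B1 + pprob p B2 + pprob p B3"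
proof -
  have "pprob p A \<le> pprob p (B1 \<union> B2 \<union> B3)" by (intro measure_pmf.finite_measure_mono assms) auto
  also have "\<dots> \<le> pprob p (B1 \<union> B2) + pprob p B3" by (rule measure_Un_le) auto
  also have "\<dots> \<le> pprob p B1 + pprob p B2 + pprob p B3" by (intro add_right_mono measure_Un_le) auto
  finally show ?thesis .
qed

lemma map_no_sinks_lattice: "map_pmf (\<lambda>(xs, rs). (xs, no_sinks rs)) (lattice_pmf a b p m n) =
    lattice_pmf a 0 p m n"
  unfolding lattice_pmf_def map_pair[of "\<lambda>x. x" no_sinks] no_sinks_rows_pmf by simp

text \<open>Sprinkling: raising the density of the sources from \<open>a\<close> to \<open>a'\<close> rewards a late exit linearly in \<open>a' - a\<close>,
  while the stationary passage time changes only quadratically in the characteristic direction.\<close>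

lemma late_source_exit:
  fixes a a' b b' p \<theta> c :: real
  assumes st: "stationary a' b' p" and a: "0 \<le> a" "a \<le> a'" and e: "e \<le> m" and \<theta>: "\<theta> > 0"
    and c: "m * a' + n * b' + 4 * \<theta> \<le> c + e * (a' - a)"
  shows "pprob (lattice_pmf a b p m n)
    {(xs, rs). heights (no_sinks rs) (\<lambda>_. 0) m + cnt xs e < heights (no_sinks rs) (cnt xs) m \<and> c \<le>
        heights (no_sinks rs) (cnt xs) m}
    \<le> (m * a' + n * b' + e * a' + e * a) / \<theta>\<^sup>2" (is "pprob _ ?A \<le> _")
proof -
  have st': "0 \<le> a'" "a' \<le> 1" "a \<le> 1" using st a by (auto simp: stationary_def)
  \<comment> \<open>The event depends on the rows only through \<open>no_sinks\<close>, so the sink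
    density may be changed, in particular to the value \<open>b'\<close> that is stationary with
    \<open>a'\<close>.\<close>
  have inv: "pprob (lattice_pmf a b p m n) ?A = pprob (lattice_pmf a 0 p m n) ?A" for b
  proof -
    have "pprob (map_pmf (\<lambda>(xs, rs). (xs, no_sinks rs)) (lattice_pmf a b p m n)) ?A =
        pprob (lattice_pmf a b p m n) ?A"
      by (auto simp: vimage_def case_prod_unfold)
    then show ?thesis unfolding map_no_sinks_lattice by simp
  qed
  obtain pq where pq: "\<And>x y. (x, y) \<in> set_pmf pq \<Longrightarrow> list_all2 (\<le>) x y" "map_pmf fst pq = conf_pmf a m"
      "map_pmf snd pq = conf_pmf a' m"
    using rel_conf_pmf[OF a st'(2), of m] by (auto elim!: rel_pmf.cases)
  define J where "J = pair_pmf pq (rows_pmf b' p m n)"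
  have J1: "map_pmf (\<lambda>(w, rs). (fst w, rs)) J = lattice_pmf a b' p m n"
    unfolding J_def lattice_pmf_def pq(2)[symmetric] map_pair[of fst "\<lambda>x. x"] by simp
  have J2: "map_pmf (\<lambda>(w, rs). (snd w, rs)) J = lattice_pmf a' b' p m n"
    unfolding J_def lattice_pmf_def pq(3)[symmetric] map_pair[of snd "\<lambda>x. x"] by simp
  \<comment> \<open>The margin 4 \<theta> of the hypothesis is spent as 2 \<theta> on the passage
    time and \<theta> on each of the two counts.\<close>
  let ?B1 = "{w. 2 * \<theta> \<le> \<bar>passage (snd (fst w)) (snd w) - (m * a' + n * b')\<bar>}"
  let ?B2 = "{w. \<theta> \<le> \<bar>cnt (snd (fst w)) e - e * a'\<bar>}"
  let ?B3 = "{w. \<theta> \<le> \<bar>cnt (fst (fst w)) e - e * a\<bar>}"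
  have "pprob (lattice_pmf a b p m n) ?A = pprob (map_pmf (\<lambda>(w, rs). (fst w, rs)) J) ?A"
    unfolding J1 inv[of b] inv[of b'] ..
  also have "\<dots> = pprob J {w. (fst (fst w), snd w) \<in> ?A}" by (simp add: vimage_def case_prod_unfold)
  also have "\<dots> \<le> pprob J (?B1 \<union> ?B2 \<union> ?B3)"
  proof (rule prob_mono_pmf)
    fix w assume w: "w \<in> set_pmf J" "w \<in> {w. (fst (fst w), snd w) \<in> ?A}"
    obtain xs xs' rs where [simp]: "w = ((xs, xs'), rs)" by (cases w; cases "fst w") auto
    have le: "list_all2 (\<le>) xs xs'" using w pq(1) by (auto simp: J_def)
    have "xs' \<in> set_pmf (conf_pmf a' m)" using w unfolding pq(3)[symmetric] by (force simp: J_def)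
    then have len: "length xs' = m" by (rule length_conf_pmf)
    have "heights (no_sinks rs) (cnt xs) m \<le> heights (no_sinks rs) (cnt xs') m - (cnt xs' e - cnt xs e)"
      using heights_sources_split[OF le, of rs m e] w(2) by auto
    also have "heights (no_sinks rs) (cnt xs') m \<le> passage xs' rs"
      unfolding passage_def len by (intro heights_mono) auto
    finally have "c \<le> passage xs' rs - (cnt xs' e - cnt xs e)" using w(2) by auto
    then show "w \<in> ?B1 \<union> ?B2 \<union> ?B3" using c \<theta> by (auto simp: algebra_simps)
  qed
  also have "\<dots> \<le> pprob J ?B1 + pprob J ?B2 + pprob J ?B3" by (rule measure_Un3_le) simp
  also have "pprob J ?B1 = pprob (map_pmf (\<lambda>(w, rs). (snd w, rs)) J) {(xs, rs). 2 * \<theta> \<le>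
      \<bar>passage xs rs - (m * a' + n * b')\<bar>}"
    by (simp add: vimage_def case_prod_unfold)
  also have "\<dots> \<le> (m * a' + n * b') / \<theta>\<^sup>2"
    unfolding J2 by (rule passage_deviation[OF st \<theta>])
  also have "pprob J ?B2 = pprob (map_pmf snd pq) {xs. \<theta> \<le> \<bar>cnt xs e - e * a'\<bar>}"
    unfolding J_def prob_pair_fst[of _ _ "\<lambda>w. \<theta> \<le> \<bar>cnt (snd w) e - e * a'\<bar>"] by (simp add: vimage_def)
  also have "\<dots> \<le> e * a' / \<theta>\<^sup>2" unfolding pq by (rule cnt_deviation) (use st' \<theta> e in auto)
  also have "pprob J ?B3 = pprob (map_pmf fst pq) {xs. \<theta> \<le> \<bar>cnt xs e - e * a\<bar>}"
    unfolding J_def prob_pair_fst[of _ _ "\<lambda>w. \<theta> \<le> \<bar>cnt (fst w) e - e * a\<bar>"] by (simp add: vimage_def)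
  also have "\<dots> \<le> e * a / \<theta>\<^sup>2" unfolding pq by (rule cnt_deviation) (use st' a \<theta> e in auto)
  finally show ?thesis by (simp add: add_divide_distrib)
qed

text \<open>Sprinkling on the other axis. The rows with few and with many sinks are coupled in
  \<open>pq\<close>; independent sources of density \<open>a'\<close> are added for the comparison
  with the stationary passage time.\<close>

lemma late_sink_exit:
  fixes a a' b b' p \<theta> c :: real
  assumes st: "stationary a' b' p" and b: "0 \<le> b" "b \<le> b'" and e: "e \<le> n" and \<theta>: "\<theta> > 0"
    and c: "m * a' + n * b' + 4 * \<theta> \<le> c + e * (b' - b)"
  shows "pprob (rows_pmf b p m n)
    {rs. heights (no_sinks rs) (\<lambda>_. 0) m + ntrue (map fst (take e rs)) < heights rs (\<lambda>_. 0) m \<and> c \<le>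
        heights rs (\<lambda>_. 0) m}
    \<le> (m * a' + n * b' + e * b' + e * b) / \<theta>\<^sup>2" (is "pprob _ ?A \<le> _")
proof -
  have st': "0 \<le> b'" "b' \<le> 1" "b \<le> 1" using st b by (auto simp: stationary_def)
  obtain pq where pq: "\<And>x y. (x, y) \<in> set_pmf pq \<Longrightarrow> rows_le x y" "map_pmf fst pq = rows_pmf b p m n"
      "map_pmf snd pq = rows_pmf b' p m n"
    using rel_rows_pmf[OF b st'(2), of p m n] by (auto elim!: rel_pmf.cases)
  define J where "J = pair_pmf (conf_pmf a' m) pq"
  have J2: "map_pmf (\<lambda>(xs, w). (xs, snd w)) J = lattice_pmf a' b' p m n"
    unfolding J_def lattice_pmf_def pq(3)[symmetric] map_pair[of "\<lambda>x. x" snd] by simp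
  let ?B1 = "{w. 2 * \<theta> \<le> \<bar>passage (fst w) (snd (snd w)) - (m * a' + n * b')\<bar>}"
  let ?B2 = "{w. \<theta> \<le> \<bar>ntrue (map fst (take e (snd (snd w)))) - e * b'\<bar>}"
  let ?B3 = "{w. \<theta> \<le> \<bar>ntrue (map fst (take e (fst (snd w)))) - e * b\<bar>}"
  have "pprob (rows_pmf b p m n) ?A = pprob pq {w. fst w \<in> ?A}"
    unfolding pq(2)[symmetric] by (simp add: vimage_def)
  also have "\<dots> = pprob J {w. fst (snd w) \<in> ?A}"
    unfolding J_def prob_pair_snd[of _ _ "\<lambda>w. fst w \<in> ?A"] ..
  also have "\<dots> \<le> pprob J (?B1 \<union> ?B2 \<union> ?B3)"
  proof (rule prob_mono_pmf)
    fix w assume w: "w \<in> set_pmf J" "w \<in> {w. fst (snd w) \<in> ?A}"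
    obtain xs rs rs' where [simp]: "w = (xs, (rs, rs'))" by (cases w; cases "snd w") auto
    have le: "rows_le rs rs'" using w pq(1) by (auto simp: J_def)
    have len: "length xs = m" using w by (auto simp: J_def intro: length_conf_pmf)
    have le12: "rows_le (take e rs) (take e rs')" "rows_le (drop e rs) (drop e rs')"
      using le by (auto simp: rows_le_def)
    have "heights rs (\<lambda>_. 0) m \<le> heights rs' (\<lambda>_. 0) m -
        (ntrue (map fst (take e rs')) - ntrue (map fst (take e rs)))"
      using heights_sinks_split[OF le12, of m, unfolded append_take_drop_id] w(2) by auto
    also have "heights rs' (\<lambda>_. 0) m \<le> passage xs rs'"
      unfolding passage_def len by (intro heights_mono) auto
    finally have "c \<le> passage xs rs' - (ntrue (map fst (take e rs')) - ntrue (map fst (take e rs)))"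
        using w(2) by auto
    then show "w \<in> ?B1 \<union> ?B2 \<union> ?B3" using c \<theta> by (auto simp: algebra_simps)
  qed
  also have "\<dots> \<le> pprob J ?B1 + pprob J ?B2 + pprob J ?B3" by (rule measure_Un3_le) simp
  also have "pprob J ?B1 = pprob (map_pmf (\<lambda>(xs, w). (xs, snd w)) J) {(xs, rs). 2 * \<theta> \<le>
      \<bar>passage xs rs - (m * a' + n * b')\<bar>}"
    by (simp add: vimage_def case_prod_unfold)
  also have "\<dots> \<le> (m * a' + n * b') / \<theta>\<^sup>2"
    unfolding J2 by (rule passage_deviation[OF st \<theta>])
  also have "pprob J ?B2 = pprob (map_pmf snd pq) {rs. \<theta> \<le> \<bar>ntrue (map fst (take e rs)) - e * b'\<bar>}"
    unfolding J_def prob_pair_snd[of _ _ "\<lambda>w. \<theta> \<le> \<bar>ntrue (map fst (take e (snd w))) - e * b'\<bar>"]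
        by (simp add: vimage_def)
  also have "\<dots> \<le> e * b' / \<theta>\<^sup>2" unfolding pq by (rule sinks_deviation) (use st' \<theta> e in auto)
  also have "pprob J ?B3 = pprob (map_pmf fst pq) {rs. \<theta> \<le> \<bar>ntrue (map fst (take e rs)) - e * b\<bar>}"
    unfolding J_def prob_pair_snd[of _ _ "\<lambda>w. \<theta> \<le> \<bar>ntrue (map fst (take e (fst w))) - e * b\<bar>"]
        by (simp add: vimage_def)
  also have "\<dots> \<le> e * b / \<theta>\<^sup>2" unfolding pq by (rule sinks_deviation) (use st' b \<theta> e in auto)
  finally show ?thesis by (simp add: add_divide_distrib)
qed

text \<open>The stationary passage time is typically above \<open>c\<close>, and a path along the
  sources or one along the sinks attains it. With high probability such a path leaves its axis by
  \<open>e1\<close> or \<open>e2\<close>, so all but about \<open>e1 * a\<close> or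
  \<open>e2 * b\<close> is collected from points. The 6 \<theta> in the hypotheses is the margin 4
  \<theta> of the exit lemmas plus the 2 \<theta> by which \<open>c\<close> lies below the
  mean.\<close>

lemma prob_points_passage:
  fixes a b p a1 b1 a2 b2 \<theta> C :: real and m n e1 e2 :: nat
  assumes st: "stationary a b p" "stationary a1 b1 p" "stationary a2 b2 p"
    and le: "a \<le> a1" "b \<le> b2" and e: "e1 \<le> m" "e2 \<le> n" and \<theta>: "\<theta> > 0"
    and c1: "m * a1 + n * b1 + 6 * \<theta> \<le> m * a + n * b + e1 * (a1 - a)"
    and c2: "m * a2 + n * b2 + 6 * \<theta> \<le> m * a + n * b + e2 * (b2 - b)"
    and C: "m * a + n * b \<le> C" "m * a1 + n * b1 \<le> C" "m * a2 + n * b2 \<le> C"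
  shows "pprob (rows_pmf 0 p m n) {rs. m * a + n * b - 3 * \<theta> - e1 * a - e2 * b \<le> heights rs (\<lambda>_. 0) m} \<ge> 1 -
      8 * C / \<theta>\<^sup>2"
proof -
  have st': "0 \<le> a" "0 \<le> b" "a \<le> 1" "b \<le> 1" "0 \<le> a1" "0 \<le> b1" "0 \<le> a2" "0 \<le> b2" using st
      by (auto simp: stationary_def)
  define c where "c = m * a + n * b - 2 * \<theta>"
  let ?J = "lattice_pmf a b p m n"
  let ?P = "pprob ?J"
  let ?G = "{rs. m * a + n * b - 3 * \<theta> - e1 * a - e2 * b \<le> heights rs (\<lambda>_. 0) m}"
  let ?S = "{(xs, rs). heights (no_sinks rs) (\<lambda>_. 0) m + cnt xs e1 < heights (no_sinks rs) (cnt xs) m \<and> c \<le>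
      heights (no_sinks rs) (cnt xs) m}"
  let ?T = "{rs. heights (no_sinks rs) (\<lambda>_. 0) m + ntrue (map fst (take e2 rs)) < heights rs (\<lambda>_. 0) m \<and> c \<le>
      heights rs (\<lambda>_. 0) m}"
  let ?B1 = "{(xs, rs). 2 * \<theta> \<le> \<bar>passage xs rs - (m * a + n * b)\<bar>}"
  let ?B2 = "{w. \<theta> \<le> \<bar>cnt (fst w) e1 - e1 * a\<bar>}"
  let ?B3 = "{w. \<theta> \<le> \<bar>ntrue (map fst (take e2 (snd w))) - e2 * b\<bar>}"
  have "1 - pprob (rows_pmf 0 p m n) ?G = pprob (rows_pmf 0 p m n) (- ?G)"
    using measure_pmf.prob_compl[of ?G "rows_pmf 0 p m n"] by (simp add: Compl_eq_Diff_UNIV)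
  also have "\<dots> = pprob (map_pmf no_sinks (rows_pmf b p m n)) (- ?G)"
    unfolding no_sinks_rows_pmf ..
  also have "\<dots> = ?P {w. no_sinks (snd w) \<notin> ?G}"
    unfolding lattice_pmf_def prob_pair_snd[of _ _ "\<lambda>rs. no_sinks rs \<notin> ?G"] by (simp add: vimage_def)
  also have "\<dots> \<le> ?P ((?B1 \<union> ?B2 \<union> ?B3) \<union> ?S \<union> {w. snd w \<in> ?T})"
  proof (rule prob_mono_pmf)
    fix w assume w: "w \<in> set_pmf ?J" "w \<in> {w. no_sinks (snd w) \<notin> ?G}"
    obtain xs rs where [simp]: "w = (xs, rs)" by (cases w)
    have len: "length xs = m" using w by (auto simp: lattice_pmf_def intro: length_conf_pmf)
    have max: "passage xs rs \<le> max (heights (no_sinks rs) (cnt xs) m) (heights rs (\<lambda>_. 0) m)"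
      unfolding passage_def len by (rule heights_sources_or_sinks)
    show "w \<in> (?B1 \<union> ?B2 \<union> ?B3) \<union> ?S \<union> {w. snd w \<in> ?T}"
    proof (rule ccontr)
      assume neg: "\<not> ?thesis"
      have "c < passage xs rs" "cnt xs e1 < e1 * a + \<theta>" "ntrue (map fst (take e2 rs)) < e2 * b + \<theta>"
        using neg by (auto simp: c_def)
      moreover have "0 \<le> e1 * a" "0 \<le> e2 * b" using st' by auto
      ultimately have "c - \<theta> - e1 * a - e2 * b \<le> heights (no_sinks rs) (\<lambda>_. 0) m"
        using neg max by (auto simp: not_less)
      then show False using w(2) by (simp add: c_def)
    qed
  qed
  also have "\<dots> \<le> ?P (?B1 \<union> ?B2 \<union> ?B3) + ?P ?S + ?P {w. snd w \<in> ?T}" by (rule measure_Un3_le) simp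
  also have "?P (?B1 \<union> ?B2 \<union> ?B3) \<le> ?P ?B1 + ?P ?B2 + ?P ?B3" by (rule measure_Un3_le) simp
  also have "?P ?B1 \<le> (m * a + n * b) / \<theta>\<^sup>2" by (rule passage_deviation[OF st(1) \<theta>])
  also have "?P ?B2 \<le> e1 * a / \<theta>\<^sup>2"
    unfolding lattice_pmf_def prob_pair_fst[of _ _ "\<lambda>xs. \<theta> \<le> \<bar>cnt xs e1 - e1 * a\<bar>"]
    by (rule cnt_deviation) (use st' \<theta> e in auto)
  also have "?P ?B3 \<le> e2 * b / \<theta>\<^sup>2"
    unfolding lattice_pmf_def prob_pair_snd[of _ _ "\<lambda>rs. \<theta> \<le> \<bar>ntrue (map fst (take e2 rs)) - e2 * b\<bar>"]
    by (rule sinks_deviation) (use st' \<theta> e in auto)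
  also have "?P ?S \<le> (m * a1 + n * b1 + e1 * a1 + e1 * a) / \<theta>\<^sup>2"
    by (rule late_source_exit[OF st(2)]) (use st' \<theta> e le c1 in \<open>auto simp: c_def\<close>)
  also have "?P {w. snd w \<in> ?T} = pprob (rows_pmf b p m n) ?T"
    unfolding lattice_pmf_def prob_pair_snd[of _ _ "\<lambda>rs. rs \<in> ?T"] by simp
  also have "\<dots> \<le> (m * a2 + n * b2 + e2 * b2 + e2 * b) / \<theta>\<^sup>2"
    by (rule late_sink_exit[OF st(3)]) (use st' \<theta> e le c2 in \<open>auto simp: c_def\<close>)
  finally have "1 - pprob (rows_pmf 0 p m n) ?G \<le>
     ((m * a + n * b) + e1 * a + e2 * b + (m * a1 + n * b1 + e1 * a1 + e1 * a) +
         (m * a2 + n * b2 + e2 * b2 + e2 * b)) / \<theta>\<^sup>2"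
    by (simp add: add_divide_distrib)
  \<comment> \<open>The numerator splits into seven groups, each at most \<open>C\<close>; 8 is a
    rounding.\<close>
  also have "\<dots> \<le> 8 * C / \<theta>\<^sup>2"
  proof (intro divide_right_mono)
    have "e1 * a \<le> m * a" "e1 * a1 \<le> m * a1" "e2 * b \<le> n * b" "e2 * b2 \<le> n * b2" "0 \<le> m * a" "0 \<le> n * b"
        "0 \<le> n * b1" "0 \<le> m * a2"
      using e st' by (auto intro!: mult_right_mono)
    then show "(m * a + n * b) + e1 * a + e2 * b + (m * a1 + n * b1 + e1 * a1 + e1 * a) +
        (m * a2 + n * b2 + e2 * b2 + e2 * b) \<le> 8 * C"
      using C by linarith
  qed auto
  finally show ?thesis by simp
qed

text \<open>Markov's inequality after discarding all sources and sinks.\<close>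

lemma mean_passage_ge:
  fixes a b p a0 b0 c :: real
  assumes "0 \<le> c"
  shows "mean_passage a0 b0 p m n \<ge> c * pprob (rows_pmf 0 p m n) {rs. c \<le> heights rs (\<lambda>_. 0) m}"
proof -
  let ?J = "lattice_pmf a0 b0 p m n"
  let ?G = "{rs. c \<le> heights rs (\<lambda>_. 0) m}"
  have "c * pprob (rows_pmf 0 p m n) ?G = c * pprob (map_pmf no_sinks (rows_pmf b0 p m n)) ?G"
    unfolding no_sinks_rows_pmf ..
  also have "\<dots> = c * pprob ?J {w. no_sinks (snd w) \<in> ?G}"
    unfolding lattice_pmf_def prob_pair_snd[of _ _ "\<lambda>rs. no_sinks rs \<in> ?G"] by (simp add: vimage_def)
  also have "\<dots> = pexp ?J (\<lambda>w. c * indicator {w. no_sinks (snd w) \<in> ?G} w)" by simp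
  also have "\<dots> \<le> mean_passage a0 b0 p m n"
    unfolding mean_passage_def
  proof (intro expectation_mono_pmf fin_pmfs)
    fix w assume w: "w \<in> set_pmf ?J"
    obtain xs rs where [simp]: "w = (xs, rs)" by (cases w)
    have len: "length xs = m" using w by (auto simp: lattice_pmf_def intro: length_conf_pmf)
    have "heights (no_sinks rs) (\<lambda>_. 0) m \<le> passage xs rs"
      unfolding passage_def len by (intro heights_mono) auto
    moreover have "0 \<le> passage xs rs"
      using heights_ge_0[of "cnt xs" rs "length xs"]
          by (simp add: heights_0 passage_def) (metis order_trans ntrue_nonneg)
    ultimately show "c * indicator {w. no_sinks (snd w) \<in> ?G} w \<le>
        (case w of (xs, rs) \<Rightarrow> real_of_int (passage xs rs))"
      by (auto simp: indicator_def)
  qed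
  finally show ?thesis .
qed

subsection \<open>Vanishing mesh\<close>

text \<open>The probability that a Poisson process of intensity \<open>c\<close> has a point in an
  interval of length 1 / N. \<open>occ2\<close> is its analogue for a square of side 1 / N and
  intensity 1.\<close>

definition occ :: "real \<Rightarrow> nat \<Rightarrow> real" where
  "occ c N = 1 - exp (- (c / real N))"

definition occ2 :: "nat \<Rightarrow> real" where
  "occ2 N = 1 - exp (- (1 / (real N)\<^sup>2))"

text \<open>The sink probability that makes the source probability \<open>occ c N\<close> stationary.\<close>

definition sink_prob :: "real \<Rightarrow> nat \<Rightarrow> real" where
  "sink_prob c N = occ2 N * (1 - occ c N) / (occ c N + occ2 N * (1 - occ c N))"

text \<open>For positive \<open>x\<close> this is the one-based index of the cell containing
  \<open>x\<close>, cells being open on the left and closed on the right; hence also the number of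
  cells that meet (0, x].\<close>

definition grid :: "real \<Rightarrow> nat \<Rightarrow> nat" where
  "grid x N = nat \<lceil>x * real N\<rceil>"

lemma occ_bounds: "0 \<le> c \<Longrightarrow> 0 \<le> occ c N" "occ c N \<le> 1" "0 \<le> occ2 N" "occ2 N \<le> 1" "occ c N < 1"
  by (simp_all add: occ_def occ2_def)

lemma occ_pos: "0 < c \<Longrightarrow> 0 < N \<Longrightarrow> 0 < occ c N"
  by (simp add: occ_def)

lemma occ_mono: "c \<le> d \<Longrightarrow> occ c N \<le> occ d N"
  by (simp add: occ_def divide_right_mono)

lemma stationary_sink:
  assumes "0 < c" "0 < N"
  shows "stationary (occ c N) (sink_prob c N) (occ2 N)"
proof -
  have *: "stationary a (p * (1 - a) / (a + p * (1 - a))) p" if "0 < a" "a < 1" "0 \<le> p" "p \<le> 1" for a p :: real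
  proof -
    define q where "q = p * (1 - a)"
    have q: "0 \<le> q" using that by (simp add: q_def)
    have "1 - q / (a + q) = a / (a + q)" using that q by (simp add: field_simps)
    then have "(1 - a) * (1 - q / (a + q)) * p = a * (q / (a + q))" by (simp add: q_def)
    moreover have "q / (a + q) \<le> 1" using that q by simp
    ultimately show ?thesis using that q by (simp add: stationary_def flip: q_def)
  qed
  show ?thesis unfolding sink_prob_def using assms by (intro * occ_pos occ_bounds)
qed

lemma occ_limit: "(\<lambda>N. real N * occ c N) \<longlonglongrightarrow> c"
proof (cases "c = 0")
  case False
  then consider "c > 0" | "c < 0" by linarith
  then show ?thesis unfolding occ_def by cases real_asymp+
qed (simp add: occ_def)

lemma occ2_limit: "(\<lambda>N. (real N)\<^sup>2 * occ2 N) \<longlonglongrightarrow> 1"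
  unfolding occ2_def by real_asymp

lemma occ_tendsto_0: "(\<lambda>N. occ c N) \<longlonglongrightarrow> 0"
proof -
  have "(\<lambda>N. real N * occ c N * (1 / real N)) \<longlonglongrightarrow> c * 0"
    by (intro tendsto_mult occ_limit lim_1_over_n)
  moreover have "eventually (\<lambda>N. real N * occ c N * (1 / real N) = occ c N) sequentially"
    using eventually_gt_at_top[of 0] by eventually_elim simp
  ultimately show ?thesis by (simp add: tendsto_cong)
qed

lemma occ2_tendsto_0: "(\<lambda>N. real N * occ2 N) \<longlonglongrightarrow> 0"
  unfolding occ2_def by real_asymp

lemma sink_limit:
  assumes "0 < c"
  shows "(\<lambda>N. real N * sink_prob c N) \<longlonglongrightarrow> 1 / c"
proof -
  have "(\<lambda>N. ((real N)\<^sup>2 * occ2 N) * (1 - occ c N) / (real N * occ c N + (real N * occ2 N) * (1 - occ c N)))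
      \<longlonglongrightarrow> 1 * (1 - 0) / (c + 0 * (1 - 0))"
    using assms by (intro tendsto_intros occ_limit occ2_limit occ_tendsto_0 occ2_tendsto_0) simp
  moreover have "eventually (\<lambda>N. ((real N)\<^sup>2 * occ2 N) *
      (1 - occ c N) / (real N * occ c N + (real N * occ2 N) * (1 - occ c N)) =
      real N * sink_prob c N) sequentially"
    using eventually_gt_at_top[of 0]
  proof eventually_elim
    case (elim N)
    have "real N * occ c N + (real N * occ2 N) * (1 - occ c N) = real N * (occ c N + occ2 N * (1 - occ c N))"
      by (simp add: algebra_simps)
    then show ?case using elim by (simp add: sink_prob_def power2_eq_square)
  qed
  ultimately show ?thesis by (simp add: tendsto_cong)
qed

lemma grid_limit:
  assumes "0 \<le> x"
  shows "(\<lambda>N. real (grid x N) / real N) \<longlonglongrightarrow> x"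
proof (rule tendsto_sandwich)
  have 1: "x * real N \<le> real (grid x N)" "real (grid x N) \<le> x * real N + 1" for N
    using assms by (auto simp: grid_def)
  show "eventually (\<lambda>N. x \<le> real (grid x N) / real N) sequentially"
    using eventually_gt_at_top[of 0] by eventually_elim (use 1 in \<open>simp add: field_simps\<close>)
  show "eventually (\<lambda>N. real (grid x N) / real N \<le> x + 1 / real N) sequentially"
    using eventually_gt_at_top[of 0] by eventually_elim (use 1 in \<open>simp add: field_simps\<close>)
  show "(\<lambda>N. x + 1 / real N) \<longlonglongrightarrow> x" using tendsto_add[OF tendsto_const lim_1_over_n, of x] by simp
qed auto

lemma scaled_limit:
  assumes "(\<lambda>N. real (k N) / real N) \<longlonglongrightarrow> x" "(\<lambda>N. real N * f N) \<longlonglongrightarrow> y"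
  shows "(\<lambda>N. real (k N) * f N) \<longlonglongrightarrow> x * y"
proof -
  have "(\<lambda>N. real (k N) / real N * (real N * f N)) \<longlonglongrightarrow> x * y" by (intro tendsto_mult assms)
  moreover have "eventually (\<lambda>N. real (k N) / real N * (real N * f N) = real (k N) * f N) sequentially"
    using eventually_gt_at_top[of 0] by eventually_elim simp
  ultimately show ?thesis by (simp add: tendsto_cong)
qed

lemmas grid_scaled = scaled_limit[OF grid_limit]

text \<open>Domination by the stationary model with source intensity \<nu> and sink intensity 1 /
  \<nu>; the bounds on \<nu> say that both boundary intensities are raised.\<close>

lemma eventually_mean_passage_le:
  assumes "0 < lam" "0 \<le> mu" "lam \<le> \<nu>" "mu * \<nu> < 1" "0 \<le> x" "0 \<le> t" "0 < \<epsilon>"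
  shows "eventually (\<lambda>N. mean_passage (occ lam N) (occ mu N) (occ2 N) (grid x N) (grid t N) \<le>
      \<nu> * x + t / \<nu> + \<epsilon>) sequentially"
proof -
  have \<nu>: "0 < \<nu>" using assms by linarith
  have "eventually (\<lambda>N. real N * occ mu N < real N * sink_prob \<nu> N) sequentially"
  proof -
    have "mu < 1 / \<nu>" using assms \<nu> by (simp add: field_simps)
    then have "eventually (\<lambda>N. 0 < real N * sink_prob \<nu> N - real N * occ mu N) sequentially"
      by (intro order_tendstoD(1)[OF tendsto_diff[OF sink_limit[OF \<nu>] occ_limit[of mu]]]) simp
    then show ?thesis by simp
  qed
  moreover have "(\<lambda>N. real (grid x N) * occ \<nu> N + real (grid t N) * sink_prob \<nu> N) \<longlonglongrightarrow> x * \<nu> + t * (1 / \<nu>)"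
    using assms \<nu> by (intro tendsto_add grid_scaled occ_limit sink_limit)
  then have "eventually (\<lambda>N. real (grid x N) * occ \<nu> N + real (grid t N) * sink_prob \<nu> N <
      x * \<nu> + t * (1 / \<nu>) + \<epsilon>) sequentially"
    using assms by (intro order_tendstoD(2)) auto
  ultimately show ?thesis using eventually_gt_at_top[of 0]
  proof eventually_elim
    case (elim N)
    have "mean_passage (occ lam N) (occ mu N) (occ2 N) (grid x N) (grid t N) \<le>
        real (grid x N) * occ \<nu> N + real (grid t N) * sink_prob \<nu> N"
      using assms \<nu> elim by (intro mean_passage_le stationary_sink occ_mono occ_bounds) auto
    then show ?case using elim by (simp add: mult.commute)
  qed
qed

lemma floor_limit:
  assumes "0 \<le> x"
  shows "(\<lambda>N. real (nat \<lfloor>x * real N\<rfloor>) / real N) \<longlonglongrightarrow> x"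
proof (rule tendsto_sandwich)
  have 1: "real (nat \<lfloor>x * real N\<rfloor>) \<le> x * real N" "x * real N - 1 \<le> real (nat \<lfloor>x * real N\<rfloor>)" for N
    using assms by (auto intro: of_nat_floor)
  show "eventually (\<lambda>N. real (nat \<lfloor>x * real N\<rfloor>) / real N \<le> x) sequentially"
    using eventually_gt_at_top[of 0] by eventually_elim (use 1 in \<open>simp add: field_simps\<close>)
  show "eventually (\<lambda>N. x - 1 / real N \<le> real (nat \<lfloor>x * real N\<rfloor>) / real N) sequentially"
    using eventually_gt_at_top[of 0]
  proof eventually_elim
    case (elim N)
    have "x - 1 / real N = (x * real N - 1) / real N" using elim by (simp add: field_simps)
    then show ?case using divide_right_mono[OF 1(2)[of N], of "real N"] by simp
  qed
  show "(\<lambda>N. x - 1 / real N) \<longlonglongrightarrow> x" using tendsto_diff[OF tendsto_const lim_1_over_n, of x] by simp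
qed auto

lemma floor_le_grid: "0 \<le> y \<Longrightarrow> y \<le> x \<Longrightarrow> nat \<lfloor>y * real N\<rfloor> \<le> grid x N"
  unfolding grid_def by (intro nat_mono order.trans[OF floor_le_ceiling] ceiling_mono mult_right_mono) auto

text \<open>Points alone achieve this, so the boundary densities are arbitrary. At time \<nu>^2 x
  the stationary intensity \<nu> is the minimiser. Sources are sprinkled by raising \<nu> to
  \<open>\<nu>1\<close>; sinks by lowering it to \<open>\<nu>2\<close>, which raises the sink
  intensity 1 / \<nu>.\<close>

lemma eventually_mean_passage_ge:
  fixes a0 b0 :: "nat \<Rightarrow> real"
  assumes \<nu>: "0 < \<nu>" and \<epsilon>: "0 < \<epsilon>" "\<epsilon> < 1 / 2" and x: "0 < x"
  shows "eventually (\<lambda>N. mean_passage (a0 N) (b0 N) (occ2 N) (grid x N) (grid (\<nu>\<^sup>2 * x) N) \<ge>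
      (2 - 3 * \<epsilon>) * \<nu> * x * (1 - 20000 / (\<nu> * x * \<epsilon> ^ 4))) sequentially"
proof -
  define \<delta> where "\<delta> = \<epsilon> / 2"
  have \<delta>: "0 < \<delta>" "\<delta> < 1 / 4" "\<epsilon> = 2 * \<delta>" using \<epsilon> by (auto simp: \<delta>_def)
  define t where "t = \<nu>\<^sup>2 * x"
  have t: "0 < t" "t / \<nu> = \<nu> * x" using \<nu> x by (auto simp: t_def power2_eq_square)
  \<comment> \<open>The unit of error. Both perturbed means exceed the minimum 2 \<nu> x by at most
    7 \<theta> (\<open>v\<close>), a late exit is rewarded by 14 \<theta> (\<open>d1\<close>,
    \<open>d2\<close>), and \<open>prob_points_passage\<close> asks for a margin of 6 \<theta>; 7 +
    6 < 14.\<close>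
  define \<theta> where "\<theta> = \<nu> * x * \<delta>\<^sup>2 / 7"
  have \<theta>: "0 < \<theta>" "7 * \<theta> = \<nu> * x * \<delta>\<^sup>2" using \<nu> x \<delta> by (auto simp: \<theta>_def)
  define \<nu>1 \<nu>2 where "\<nu>1 = \<nu> * (1 + \<delta>)" and "\<nu>2 = \<nu> / (1 + \<delta>)"
  have \<nu>12: "0 < \<nu>1" "0 < \<nu>2" using \<nu> \<delta> by (auto simp: \<nu>1_def \<nu>2_def intro!: mult_pos_pos divide_pos_pos)
  have \<nu>12': "\<nu> < \<nu>1" "\<nu>2 < \<nu>" using \<nu> \<delta> by (auto simp: \<nu>1_def \<nu>2_def field_simps)
  define e1 e2 where "e1 N = nat \<lfloor>\<epsilon> * x * real N\<rfloor>" and "e2 N = nat \<lfloor>\<epsilon> * t * real N\<rfloor>" for N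
  define m n where "m N = grid x N" and "n N = grid t N" for N
  have lims: "(\<lambda>N. real (m N) / real N) \<longlonglongrightarrow> x" "(\<lambda>N. real (n N) / real N) \<longlonglongrightarrow> t"
     "(\<lambda>N. real (e1 N) / real N) \<longlonglongrightarrow> \<epsilon> * x" "(\<lambda>N. real (e2 N) / real N) \<longlonglongrightarrow> \<epsilon> * t"
    unfolding m_def n_def e1_def e2_def by (rule grid_limit floor_limit; use x t \<epsilon> in simp)+
  note lims = lims[THEN scaled_limit]
  have e: "e1 N \<le> m N" "e2 N \<le> n N" for N
    unfolding m_def n_def e1_def e2_def using x t \<epsilon> by (auto intro!: floor_le_grid)
  have gap: "(1 + \<delta>) + 1 / (1 + \<delta>) \<le> 2 + \<delta>\<^sup>2"
  proof -
    have "(1 + \<delta>) + 1 / (1 + \<delta>) = 2 + \<delta>\<^sup>2 / (1 + \<delta>)" using \<delta> by (simp add: field_simps power2_eq_square)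
    also have "\<dots> \<le> 2 + \<delta>\<^sup>2" using \<delta> by (simp add: field_simps)
    finally show ?thesis .
  qed
  have v1: "x * \<nu>1 + t * (1 / \<nu>1) = \<nu> * x * ((1 + \<delta>) + 1 / (1 + \<delta>))"
  proof -
    have "t * (1 / \<nu>1) = \<nu> * x * (1 / (1 + \<delta>))" using \<nu> by (simp add: \<nu>1_def t_def power2_eq_square)
    moreover have "x * \<nu>1 = \<nu> * x * (1 + \<delta>)" by (simp add: \<nu>1_def)
    ultimately show ?thesis by (simp only: distrib_left)
  qed
  have v2: "x * \<nu>2 + t * (1 / \<nu>2) = \<nu> * x * ((1 + \<delta>) + 1 / (1 + \<delta>))"
  proof -
    have "t * (1 / \<nu>2) = \<nu> * x * (1 + \<delta>)" using \<nu> by (simp add: \<nu>2_def t_def power2_eq_square)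
    moreover have "x * \<nu>2 = \<nu> * x * (1 / (1 + \<delta>))" by (simp add: \<nu>2_def)
    ultimately show ?thesis by (simp only: distrib_left add.commute)
  qed
  have v0: "x * \<nu> + t * (1 / \<nu>) = 2 * (\<nu> * x)" using t by simp
  have \<nu>x: "0 < \<nu> * x" using \<nu> x by simp
  have v: "\<nu> * x * ((1 + \<delta>) + 1 / (1 + \<delta>)) \<le> 2 * (\<nu> * x) + 7 * \<theta>"
    using mult_left_mono[OF gap, of "\<nu> * x"] \<nu>x unfolding \<theta> by (simp add: algebra_simps)
  have v3: "\<nu> * x * ((1 + \<delta>) + 1 / (1 + \<delta>)) < 3 * (\<nu> * x)"
  proof -
    have "\<delta>\<^sup>2 < 1" using \<delta> by (simp add: power_less_one_iff)
    then have "(1 + \<delta>) + 1 / (1 + \<delta>) < 3" using gap by linarith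
    from mult_strict_left_mono[OF this \<nu>x] show ?thesis by (simp add: mult.commute)
  qed
  have d1: "\<epsilon> * x * (\<nu>1 - \<nu>) = 14 * \<theta>" unfolding \<theta>_def \<nu>1_def \<delta>(3) by (simp add: algebra_simps power2_eq_square)
  have d2: "\<epsilon> * t * (1 / \<nu>2 - 1 / \<nu>) = 14 * \<theta>"
  proof -
    have "1 / \<nu>2 - 1 / \<nu> = \<delta> / \<nu>" using \<nu> by (simp add: \<nu>2_def field_simps)
    then show ?thesis unfolding \<theta>_def \<delta>(3) t_def using \<nu> by (simp add: power2_eq_square)
  qed
  note L = occ_limit sink_limit
  have c1: "eventually (\<lambda>N. m N * occ \<nu>1 N + n N * sink_prob \<nu>1 N + 6 * \<theta> -
      (m N * occ \<nu> N + n N * sink_prob \<nu> N + e1 N * (occ \<nu>1 N - occ \<nu> N)) < 0) sequentially"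
  proof (rule order_tendstoD(2))
    show "(\<lambda>N. m N * occ \<nu>1 N + n N * sink_prob \<nu>1 N + 6 * \<theta> -
        (m N * occ \<nu> N + n N * sink_prob \<nu> N + e1 N * (occ \<nu>1 N - occ \<nu> N)))
       \<longlonglongrightarrow> x * \<nu>1 + t * (1 / \<nu>1) + 6 * \<theta> - (x * \<nu> + t * (1 / \<nu>) + \<epsilon> * x * (\<nu>1 - \<nu>))"
      by (intro tendsto_intros lims L \<nu> \<nu>12) (simp only: right_diff_distrib, intro tendsto_diff L)
    show "x * \<nu>1 + t * (1 / \<nu>1) + 6 * \<theta> - (x * \<nu> + t * (1 / \<nu>) + \<epsilon> * x * (\<nu>1 - \<nu>)) < 0"
      unfolding v1 v0 d1 using v \<theta> by linarith
  qed
  have c2: "eventually (\<lambda>N. m N * occ \<nu>2 N + n N * sink_prob \<nu>2 N + 6 * \<theta> -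
      (m N * occ \<nu> N + n N * sink_prob \<nu> N + e2 N * (sink_prob \<nu>2 N - sink_prob \<nu> N)) < 0) sequentially"
  proof (rule order_tendstoD(2))
    show "(\<lambda>N. m N * occ \<nu>2 N + n N * sink_prob \<nu>2 N + 6 * \<theta> -
        (m N * occ \<nu> N + n N * sink_prob \<nu> N + e2 N * (sink_prob \<nu>2 N - sink_prob \<nu> N)))
       \<longlonglongrightarrow> x * \<nu>2 + t * (1 / \<nu>2) + 6 * \<theta> - (x * \<nu> + t * (1 / \<nu>) + \<epsilon> * t * (1 / \<nu>2 - 1 / \<nu>))"
      by (intro tendsto_intros lims L \<nu> \<nu>12) (simp only: right_diff_distrib, intro tendsto_diff L \<nu> \<nu>12)
    show "x * \<nu>2 + t * (1 / \<nu>2) + 6 * \<theta> - (x * \<nu> + t * (1 / \<nu>) + \<epsilon> * t * (1 / \<nu>2 - 1 / \<nu>)) < 0"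
      unfolding v2 v0 d2 using v \<theta> by linarith
  qed
  have C0: "eventually (\<lambda>N. m N * occ \<nu> N + n N * sink_prob \<nu> N < 3 * (\<nu> * x)) sequentially"
    using v0 \<nu>x by (intro order_tendstoD(2)[of _ "x * \<nu> + t * (1 / \<nu>)"] tendsto_add lims L \<nu>) simp
  have C1: "eventually (\<lambda>N. m N * occ \<nu>1 N + n N * sink_prob \<nu>1 N < 3 * (\<nu> * x)) sequentially"
    using v1 v3 by (intro order_tendstoD(2)[of _ "x * \<nu>1 + t * (1 / \<nu>1)"] tendsto_add lims L \<nu>12) simp
  have C2: "eventually (\<lambda>N. m N * occ \<nu>2 N + n N * sink_prob \<nu>2 N < 3 * (\<nu> * x)) sequentially"
    using v2 v3 by (intro order_tendstoD(2)[of _ "x * \<nu>2 + t * (1 / \<nu>2)"] tendsto_add lims L \<nu>12) simp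
  have le: "eventually (\<lambda>N. 0 < real N * sink_prob \<nu>2 N - real N * sink_prob \<nu> N) sequentially"
    using \<nu> \<nu>12 \<nu>12' by (intro order_tendstoD(1)[of _ "1 / \<nu>2 - 1 / \<nu>"] tendsto_diff L) (auto simp: field_simps)
  \<comment> \<open>Each axis contributes about \<epsilon> \<nu> x, and 3 \<theta> stays below a
    third such term; hence the factor 2 - 3 \<epsilon>.\<close>
  have c: "eventually (\<lambda>N. (2 - 3 * \<epsilon>) * \<nu> * x < m N * occ \<nu> N + n N * sink_prob \<nu> N - 3 * \<theta> - e1 N *
      occ \<nu> N - e2 N * sink_prob \<nu> N) sequentially"
  proof (rule order_tendstoD(1))
    show "(\<lambda>N. m N * occ \<nu> N + n N * sink_prob \<nu> N - 3 * \<theta> - e1 N * occ \<nu> N - e2 N * sink_prob \<nu> N)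
      \<longlonglongrightarrow> x * \<nu> + t * (1 / \<nu>) - 3 * \<theta> - \<epsilon> * x * \<nu> - \<epsilon> * t * (1 / \<nu>)"
      by (intro tendsto_intros lims L \<nu>)
    have "\<delta>\<^sup>2 < \<epsilon>" unfolding \<delta>(3) power2_eq_square using \<delta> by (intro mult_strict_right_mono) auto
    then have "\<delta>\<^sup>2 * (\<nu> * x) < \<epsilon> * (\<nu> * x)" using \<nu>x by (rule mult_strict_right_mono)
    then have "7 * \<theta> < \<epsilon> * (\<nu> * x)" unfolding \<theta>(2) by (simp only: mult.commute[of "\<nu> * x"])
    then have "3 * \<theta> < \<epsilon> * (\<nu> * x)" using \<theta> by linarith
    moreover have "\<epsilon> * t * (1 / \<nu>) = \<epsilon> * (\<nu> * x)" unfolding t(2)[symmetric] by simp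
    ultimately show "(2 - 3 * \<epsilon>) * \<nu> * x < x * \<nu> + t * (1 / \<nu>) - 3 * \<theta> - \<epsilon> * x * \<nu> - \<epsilon> * t * (1 / \<nu>)"
      unfolding v0 by (simp add: algebra_simps)
  qed
  have c0: "0 \<le> (2 - 3 * \<epsilon>) * \<nu> * x" using \<epsilon> \<nu> x by simp
  \<comment> \<open>18816 = 24 * 49 * 16, where 24 comes from 8 C with C = 3 \<nu> x, 49 from the 7
    in \<theta>, and 16 from \<delta> = \<epsilon> / 2.\<close>
  have err: "8 * (3 * (\<nu> * x)) / \<theta>\<^sup>2 \<le> 20000 / (\<nu> * x * \<epsilon> ^ 4)"
  proof -
    have "8 * (3 * (\<nu> * x)) / \<theta>\<^sup>2 = 18816 / (\<nu> * x * \<epsilon> ^ 4)"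
      unfolding \<theta>_def \<delta>_def using \<nu> x \<epsilon> by (simp add: field_simps power2_eq_square power4_eq_xxxx)
    also have "\<dots> \<le> 20000 / (\<nu> * x * \<epsilon> ^ 4)" using \<nu> x \<epsilon> by (intro divide_right_mono) auto
    finally show ?thesis .
  qed
  show ?thesis
    using c1 c2 C0 C1 C2 le c eventually_gt_at_top[of 0]
  proof eventually_elim
    case (elim N)
    let ?c = "(2 - 3 * \<epsilon>) * \<nu> * x"
    let ?p = "pprob (rows_pmf 0 (occ2 N) (m N) (n N))"
    have "sink_prob \<nu> N \<le> sink_prob \<nu>2 N" using elim by simp
    then have "1 - 8 * (3 * (\<nu> * x)) / \<theta>\<^sup>2 \<le> ?p {rs. m N * occ \<nu> N + n N * sink_prob \<nu> N - 3 * \<theta> - e1 N *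
        occ \<nu> N - e2 N * sink_prob \<nu> N \<le> heights rs (\<lambda>_. 0) (m N)}"
      using elim \<theta> \<nu> \<nu>12 \<nu>12' e
      by (intro prob_points_passage[where ?a1.0 = "occ \<nu>1 N" and ?b1.0 = "sink_prob \<nu>1 N"
          and ?a2.0 = "occ \<nu>2 N" and ?b2.0 = "sink_prob \<nu>2 N"] stationary_sink occ_mono) auto
    also have "\<dots> \<le> ?p {rs. ?c \<le> heights rs (\<lambda>_. 0) (m N)}"
      using elim by (intro prob_mono_pmf) auto
    finally have "1 - 20000 / (\<nu> * x * \<epsilon> ^ 4) \<le> ?p {rs. ?c \<le> heights rs (\<lambda>_. 0) (m N)}" using err by linarith
    then have "?c * (1 - 20000 / (\<nu> * x * \<epsilon> ^ 4)) \<le> ?c * ?p {rs. ?c \<le> heights rs (\<lambda>_. 0) (m N)}"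
      using c0 by (intro mult_left_mono)
    also have "\<dots> \<le> mean_passage (a0 N) (b0 N) (occ2 N) (m N) (n N)" by (rule mean_passage_ge[OF c0])
    finally show ?case by (simp add: m_def n_def t_def)
  qed
qed

subsection \<open>The rarefaction fan\<close>

text \<open>The continuous process enters the analysis only through the limits \<open>P x t\<close>
  of the lattice probabilities, which stand for \<open>P(X'\<^sub>t > x)\<close>.\<close>

context
  fixes lam mu :: real and P :: "real \<Rightarrow> real \<Rightarrow> real"
  assumes lam: "0 < lam" and mu: "0 < mu" and lam_mu: "lam * mu < 1"
    and P: "\<And>x t. 0 < x \<Longrightarrow> 0 \<le> t \<Longrightarrow>
      (\<lambda>N. merge_prob (occ lam N) (occ mu N) (occ2 N) (grid x N) (grid t N)) \<longlonglongrightarrow> P x t"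
begin

abbreviation (input) "mean_at x t N \<equiv> mean_passage (occ lam N) (occ mu N) (occ2 N) (grid x N) (grid t N)"

lemma mu_less: "mu < 1 / lam"
  using lam lam_mu by (simp add: field_simps)

lemma grid_mono: "t \<le> t' \<Longrightarrow> grid t N \<le> grid t' N"
  unfolding grid_def by (intro nat_mono ceiling_mono mult_right_mono) auto

lemma P_mono:
  assumes "0 < x" "0 \<le> t" "t \<le> t'"
  shows "P x t \<le> P x t'"
  using assms by (intro LIMSEQ_le[OF P P] exI[of _ 0] allI impI merge_prob_mono grid_mono) auto

lemma P_bounds:
  assumes "0 < x" "0 \<le> t" shows "0 \<le> P x t" "P x t \<le> 1"
  using assms by (auto intro!: LIMSEQ_le_const[OF P] LIMSEQ_le_const2[OF P] exI[of _ 0] simp: merge_prob_def)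

text \<open>Refinement of the mesh in \<open>mean_passage_increment\<close>. The means are
  represented by eventual bounds \<open>A\<close> and \<open>B\<close>, so that one-sided
  information can be inserted. In \<open>lim\<close>, \<open>s\<close> is the sign of the vanishing
  error.\<close>

lemma increment_limits:
  assumes x: "0 < x" and t: "0 \<le> t1" "t1 \<le> t2"
  shows "eventually (\<lambda>N. A \<le> mean_at x t2 N) sequentially \<Longrightarrow> eventually (\<lambda>N. mean_at x t1 N \<le> B) sequentially \<Longrightarrow>
      A - B \<le> (t2 - t1) * (1 / lam - (1 / lam - mu) * P x t1)"
    and "eventually (\<lambda>N. mean_at x t2 N \<le> B) sequentially \<Longrightarrow> eventually (\<lambda>N. A \<le> mean_at x t1 N) sequentially \<Longrightarrow>
      (t2 - t1) * (1 / lam - (1 / lam - mu) * P x t2) \<le> B - A"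
proof -
  let ?m = "\<lambda>N. real (grid x N) * occ2 N"
  have lim: "(\<lambda>N. (real (grid t2 N) - real (grid t1 N)) *
      (occ mu N + (sink_prob lam N - occ mu N) *
      (1 - merge_prob (occ lam N) (occ mu N) (occ2 N) (grid x N) (grid t N) + s * ?m N)))
     \<longlonglongrightarrow> (t2 - t1) * (1 / lam - (1 / lam - mu) * P x t)" if "0 \<le> t" for t s
  proof -
    let ?q = "\<lambda>N. 1 - merge_prob (occ lam N) (occ mu N) (occ2 N) (grid x N) (grid t N) + s * ?m N"
    have "?m \<longlonglongrightarrow> x * 0" using x by (intro grid_scaled occ2_tendsto_0) simp
    from tendsto_mult[OF tendsto_const[of s] this]
    have q: "?q \<longlonglongrightarrow> 1 - P x t + s * (x * 0)"
      by (intro tendsto_add tendsto_diff[OF tendsto_const P[OF x that]])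
    have "(\<lambda>N. (real (grid t2 N) * occ mu N - real (grid t1 N) * occ mu N) +
        ((real (grid t2 N) * sink_prob lam N - real (grid t1 N) * sink_prob lam N) -
            (real (grid t2 N) * occ mu N - real (grid t1 N) * occ mu N)) * ?q N)
      \<longlonglongrightarrow> (t2 * mu - t1 * mu) + ((t2 * (1 / lam) - t1 * (1 / lam)) - (t2 * mu - t1 * mu)) *
          (1 - P x t + s * (x * 0))"
      using x t by (intro tendsto_add tendsto_mult tendsto_diff grid_scaled occ_limit sink_limit q lam) auto
    moreover have "(t2 * mu - t1 * mu) + ((t2 * L - t1 * L) - (t2 * mu - t1 * mu)) * (1 - p + s * (x * 0)) =
        (t2 - t1) * (L - (L - mu) * p)" for L p
      by (simp add: algebra_simps)
    moreover have "(u * b - v * b) + ((u * c - v * c) - (u * b - v * b)) * w = (u - v) * (b + (c - b) * w)"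
        for u v b c w :: real
      by (simp add: algebra_simps)
    ultimately show ?thesis by (simp only:)
  qed
  have ev: "eventually (\<lambda>N. 0 < N \<and> occ mu N \<le> sink_prob lam N) sequentially"
  proof -
    have "eventually (\<lambda>N. 0 < real N * sink_prob lam N - real N * occ mu N) sequentially"
      using mu_less by (intro order_tendstoD(1)[OF tendsto_diff[OF sink_limit[OF lam] occ_limit[of mu]]]) simp
    then show ?thesis using eventually_gt_at_top[of 0] by eventually_elim simp
  qed
  {
    assume "eventually (\<lambda>N. A \<le> mean_at x t2 N) sequentially" "eventually (\<lambda>N. mean_at x t1 N \<le> B) sequentially"
    then have "eventually (\<lambda>N. A - B \<le> (real (grid t2 N) - real (grid t1 N)) *
        (occ mu N + (sink_prob lam N - occ mu N) *
        (1 - merge_prob (occ lam N) (occ mu N) (occ2 N) (grid x N) (grid t1 N) + 1 * ?m N))) sequentially"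
      using ev
    proof eventually_elim
      case (elim N)
      then show ?case
        using mean_passage_increment(1)[OF stationary_sink[OF lam, of N], of "occ mu N" "grid t1 N"
            "grid t2 N" "grid x N"] mu t
        by (simp add: occ_bounds grid_mono)
    qed
    then show "A - B \<le> (t2 - t1) * (1 / lam - (1 / lam - mu) * P x t1)"
      using t(1) by (intro tendsto_lowerbound[OF lim[of t1 1]]) simp_all
  next
    assume "eventually (\<lambda>N. mean_at x t2 N \<le> B) sequentially" "eventually (\<lambda>N. A \<le> mean_at x t1 N) sequentially"
    then have "eventually (\<lambda>N. (real (grid t2 N) - real (grid t1 N)) *
        (occ mu N + (sink_prob lam N - occ mu N) *
        (1 - merge_prob (occ lam N) (occ mu N) (occ2 N) (grid x N) (grid t2 N) + (- 1) * ?m N)) \<le>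
        B - A) sequentially"
      using ev
    proof eventually_elim
      case (elim N)
      then show ?case
        using mean_passage_increment(2)[OF stationary_sink[OF lam, of N], of "occ mu N" "grid t1 N"
            "grid t2 N" "grid x N"] mu t
        by (simp add: occ_bounds grid_mono)
    qed
    then show "(t2 - t1) * (1 / lam - (1 / lam - mu) * P x t2) \<le> B - A"
      using t by (intro tendsto_upperbound[OF lim[of t2 "- 1"]]) simp_all
  }
qed

lemma eventually_mean_ge:
  assumes "0 < r" "0 < \<epsilon>"
  shows "eventually (\<lambda>x. eventually (\<lambda>N. 2 * r * x - \<epsilon> * x \<le> mean_at x (r\<^sup>2 * x) N) sequentially) at_top"
proof -
  \<comment> \<open>Since (2 - 3 \<eta>) (1 - \<eta>) \<ge> 2 - 5 \<eta>, the total loss is at most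
    5 \<eta> r x, which must not exceed \<epsilon> x.\<close>
  define \<eta> where "\<eta> = min (1 / 4) (\<epsilon> / (5 * r))"
  have \<eta>: "0 < \<eta>" "\<eta> < 1 / 2" "5 * \<eta> * r \<le> \<epsilon>" using assms by (auto simp: \<eta>_def min_def field_simps)
  have "eventually (\<lambda>x. 20000 / (r * x * \<eta> ^ 4) < \<eta>) at_top"
  proof (rule order_tendstoD(2))
    show "((\<lambda>x. 20000 / (r * x * \<eta> ^ 4)) \<longlongrightarrow> 0) at_top" using assms \<eta> by real_asymp
  qed (use \<eta> in auto)
  then show ?thesis using eventually_gt_at_top[of 0]
  proof eventually_elim
    case (elim x)
    have rx: "0 < r * x" using elim assms by simp
    have "2 * r * x - \<epsilon> * x \<le> (2 - 5 * \<eta>) * (r * x)"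
      using mult_right_mono[OF \<eta>(3), of x] elim by (simp add: algebra_simps)
    also have "\<dots> \<le> ((2 - 3 * \<eta>) * (1 - \<eta>)) * (r * x)"
      using \<eta> rx by (intro mult_right_mono) (auto simp: algebra_simps)
    also have "\<dots> = (2 - 3 * \<eta>) * r * x * (1 - \<eta>)" by simp
    also have "\<dots> \<le> (2 - 3 * \<eta>) * r * x * (1 - 20000 / (r * x * \<eta> ^ 4))"
      using elim \<eta> assms by (intro mult_left_mono) auto
    finally have *: "2 * r * x - \<epsilon> * x \<le> (2 - 3 * \<eta>) * r * x * (1 - 20000 / (r * x * \<eta> ^ 4))" .
    show ?case
      using eventually_mean_passage_ge[OF assms(1) \<eta>(1,2) elim(2), of "occ lam" "occ mu"]
      by eventually_elim (use * in linarith)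
  qed
qed

lemma eventually_mean_le:
  assumes "lam \<le> s" "mu * s < 1" "0 < \<epsilon>" "0 < x"
  shows "eventually (\<lambda>N. mean_at x (s\<^sup>2 * x) N \<le> 2 * s * x + \<epsilon> * x) sequentially"
proof -
  have "s * x + s\<^sup>2 * x / s = 2 * s * x" using assms lam by (simp add: power2_eq_square)
  then show ?thesis
    using eventually_mean_passage_le[of lam mu s x "s\<^sup>2 * x" "\<epsilon> * x"] assms lam mu by (simp add: mult.assoc)
qed

text \<open>Difference quotient over the times from s^2 x to r^2 x. The upper bound on the mean is
  applied at \<open>s\<close>, inside the fan, whereas the lower bound at \<open>r\<close> holds for
  every positive \<open>r\<close>; so \<open>r\<close> may lie outside.\<close>

lemma fan_upper:
  assumes s: "lam \<le> s" "mu * s < 1" and r: "s < r" and \<epsilon>: "0 < \<epsilon>"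
  shows "eventually (\<lambda>x. (1 / lam - mu) * P x (s\<^sup>2 * x) \<le> 1 / lam - 2 / (s + r) + \<epsilon>) at_top"
proof -
  \<comment> \<open>Two errors \<eta> x, divided by the elapsed time (r^2 - s^2) x, add up to
    \<epsilon>.\<close>
  define \<eta> where "\<eta> = \<epsilon> * (r\<^sup>2 - s\<^sup>2) / 2"
  have pos: "0 < s" "0 < r" using s r lam by linarith+
  have sq: "r\<^sup>2 - s\<^sup>2 = (r - s) * (s + r)" by (simp add: power2_eq_square algebra_simps)
  then have d: "0 < r\<^sup>2 - s\<^sup>2" using pos r by simp
  have \<eta>: "0 < \<eta>" using d \<epsilon> by (simp add: \<eta>_def)
  have \<eta>2: "2 * \<eta> = (r\<^sup>2 - s\<^sup>2) * \<epsilon>" by (simp add: \<eta>_def)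
  show ?thesis
    using eventually_mean_ge[OF pos(2) \<eta>] eventually_gt_at_top[of 0]
  proof eventually_elim
    case (elim x)
    define q where "q = 1 / lam - (1 / lam - mu) * P x (s\<^sup>2 * x)"
    have "2 * r * x - \<eta> * x - (2 * s * x + \<eta> * x) \<le> (r\<^sup>2 * x - s\<^sup>2 * x) * q"
      unfolding q_def using elim d by (intro increment_limits(1) eventually_mean_le s \<eta>) auto
    then have "x * (2 * (r - s) - 2 * \<eta>) \<le> x * ((r\<^sup>2 - s\<^sup>2) * q)"
      by (simp add: algebra_simps)
    then have "2 * (r - s) - 2 * \<eta> \<le> (r\<^sup>2 - s\<^sup>2) * q"
      using elim by simp
    moreover have "2 * (r - s) = (r\<^sup>2 - s\<^sup>2) * (2 / (s + r))" unfolding sq using pos by simp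
    ultimately have "(r\<^sup>2 - s\<^sup>2) * (2 / (s + r) - \<epsilon>) \<le> (r\<^sup>2 - s\<^sup>2) * q"
      unfolding right_diff_distrib distrib_left \<eta>2[symmetric] by linarith
    then show ?case using d by (simp add: q_def)
  qed
qed

text \<open>The same quotient with its later end at \<open>s\<close>. As \<open>r\<close> may drop
  below \<open>lam\<close>, the edge \<open>s = lam\<close> of the fan is included.\<close>

lemma fan_lower:
  assumes s: "lam \<le> s" "mu * s < 1" and r: "0 < r" "r < s" and \<epsilon>: "0 < \<epsilon>"
  shows "eventually (\<lambda>x. 1 / lam - 2 / (s + r) - \<epsilon> \<le> (1 / lam - mu) * P x (s\<^sup>2 * x)) at_top"
proof -
  define \<eta> where "\<eta> = \<epsilon> * (s\<^sup>2 - r\<^sup>2) / 2"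
  have pos: "0 < s" "0 < r" using s r lam by linarith+
  have sq: "s\<^sup>2 - r\<^sup>2 = (s - r) * (s + r)" by (simp add: power2_eq_square algebra_simps)
  then have d: "0 < s\<^sup>2 - r\<^sup>2" using pos r by simp
  have \<eta>: "0 < \<eta>" using d \<epsilon> by (simp add: \<eta>_def)
  have \<eta>2: "2 * \<eta> = (s\<^sup>2 - r\<^sup>2) * \<epsilon>" by (simp add: \<eta>_def)
  show ?thesis
    using eventually_mean_ge[OF pos(2) \<eta>] eventually_gt_at_top[of 0]
  proof eventually_elim
    case (elim x)
    define q where "q = 1 / lam - (1 / lam - mu) * P x (s\<^sup>2 * x)"
    have "(s\<^sup>2 * x - r\<^sup>2 * x) * q \<le> (2 * s * x + \<eta> * x) - (2 * r * x - \<eta> * x)"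
      unfolding q_def using elim d by (intro increment_limits(2) eventually_mean_le s \<eta>) auto
    then have "x * ((s\<^sup>2 - r\<^sup>2) * q) \<le> x * (2 * (s - r) + 2 * \<eta>)"
      by (simp add: algebra_simps)
    then have "(s\<^sup>2 - r\<^sup>2) * q \<le> 2 * (s - r) + 2 * \<eta>"
      using elim by simp
    moreover have "2 * (s - r) = (s\<^sup>2 - r\<^sup>2) * (2 / (s + r))" unfolding sq using pos by simp
    ultimately have "(s\<^sup>2 - r\<^sup>2) * q \<le> (s\<^sup>2 - r\<^sup>2) * (2 / (s + r) + \<epsilon>)"
      unfolding right_diff_distrib distrib_left \<eta>2[symmetric] by linarith
    then show ?case using d by (simp add: q_def)
  qed
qed

lemma fan_limit:
  assumes s: "lam \<le> s" "mu * s < 1"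
  shows "((\<lambda>x. P x (s\<^sup>2 * x)) \<longlongrightarrow> (1 / lam - 1 / s) / (1 / lam - mu)) at_top"
proof -
  have K: "0 < 1 / lam - mu" using mu_less by simp
  have pos: "0 < s" using s lam by linarith
  have cont: "((\<lambda>r. 2 / (s + r)) \<longlongrightarrow> 2 / (s + s)) (at s within A)" for A
    using pos by (intro tendsto_intros) auto
  have third: "3 * (z / 3) = z" for z :: real by simp
  have s1: "2 / (s + s) = 1 / s" using pos by simp
  have "((\<lambda>x. (1 / lam - mu) * P x (s\<^sup>2 * x)) \<longlongrightarrow> 1 / lam - 1 / s) at_top"
  proof (rule order_tendstoI)
    fix y assume y: "y < 1 / lam - 1 / s"
    \<comment> \<open>One third pays for replacing 2 / (s + r) by 1 / s, one for the error in
      \<open>fan_lower\<close>, and the last makes the inequality strict.\<close>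
    define \<epsilon> where "\<epsilon> = (1 / lam - 1 / s - y) / 3"
    have \<epsilon>: "0 < \<epsilon>" using y by (simp add: \<epsilon>_def)
    have y\<epsilon>: "y = 1 / lam - 1 / s - 3 * \<epsilon>" unfolding \<epsilon>_def third by simp
    have "eventually (\<lambda>r. 2 / (s + r) < 1 / s + \<epsilon>) (at_left s)"
      by (rule order_tendstoD(2)[OF cont]) (use \<epsilon> s1 in simp)
    moreover have "eventually (\<lambda>r. r < s \<and> 0 < r) (at_left s)"
      using eventually_at_left_real[OF pos] by eventually_elim auto
    ultimately obtain r where r: "2 / (s + r) < 1 / s + \<epsilon>" "r < s" "0 < r"
      using eventually_happens[OF eventually_conj] trivial_limit_at_left_real[of s] by blast
    show "eventually (\<lambda>x. y < (1 / lam - mu) * P x (s\<^sup>2 * x)) at_top"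
      using fan_lower[OF s r(3,2) \<epsilon>] by eventually_elim (use r \<epsilon> y\<epsilon> in linarith)
  next
    fix y assume y: "y > 1 / lam - 1 / s"
    define \<epsilon> where "\<epsilon> = (y - (1 / lam - 1 / s)) / 3"
    have \<epsilon>: "0 < \<epsilon>" using y by (simp add: \<epsilon>_def)
    have y\<epsilon>: "y = 1 / lam - 1 / s + 3 * \<epsilon>" unfolding \<epsilon>_def third by simp
    have "eventually (\<lambda>r. 1 / s - \<epsilon> < 2 / (s + r)) (at_right s)"
      by (rule order_tendstoD(1)[OF cont]) (use \<epsilon> s1 in simp)
    moreover have "eventually (\<lambda>r. s < r) (at_right s)"
      by (simp add: eventually_at_filter)
    ultimately obtain r where r: "1 / s - \<epsilon> < 2 / (s + r)" "s < r"
      using eventually_happens[OF eventually_conj] trivial_limit_at_right_real[of s] by blast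
    show "eventually (\<lambda>x. (1 / lam - mu) * P x (s\<^sup>2 * x) < y) at_top"
      using fan_upper[OF s r(2) \<epsilon>] by eventually_elim (use r \<epsilon> y\<epsilon> in linarith)
  qed
  then have "((\<lambda>x. (1 / lam - mu) * P x (s\<^sup>2 * x) / (1 / lam - mu)) \<longlongrightarrow> (1 / lam - 1 / s) / (1 / lam - mu))
      at_top"
    using K by (intro tendsto_divide tendsto_const) auto
  then show ?thesis using K by simp
qed

text \<open>Inside the fan s = \<surd>a. Outside, monotonicity in time compares with the fan: its
  formula tends to 1 as s approaches 1 / \<mu> and vanishes at s = \<lambda>, and the trivial bounds
  on a probability do the rest.\<close>

lemma P_limit:
  assumes a: "0 \<le> a"
  shows "((\<lambda>x. P x (a * x)) \<longlongrightarrow> (if a \<ge> 1 / mu\<^sup>2 then 1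
               else if a \<ge> lam\<^sup>2 then (1 / lam - sqrt (1 / a)) / (1 / lam - mu)
               else 0)) at_top"
proof -
  have K: "0 < 1 / lam - mu" using mu_less by simp
  consider "a \<ge> 1 / mu\<^sup>2" | "a < 1 / mu\<^sup>2" "a \<ge> lam\<^sup>2" | "a < 1 / mu\<^sup>2" "a < lam\<^sup>2" by linarith
  then show ?thesis
  proof cases
    case 1
    have "((\<lambda>x. P x (a * x)) \<longlongrightarrow> 1) at_top"
    proof (rule order_tendstoI)
      fix y :: real assume y: "y < 1"
      have inv: "lam < 1 / mu" using mu lam_mu by (simp add: field_simps)
      have "((\<lambda>s. (1 / lam - 1 / s) / (1 / lam - mu)) \<longlongrightarrow> (1 / lam - 1 / (1 / mu)) / (1 / lam - mu))
          (at_left (1 / mu))"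
        using mu K by (intro tendsto_intros) auto
      then have "eventually (\<lambda>s. y < (1 / lam - 1 / s) / (1 / lam - mu)) (at_left (1 / mu))"
        by (rule order_tendstoD(1)) (use y K in simp)
      moreover have "eventually (\<lambda>s. s < 1 / mu \<and> lam < s) (at_left (1 / mu))"
        using eventually_at_left_real[OF inv] by eventually_elim auto
      ultimately obtain s where s: "y < (1 / lam - 1 / s) / (1 / lam - mu)" "s < 1 / mu" "lam < s"
        using eventually_happens[OF eventually_conj] trivial_limit_at_left_real[of "1 / mu"] by blast
      have "s\<^sup>2 \<le> (1 / mu)\<^sup>2" using s lam by (intro power_mono) auto
      then have sa: "s\<^sup>2 \<le> a" using 1 by (simp add: power_divide)
      have "mu * s < 1" using s mu by (simp add: field_simps)
      then have "eventually (\<lambda>x. y < P x (s\<^sup>2 * x)) at_top"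
        using s by (intro order_tendstoD(1)[OF fan_limit]) auto
      then show "eventually (\<lambda>x. y < P x (a * x)) at_top" using eventually_gt_at_top[of 0]
      proof eventually_elim
        case (elim x)
        have "P x (s\<^sup>2 * x) \<le> P x (a * x)" using elim sa by (intro P_mono mult_right_mono) auto
        then show ?case using elim by simp
      qed
    next
      fix y :: real assume y: "1 < y"
      show "eventually (\<lambda>x. P x (a * x) < y) at_top" using eventually_gt_at_top[of 0]
      proof eventually_elim
        case (elim x)
        then show ?case using P_bounds(2)[of x "a * x"] y a by simp
      qed
    qed
    then show ?thesis using 1 by simp
  next
    case 2
    have "sqrt a < 1 / mu" using 2 mu by (intro real_less_lsqrt) (auto simp: power_divide)
    then have "mu * sqrt a < 1" using mu by (simp add: field_simps)
    moreover have "lam \<le> sqrt a" using 2 by (intro real_le_rsqrt) auto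
    ultimately show ?thesis using fan_limit[of "sqrt a"] 2 a by (simp add: real_sqrt_divide)
  next
    case 3
    have lim: "((\<lambda>x. P x (lam\<^sup>2 * x)) \<longlongrightarrow> 0) at_top"
      using fan_limit[of lam] lam_mu by (simp add: mult.commute)
    have le: "eventually (\<lambda>x. P x (a * x) \<le> P x (lam\<^sup>2 * x)) at_top"
      using eventually_gt_at_top[of 0] by eventually_elim (use 3 a in \<open>auto intro!: P_mono mult_right_mono\<close>)
    have ge: "eventually (\<lambda>x. 0 \<le> P x (a * x)) at_top"
      using eventually_gt_at_top[of 0] by eventually_elim (use a in \<open>auto intro!: P_bounds\<close>)
    have "((\<lambda>x. P x (a * x)) \<longlongrightarrow> 0) at_top"
      by (rule tendsto_sandwich[OF ge le tendsto_const lim])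
    then show ?thesis using 3 by simp
  qed
qed

end

subsection \<open>Chronological lists\<close>

definition before :: "real \<times> real \<Rightarrow> real \<times> real \<Rightarrow> bool" where
  "before e e' \<longleftrightarrow> snd e < snd e' \<or> (snd e = snd e' \<and> fst e < fst e')"

lemma sorted_wrt_unique:
  assumes "\<And>x y. R x y \<Longrightarrow> \<not> R y x"
  shows "sorted_wrt R xs \<Longrightarrow> sorted_wrt R ys \<Longrightarrow> set xs = set ys \<Longrightarrow> xs = ys"
proof (induction xs arbitrary: ys)
  case (Cons x xs)
  then obtain y ys' where ys: "ys = y # ys'" by (cases ys) auto
  have irr: "\<not> R z z" for z using assms by blast
  have "x = y"
  proof (rule ccontr)
    assume "x \<noteq> y"
    then have "R x y" "R y x" using Cons.prems by (auto simp: ys)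
    then show False using assms by blast
  qed
  moreover have "x \<notin> set xs" "y \<notin> set ys'" using Cons.prems irr by (auto simp: ys)
  ultimately have "set xs = set ys'" using Cons.prems(3) by (auto simp: ys)
  then show ?case using Cons.IH[of ys'] Cons.prems \<open>x = y\<close> by (simp add: ys)
qed simp

lemma sorted_wrt_concat_map:
  "sorted_wrt R ks \<Longrightarrow> (\<And>k. k \<in> set ks \<Longrightarrow> sorted_wrt Q (f k)) \<Longrightarrow>
   (\<And>k l x y. R k l \<Longrightarrow> x \<in> set (f k) \<Longrightarrow> y \<in> set (f l) \<Longrightarrow> Q x y) \<Longrightarrow> sorted_wrt Q (concat (map f ks))"
  by (induction ks) (auto simp: sorted_wrt_append)

lemma chronological:
  assumes "finite E"
  shows "set (chronological E) = E" "sorted_wrt before (chronological E)"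
proof -
  have fin: "finite (snd ` E)" using assms by simp
  have fin': "finite {u. (u, s) \<in> E}" for s
    by (rule finite_subset[of _ "fst ` E"]) (use assms in \<open>auto intro: rev_image_eqI\<close>)
  have eq: "chronological E = concat (map (\<lambda>s. map (\<lambda>u. (u, s)) (sorted_list_of_set {u. (u, s) \<in> E}))
      (sorted_list_of_set (snd ` E)))"
    by (simp add: chronological_def)
  show "set (chronological E) = E"
    unfolding eq using fin fin' by (auto simp: image_iff intro: bexI)
  show "sorted_wrt before (chronological E)"
    unfolding eq
  proof (rule sorted_wrt_concat_map[of "(<)"])
    show "sorted_wrt (<) (sorted_list_of_set (snd ` E))" by (rule strict_sorted_list_of_set)
    show "sorted_wrt before (map (\<lambda>u. (u, s)) (sorted_list_of_set {u. (u, s) \<in> E}))" for s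
      using strict_sorted_list_of_set[of "{u. (u, s) \<in> E}"]
      by (simp add: sorted_wrt_map before_def)
  qed (auto simp: before_def)
qed

text \<open>An asymmetric order has at most one sorted enumeration of a set. Filtering, mapping and
  appending chronological lists thus reduce to checking sortedness and the set of entries.\<close>

lemma chronological_eqI: "sorted_wrt before es \<Longrightarrow> set es = E \<Longrightarrow> chronological E = es"
  using chronological[of E] by (intro sorted_wrt_unique[of before]) (auto simp: before_def)

lemma chronological_filter:
  "finite E \<Longrightarrow> chronological {e \<in> E. P e} = filter P (chronological E)"
  by (rule chronological_eqI) (auto simp: chronological sorted_wrt_filter)

lemma chronological_map:
  assumes "finite E" "strict_mono_on (fst ` E) f" "strict_mono_on (snd ` E) g"
  shows "chronological (map_prod f g ` E) = map (map_prod f g) (chronological E)"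
proof (rule chronological_eqI)
  have "sorted_wrt (\<lambda>e e'. before (map_prod f g e) (map_prod f g e')) (chronological E)"
  proof (rule sorted_wrt_mono_rel[OF _ chronological(2)[OF assms(1)]])
    fix e e' assume "e \<in> set (chronological E)" "e' \<in> set (chronological E)" "before e e'"
    then show "before (map_prod f g e) (map_prod f g e')"
      using assms by (auto simp: before_def chronological dest!: strict_mono_onD[of _ f "fst e"
          "fst e'"] strict_mono_onD[of _ g "snd e" "snd e'"])
  qed
  then show "sorted_wrt before (map (map_prod f g) (chronological E))" by (simp add: sorted_wrt_map)
qed (use assms in \<open>simp add: chronological\<close>)

lemma chronological_append:
  assumes "finite E" "finite F" "\<And>e e'. e \<in> E \<Longrightarrow> e' \<in> F \<Longrightarrow> snd e < snd e'"
  shows "chronological (E \<union> F) = chronological E @ chronological F"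
  using assms by (intro chronological_eqI) (auto simp: sorted_wrt_append chronological before_def)

subsection \<open>The coupling of the two particle systems\<close>

definition jumps :: "(real \<times> real) list \<Rightarrow> real set \<Rightarrow> real set" where
  "jumps es A = fold (\<lambda>(u, s). jump u) es A"

lemma jumps_simps [simp]: "jumps [] A = A" "jumps (e # es) A = jumps es (jump (fst e) A)"
  "jumps (es @ es') A = jumps es' (jumps es A)"
  by (auto simp: jumps_def case_prod_unfold)

definition coupled :: "real set \<Rightarrow> real set \<Rightarrow> bool" where
  "coupled A B \<longleftrightarrow> A = B \<or> (\<exists>y. y \<notin> B \<and> A = insert y B)"

lemma remove_next_finite:
  assumes "finite A"
  shows "remove_next u A = (if {y \<in> A. u < y} = {} then A else A - {Min {y \<in> A. u < y}})"
proof (cases "{y \<in> A. u < y} = {}")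
  case True then show ?thesis by (auto simp: remove_next_def)
next
  case False
  let ?S = "{y \<in> A. u < y}"
  have fin: "finite ?S" using assms by simp
  have "{y \<in> A. u < y \<and> (\<forall>z\<in>A. u < z \<longrightarrow> y \<le> z)} = {Min ?S}"
  proof (intro equalityI subsetI)
    fix y assume "y \<in> {y \<in> A. u < y \<and> (\<forall>z\<in>A. u < z \<longrightarrow> y \<le> z)}"
    then have "Min ?S = y" using fin by (intro Min_eqI) auto
    then show "y \<in> {Min ?S}" by simp
  next
    fix y assume "y \<in> {Min ?S}"
    then have "y = Min ?S" by simp
    then show "y \<in> {y \<in> A. u < y \<and> (\<forall>z\<in>A. u < z \<longrightarrow> y \<le> z)}"
      using Min_in[OF fin False] Min_le[OF fin] by auto
  qed
  then show ?thesis unfolding remove_next_def if_not_P[OF False] by simp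
qed

lemma finite_remove_next: "finite A \<Longrightarrow> finite (remove_next u A)"
  by (simp add: remove_next_def)

lemma finite_jump: "finite A \<Longrightarrow> finite (jump u A)"
  by (simp add: jump_def finite_remove_next)

lemma coupled_remove_next: "finite A \<Longrightarrow> coupled A (remove_next u A)"
  unfolding coupled_def remove_next_finite using Min_in[of "{y \<in> A. u < y}"] by auto

text \<open>If the extra particle \<open>y\<close> is not to the right of \<open>u\<close>, both
  sets lose the same particle or none. If \<open>y\<close> is the first one there, \<open>A\<close>
  loses \<open>y\<close> and \<open>B\<close> its own next particle, to which the discrepancy moves;
  if \<open>B\<close> has none, the sets become equal. Otherwise both lose a particle before
  \<open>y\<close>.\<close>

lemma coupled_remove_next_both:
  assumes "finite B" "coupled A B"
  shows "coupled (remove_next u A) (remove_next u B)"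
proof -
  consider "A = B" | y where "y \<notin> B" "A = insert y B" using assms by (auto simp: coupled_def)
  then show ?thesis
  proof cases
    case 2
    let ?S = "{z \<in> B. u < z}"
    have fin: "finite A" "finite ?S" using 2 assms by auto
    show ?thesis
    proof (cases "u < y")
      case False
      then have eq: "{z \<in> A. u < z} = ?S" using 2 by auto
      show ?thesis
        unfolding remove_next_finite[OF fin(1)] remove_next_finite[OF assms(1)] eq
        using 2 False Min_in[OF fin(2)] by (auto simp: coupled_def)
    next
      case True
      then have eq: "{z \<in> A. u < z} = insert y ?S" using 2 by auto
      show ?thesis
      proof (cases "?S = {}")
        case True
        then have "{z \<in> A. u < z} = {y}" using eq by (simp only:)
        then have "remove_next u A = B" "remove_next u B = B"
          unfolding remove_next_finite[OF fin(1)] remove_next_finite[OF assms(1)] True using 2 by auto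
        then show ?thesis by (simp add: coupled_def)
      next
        case False
        have min: "Min (insert y ?S) = min y (Min ?S)" using fin False by simp
        have "Min ?S \<in> B" using Min_in[OF fin(2) False] by auto
        then have "y \<noteq> Min ?S" using 2 by auto
        then show ?thesis
          unfolding remove_next_finite[OF fin(1)] remove_next_finite[OF assms(1)] eq min
          using False 2 \<open>Min ?S \<in> B\<close> by (cases "y < Min ?S") (auto simp: coupled_def min_def)
      qed
    qed
  qed (simp add: coupled_def)
qed

lemma coupled_jump: "finite B \<Longrightarrow> coupled A B \<Longrightarrow> coupled (jump u A) (jump u B)"
  using coupled_remove_next_both[of B A u] coupled_remove_next_both[of B A 0]
  by (auto simp: jump_def coupled_def)

lemma coupled_jumps: "finite B \<Longrightarrow> coupled A B \<Longrightarrow> coupled (jumps es A) (jumps es B)"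
  by (induction es arbitrary: A B) (simp_all add: coupled_jump finite_jump)

lemma jump_subset: "jump u A \<subseteq> (if 0 < u then insert u A else A)"
  by (auto simp: jump_def remove_next_def)

lemma jumps_subset: "jumps es A \<subseteq> A \<union> {u \<in> fst ` set es. 0 < u}"
proof (induction es arbitrary: A)
  case (Cons e es)
  then show ?case using jump_subset[of "fst e" A] by (fastforce split: if_splits)
qed simp

subsection \<open>Consistency of the restrictions\<close>

lemma remove_next_restrict: "remove_next u (A \<inter> {0<..R}) = remove_next u A \<inter> {0<..R}" if "0 \<le> u" "A \<subseteq> {0<..}"
  using that by (fastforce simp: remove_next_def)

text \<open>An event at u > R leaves (0, R] alone. An event at u \<le> R removes the same particle
  of (0, R] in both views, or none if the next particle lies beyond R.\<close>

lemma jumps_restrict: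
  assumes "\<And>e. e \<in> set es \<Longrightarrow> 0 \<le> fst e" "A \<subseteq> {0<..}"
  shows "jumps es A \<inter> {0<..R} = jumps (filter (\<lambda>e. fst e \<le> R) es) (A \<inter> {0<..R})"
  using assms
proof (induction es arbitrary: A)
  case (Cons e es)
  have pos: "0 \<le> fst e" using Cons.prems by auto
  have sub: "jump (fst e) A \<subseteq> {0<..}" using jump_subset[of "fst e" A] Cons.prems(2) by (auto split: if_splits)
  have "jump (fst e) A \<inter> {0<..R} = (if fst e \<le> R then jump (fst e) (A \<inter> {0<..R}) else A \<inter> {0<..R})"
  proof (cases "fst e \<le> R")
    case True
    then show ?thesis using pos Cons.prems(2) by (auto simp: jump_def remove_next_restrict)
  next
    case False
    then show ?thesis using pos Cons.prems(2) by (auto simp: jump_def remove_next_def)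
  qed
  then show ?case using Cons.IH[OF _ sub] Cons.prems(1) by auto
qed simp

definition box_events :: "real \<Rightarrow> real set \<Rightarrow> (real \<times> real) set \<Rightarrow> real \<Rightarrow> (real \<times> real) set" where
  "box_events R snk alp t = ({0} \<times> snk \<union> alp) \<inter> ({0..R} \<times> {0<..t})"

lemma hammersley_upto_eq:
  "hammersley_upto R init snk alp t = jumps (chronological (box_events R snk alp t)) (init \<inter> {0<..R})"
  by (simp add: hammersley_upto_def jumps_def box_events_def)

text \<open>Deterministic properties that every outcome has, so the pathwise statements hold
  everywhere on the sample space and not just almost everywhere.\<close>

locale configuration =
  fixes src snk :: "real set" and alp :: "(real \<times> real) set"
  assumes src: "src \<subseteq> {0<..}" "locally_finite src"
    and snk: "snk \<subseteq> {0<..}" "locally_finite snk"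
    and alp: "alp \<subseteq> {0<..} \<times> {0<..}" "locally_finite alp"
begin

lemma finite_src: "finite (src \<inter> {0<..R})"
  using src by (simp add: locally_finite_def)

lemma finite_events: "finite (box_events R snk alp t)"
proof -
  have "finite (snk \<inter> {0<..t})" using snk by (simp add: locally_finite_def)
  moreover have "bounded ({0..R} \<times> {0<..t})"
    by (rule bounded_subset[of "{0..R} \<times> {0..t}"]) (auto intro: bounded_Times)
  then have "finite (alp \<inter> ({0..R} \<times> {0<..t}))" using alp by (simp add: locally_finite_def)
  ultimately have "finite ({0} \<times> (snk \<inter> {0<..t}) \<union> (alp \<inter> ({0..R} \<times> {0<..t})))" by simp
  then show ?thesis by (rule rev_finite_subset) (auto simp: box_events_def)
qed

definition particles where "particles R t = hammersley_upto R src snk alp t"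
definition particles' where "particles' R t = hammersley_upto R (remove_next 0 src) snk alp t"

lemma remove_next_src: "remove_next 0 src \<inter> {0<..R} = remove_next 0 (src \<inter> {0<..R})"
  using src by (simp add: remove_next_restrict)

lemma particles_eq:
  "particles R t = jumps (chronological (box_events R snk alp t)) (src \<inter> {0<..R})"
  "particles' R t = jumps (chronological (box_events R snk alp t)) (remove_next 0 (src \<inter> {0<..R}))"
  by (simp_all add: particles_def particles'_def hammersley_upto_eq remove_next_src)

lemma coupled_particles: "coupled (particles R t) (particles' R t)"
  unfolding particles_eq by (intro coupled_jumps coupled_remove_next finite_remove_next finite_src)

lemma particles_subset: "particles R t \<subseteq> {0<..R}" "particles' R t \<subseteq> {0<..R}"
proof -
  have "jumps (chronological (box_events R snk alp t)) A \<subseteq> {0<..R}" if "A \<subseteq> {0<..R}" for A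
  proof -
    have "{u \<in> fst ` box_events R snk alp t. 0 < u} \<subseteq> {0<..R}" by (auto simp: box_events_def)
    then show ?thesis
      using order.trans[OF jumps_subset[of "chronological (box_events R snk alp t)" A]] that
      unfolding chronological(1)[OF finite_events] by blast
  qed
  moreover have "remove_next 0 (src \<inter> {0<..R}) \<subseteq> {0<..R}" by (auto simp: remove_next_def)
  ultimately show "particles R t \<subseteq> {0<..R}" "particles' R t \<subseteq> {0<..R}" by (auto simp: particles_eq)
qed

lemma particles_restrict:
  assumes "R \<le> R'"
  shows "particles R' t \<inter> {0<..R} = particles R t" "particles' R' t \<inter> {0<..R} = particles' R t"
proof -
  have "box_events R snk alp t = {e \<in> box_events R' snk alp t. fst e \<le> R}" using assms
      by (auto simp: box_events_def)
  then have ev: "filter (\<lambda>e. fst e \<le> R) (chronological (box_events R' snk alp t)) =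
      chronological (box_events R snk alp t)"
    by (simp add: chronological_filter finite_events)
  have nonneg: "\<And>e. e \<in> set (chronological (box_events R' snk alp t)) \<Longrightarrow> 0 \<le> fst e"
    unfolding chronological(1)[OF finite_events] by (auto simp: box_events_def)
  have init: "src \<inter> {0<..R'} \<inter> {0<..R} = src \<inter> {0<..R}" using assms by auto
  then have init': "remove_next 0 (src \<inter> {0<..R'}) \<inter> {0<..R} = remove_next 0 (src \<inter> {0<..R})"
    using remove_next_restrict[of 0 "src \<inter> {0<..R'}" R] by (simp add: init le_infI2 greaterThanAtMost_def)
  have sub: "remove_next 0 (src \<inter> {0<..R'}) \<subseteq> {0<..}" by (auto simp: remove_next_def)
  have sub': "src \<inter> {0<..R'} \<subseteq> {0<..}" by auto
  show "particles R' t \<inter> {0<..R} = particles R t" "particles' R' t \<inter> {0<..R} = particles' R t"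
    unfolding particles_eq using jumps_restrict[OF nonneg sub', where R=R] jumps_restrict[OF nonneg sub,
        where R=R]
    by (simp_all add: ev init init')
qed

text \<open>No discrepancy is visible in (0, R]: the second class particle is beyond
  \<open>R\<close>.\<close>

definition merged :: "real \<Rightarrow> real \<Rightarrow> bool" where
  "merged R t \<longleftrightarrow> particles R t = particles' R t"

lemma merged_antimono: "R \<le> R' \<Longrightarrow> merged R' t \<Longrightarrow> merged R t"
  using particles_restrict by (metis merged_def)

lemma hammersley_restrict:
  assumes "0 < R"
  shows "hammersley src snk alp t \<inter> {0<..R} = particles R t"
    "hammersley (remove_next 0 src) snk alp t \<inter> {0<..R} = particles' R t"
proof -
  have *: "(\<Union>R\<in>{0<..}. F R) \<inter> {0<..R} = F R"
    if "\<And>R R'. R \<le> R' \<Longrightarrow> F R' \<inter> {0<..R} = F R" "\<And>R. F R \<subseteq> {0<..R}" for F :: "real \<Rightarrow> real set"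
  proof (intro equalityI subsetI)
    fix z assume "z \<in> (\<Union>R\<in>{0<..}. F R) \<inter> {0<..R}"
    then obtain R' where z: "z \<in> F R'" "z \<in> {0<..R}" by auto
    have "F R' = F (max R R') \<inter> {0<..R'}" "F R = F (max R R') \<inter> {0<..R}" using that(1) by auto
    then show "z \<in> F R" using z by auto
  next
    fix z assume "z \<in> F R" then show "z \<in> (\<Union>R\<in>{0<..}. F R) \<inter> {0<..R}" using that(2)[of R] assms by auto
  qed
  show "hammersley src snk alp t \<inter> {0<..R} = particles R t"
    unfolding hammersley_def particles_def[symmetric] by (rule *[OF particles_restrict(1) particles_subset(1)])
  show "hammersley (remove_next 0 src) snk alp t \<inter> {0<..R} = particles' R t"
    unfolding hammersley_def particles'_def[symmetric] by (rule *[OF particles_restrict(2) particles_subset(2)])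
qed

lemma hammersley_pos:
  "hammersley src snk alp t \<subseteq> {0<..}" "hammersley (remove_next 0 src) snk alp t \<subseteq> {0<..}"
  unfolding hammersley_def particles_def[symmetric] particles'_def[symmetric] using particles_subset
      by fastforce+

lemma hammersley_memb:
  assumes "0 < z"
  shows "z \<in> hammersley src snk alp t \<longleftrightarrow> z \<in> particles z t"
    "z \<in> hammersley (remove_next 0 src) snk alp t \<longleftrightarrow> z \<in> particles' z t"
  using hammersley_restrict[OF assms, of t] assms by auto

text \<open>For equal configurations the predicate defining \<open>dual_second_class\<close> is
  unsatisfiable, so the value is one fixed default, common to all outcomes and times.\<close>

lemma dual_second_class_merged:
  assumes "\<And>R. 0 < R \<Longrightarrow> merged R t"
  shows "dual_second_class src snk alp t = (THE y. False)"
proof -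
  have "hammersley src snk alp t = hammersley (remove_next 0 src) snk alp t"
    unfolding hammersley_def particles_def[symmetric] particles'_def[symmetric]
    using assms by (auto simp: merged_def)
  then show ?thesis unfolding dual_second_class_def by (intro arg_cong[where f=The]) auto
qed

text \<open>The window \<open>R0\<close> shows an extra particle \<open>y\<close>. A larger window
  also has exactly one, which must be the same.\<close>

lemma dual_second_class_iff:
  assumes R0: "0 < R0" "\<not> merged R0 t" and x: "0 < x"
  shows "x < dual_second_class src snk alp t \<longleftrightarrow> merged x t"
proof -
  let ?H = "hammersley src snk alp t" and ?G = "hammersley (remove_next 0 src) snk alp t"
  obtain y where y: "y \<notin> particles' R0 t" "particles R0 t = insert y (particles' R0 t)"
    using coupled_particles[of R0 t] R0 by (auto simp: coupled_def merged_def)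
  have y0: "0 < y" "y \<le> R0" using y particles_subset(1)[of R0 t] by auto
  have y_iff: "y \<notin> ?G" "y \<in> ?H"
    using y y0 hammersley_restrict[OF R0(1), of t] by auto
  have H: "?H = insert y ?G"
  proof (intro set_eqI iffI)
    fix z assume z: "z \<in> ?H"
    then have z0: "0 < z" using hammersley_pos by auto
    let ?R = "max z R0"
    have "particles ?R t \<noteq> particles' ?R t" using merged_antimono[of R0 ?R t] R0 by (auto simp: merged_def)
    then obtain w where w: "w \<notin> particles' ?R t" "particles ?R t = insert w (particles' ?R t)"
      using coupled_particles[of ?R t] by (auto simp: coupled_def)
    have "0 < ?R" using z0 by (simp add: less_max_iff_disj)
    note res = hammersley_restrict[OF this, of t]
    have "y \<in> particles ?R t" "y \<notin> particles' ?R t"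
      unfolding res[symmetric] using y_iff y0 by auto
    then have "w = y" using w by auto
    moreover have "z \<in> particles ?R t" unfolding res[symmetric] using z z0 by auto
    ultimately show "z \<in> insert y ?G" using w unfolding res[symmetric] by auto
  next
    fix z assume z: "z \<in> insert y ?G"
    show "z \<in> ?H"
    proof (cases "z = y")
      case False
      then have zG: "z \<in> ?G" using z by simp
      then have z0: "0 < z" using hammersley_pos by auto
      have "z \<in> particles' z t" using zG hammersley_memb[OF z0] by simp
      then have "z \<in> particles z t" using coupled_particles[of z t] by (auto simp: coupled_def)
      then show ?thesis using hammersley_memb[OF z0] by simp
    qed (use y_iff in simp)
  qed
  have uniq: "y' = y" if "y' \<notin> ?G" "?H = insert y' ?G" for y'
  proof -
    have "y \<in> insert y' ?G" using y_iff(2) by (simp only: that(2)[symmetric])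
    then show ?thesis using y_iff(1) by blast
  qed
  have "dual_second_class src snk alp t = y"
    unfolding dual_second_class_def
    by (rule the_equality) (use y_iff(1) H uniq in blast)+
  moreover have "merged x t \<longleftrightarrow> x < y"
  proof -
    have "merged x t \<longleftrightarrow> insert y ?G \<inter> {0<..x} = ?G \<inter> {0<..x}"
      by (simp only: merged_def hammersley_restrict[OF x, symmetric] H)
    also have "\<dots> \<longleftrightarrow> y \<notin> {0<..x}" using y_iff(1) by blast
    finally show ?thesis using y0 by auto
  qed
  ultimately show ?thesis by simp
qed

end

subsection \<open>Equivariance under order isomorphisms\<close>

lemma remove_next_image:
  assumes "strict_mono_on S f" "A \<subseteq> S" "u \<in> S"
  shows "remove_next (f u) (f ` A) = f ` remove_next u A"
proof -
  have less: "f a < f b \<longleftrightarrow> a < b" and le: "f a \<le> f b \<longleftrightarrow> a \<le> b" if "a \<in> S" "b \<in> S" for a b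
    using that assms(1) strict_mono_on_less strict_mono_on_less_eq by blast+
  have inj: "inj_on f A" using assms strict_mono_on_imp_inj_on inj_on_subset by blast
  have *: "{y \<in> f ` A. f u < y \<and> (\<forall>z\<in>f ` A. f u < z \<longrightarrow> y \<le> z)} = f ` {y \<in> A. u < y \<and> (\<forall>z\<in>A. u < z \<longrightarrow> y \<le> z)}"
    using less le assms(2,3) by (auto simp: subset_iff image_iff)
  show ?thesis unfolding remove_next_def * using inj by (intro inj_on_image_set_diff[symmetric]) auto
qed

lemma jump_image:
  assumes "strict_mono_on S f" "A \<subseteq> S" "u \<in> S" "0 \<in> S" "f 0 = 0" "0 \<le> u"
  shows "jump (f u) (f ` A) = f ` jump u A"
proof -
  have "0 < f u \<longleftrightarrow> 0 < u" using strict_mono_on_less[OF assms(1), of 0 u] assms by simp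
  then show ?thesis
    using remove_next_image[OF assms(1,2,3)] remove_next_image[OF assms(1,2,4)] assms(5) by (simp add: jump_def)
qed

text \<open>The dynamics sees positions only through their order and through the value 0 that marks
  sinks, and times only through the order of the list; hence \<open>g\<close> is arbitrary.\<close>

lemma jumps_image:
  assumes "strict_mono_on S f" "0 \<in> S" "f 0 = 0" "\<And>e. e \<in> set es \<Longrightarrow> fst e \<in> S \<and> 0 \<le> fst e" "A \<subseteq> S"
  shows "jumps (map (map_prod f g) es) (f ` A) = f ` jumps es A"
  using assms(4,5)
proof (induction es arbitrary: A)
  case (Cons e es)
  have "fst e \<in> S" using Cons.prems(1)[of e] by simp
  then have "jump (fst e) A \<subseteq> S" using jump_subset[of "fst e" A] Cons.prems(2) by (auto split: if_splits)
  then show ?case using Cons jump_image[OF assms(1) Cons.prems(2) _ assms(2,3)] by simp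
qed simp

subsection \<open>Lattice configurations without ties\<close>

text \<open>Indices are shifted by one because coordinate 0 is the axis on which the sinks
  lie.\<close>

definition pts :: "bool list \<Rightarrow> real set" where
  "pts xs = {real (Suc i) |i. i < length xs \<and> xs ! i}"

definition row_events :: "nat \<Rightarrow> bool \<times> bool list \<Rightarrow> (real \<times> real) set" where
  "row_events j r = (if fst r then {(0, real (Suc j))} else {}) \<union> (\<lambda>u. (u, real (Suc j))) ` pts (snd r)"

definition alp_pts :: "(bool \<times> bool list) list \<Rightarrow> (real \<times> real) set" where
  "alp_pts rs = {(u, real (Suc j)) |u j. j < length rs \<and> u \<in> pts (snd (rs ! j))}"

definition grid_events :: "(bool \<times> bool list) list \<Rightarrow> (real \<times> real) set" where
  "grid_events rs = {0} \<times> pts (map fst rs) \<union> alp_pts rs"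

text \<open>Two marks in a row act simultaneously in \<open>lrow\<close> but one after the other in
  \<open>jumps\<close>, and with two marks in a column a point may occur where a particle already
  sits. In both cases the two dynamics may differ.\<close>

definition no_ties :: "bool list \<Rightarrow> (bool \<times> bool list) list \<Rightarrow> bool" where
  "no_ties xs rs \<longleftrightarrow> (\<forall>r\<in>set rs. ntrue (fst r # snd r) \<le> 1) \<and>
     (\<forall>i<length xs. ntrue (xs ! i # map (\<lambda>r. snd r ! i) rs) \<le> 1)"

lemma pts_iff [simp]: "real (Suc i) \<in> pts xs \<longleftrightarrow> i < length xs \<and> xs ! i"
  by (auto simp: pts_def)

lemma pts_eqI: "(\<And>i. real (Suc i) \<in> A \<longleftrightarrow> i < length xs \<and> xs ! i) \<Longrightarrow> A \<subseteq> range (\<lambda>i. real (Suc i)) \<Longrightarrow> A = pts xs"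
  by (auto simp: pts_def image_iff subset_iff)

lemma pts_range: "pts xs \<subseteq> range (\<lambda>i. real (Suc i))"
  by (auto simp: pts_def)

lemma pts_bounds: "u \<in> pts xs \<Longrightarrow> 0 < u \<and> u \<le> real (length xs)"
  by (auto simp: pts_def)

lemma finite_pts [simp]: "finite (pts xs)"
  by (simp add: pts_def)

lemma pts_inject:
  assumes "length xs = length zs" shows "pts xs = pts zs \<longleftrightarrow> xs = zs"
proof
  assume eq: "pts xs = pts zs"
  show "xs = zs"
  proof (rule nth_equalityI[OF assms])
    fix i assume "i < length xs"
    then show "xs ! i = zs ! i" using pts_iff[of i xs] pts_iff[of i zs] eq assms by simp
  qed
qed simp

lemma nth_drop_first: "i < length ys \<Longrightarrow> drop_first ys ! i \<longleftrightarrow> ys ! i \<and> (\<exists>k<i. ys ! k)"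
proof (induction ys arbitrary: i)
  case (Cons y ys)
  show ?case
  proof (cases i)
    case (Suc i')
    then show ?thesis using Cons by (auto simp: less_Suc_eq_0_disj)
  qed auto
qed simp

lemma remove_next_pts:
  assumes "u \<le> length xs"
  shows "remove_next (real u) (pts xs) = pts (take u xs @ drop_first (drop u xs))"
proof (rule pts_eqI)
  fix i
  have "real (Suc i) \<in> remove_next (real u) (pts xs) \<longleftrightarrow>
    i < length xs \<and> xs ! i \<and> \<not> (u \<le> i \<and> (\<forall>k<length xs. xs ! k \<longrightarrow> u \<le> k \<longrightarrow> i \<le> k))"
    unfolding remove_next_def by (auto simp: pts_def less_Suc_eq_le)
  also have "\<dots> \<longleftrightarrow> i < length xs \<and> xs ! i \<and> (u \<le> i \<longrightarrow> (\<exists>k<i. u \<le> k \<and> xs ! k))"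
    by (meson not_le order.strict_trans)
  also have "\<dots> \<longleftrightarrow> i < length (take u xs @ drop_first (drop u xs)) \<and> (take u xs @ drop_first (drop u xs)) ! i"
  proof (cases "i < u")
    case False
    then obtain l where l: "i = u + l" by (metis le_Suc_ex not_le)
    have "(\<exists>k<u + l. u \<le> k \<and> xs ! k) \<longleftrightarrow> (\<exists>k<l. xs ! (u + k))"
      by (metis add_less_cancel_left le_Suc_ex le_add1)
    then show ?thesis using assms by (auto simp: l nth_append nth_drop_first)
  qed (use assms in \<open>auto simp: nth_append\<close>)
  finally show "real (Suc i) \<in> remove_next (real u) (pts xs) \<longleftrightarrow>
    i < length (take u xs @ drop_first (drop u xs)) \<and> (take u xs @ drop_first (drop u xs)) ! i" .
next
  show "remove_next (real u) (pts xs) \<subseteq> range (\<lambda>i. real (Suc i))"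
    using pts_range by (auto simp: remove_next_def)
qed

lemma remove_next_0_pts: "remove_next 0 (pts xs) = pts (drop_first xs)"
  using remove_next_pts[of 0 xs] by simp

lemma pts_update: "i < length xs \<Longrightarrow> insert (real (Suc i)) (pts xs) = pts (xs[i := True])"
  using pts_range[of xs] by (intro pts_eqI) (auto simp: nth_list_update simp del: of_nat_Suc)

text \<open>The point puts a particle in its own cell and starts a carry, which the next particle to
  the right absorbs by disappearing.\<close>

lemma lrow_single_point:
  assumes "length zs = length xs" "i < length xs" "zs ! i" "\<And>k. k < length xs \<Longrightarrow> k \<noteq> i \<Longrightarrow> \<not> zs ! k" "\<not> xs ! i"
  shows "lrow False xs zs = (take (Suc i) xs @ drop_first (drop (Suc i) xs))[i := True]"
  using assms
proof (induction xs arbitrary: i zs)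
  case (Cons x xs)
  from Cons.prems(1) obtain z zs' where zs: "zs = z # zs'" by (cases zs) auto
  show ?case
  proof (cases i)
    case 0
    have "\<not> (\<exists>z\<in>set zs'. z)"
    proof
      assume "\<exists>z\<in>set zs'. z"
      then obtain k where "k < length zs'" "zs' ! k" by (auto simp: in_set_conv_nth)
      then show False using Cons.prems(1) Cons.prems(4)[of "Suc k"] by (auto simp: zs 0)
    qed
    then show ?thesis using Cons.prems lrow_no_points[of zs' xs] by (auto simp: zs 0 cell_up_def cell_right_def)
  next
    case (Suc i')
    have "\<not> z" using Cons.prems(4)[of 0] by (auto simp: zs Suc)
    moreover have "lrow False xs zs' = (take (Suc i') xs @ drop_first (drop (Suc i') xs))[i' := True]"
      using Cons.prems(1,2,3,5) Cons.prems(4)[of "Suc k" for k] by (intro Cons.IH) (auto simp: zs Suc)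
    ultimately show ?thesis by (simp add: zs Suc cell_up_def cell_right_def)
  qed
qed simp

lemma jump_pts:
  assumes "length zs = length xs" "i < length xs" "zs ! i" "\<And>k. k < length xs \<Longrightarrow> k \<noteq> i \<Longrightarrow> \<not> zs ! k" "\<not> xs ! i"
  shows "jump (real (Suc i)) (pts xs) = pts (lrow False xs zs)"
proof -
  have "lrow False xs zs = (take (Suc i) xs @ drop_first (drop (Suc i) xs))[i := True]"
    by (rule lrow_single_point) (use assms in auto)
  then show ?thesis
    using assms(2) by (simp add: jump_def remove_next_pts pts_update del: of_nat_Suc)
qed

lemma ntrue_card: "ntrue zs = int (card {i. i < length zs \<and> zs ! i})"
  by (simp add: ntrue_def length_filter_conv_card)

lemma ntrue_le_1_unique:
  assumes "ntrue zs \<le> 1" "i < length zs" "zs ! i" "k < length zs" "zs ! k" shows "k = i"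
proof -
  have "card {i. i < length zs \<and> zs ! i} \<le> Suc 0" using assms(1) by (simp add: ntrue_card)
  then show ?thesis using assms by (subst (asm) card_le_Suc0_iff_eq) auto
qed

lemma ntrue_pos: "z \<in> set zs \<Longrightarrow> z \<Longrightarrow> 1 \<le> ntrue zs"
  by (induction zs) auto

lemma lrow_nth: "length zs = length xs \<Longrightarrow> i < length xs \<Longrightarrow> lrow y xs zs ! i \<Longrightarrow> xs ! i \<or> zs ! i"
proof (induction xs arbitrary: y zs i)
  case (Cons x xs)
  then obtain z zs' where zs: "zs = z # zs'" by (cases zs) auto
  show ?case using Cons by (cases i) (auto simp: zs cell_up_def split: if_splits)
qed simp

text \<open>A particle in a column stems from a source or a point of that column. With
  \<open>no_ties\<close> this shows that a cell is free when a point occurs there.\<close>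

lemma lrows_nth:
  assumes "\<And>r. r \<in> set rs \<Longrightarrow> length (snd r) = length xs" "i < length xs" "lrows rs xs ! i"
  shows "1 \<le> ntrue (xs ! i # map (\<lambda>r. snd r ! i) rs)"
  using assms
proof (induction rs arbitrary: xs)
  case (Cons r rs)
  have "1 \<le> ntrue (lrow (fst r) xs (snd r) ! i # map (\<lambda>r. snd r ! i) rs)"
    using Cons.prems by (intro Cons.IH) auto
  moreover have "lrow (fst r) xs (snd r) ! i \<Longrightarrow> xs ! i \<or> snd r ! i"
    using Cons.prems by (intro lrow_nth) auto
  ultimately show ?case by (auto simp: of_bool_def split: if_splits)
qed simp

lemma finite_grid_events [simp]: "finite (grid_events rs)" "finite (row_events j r)"
proof -
  have "alp_pts rs = (\<Union>j<length rs. (\<lambda>u. (u, real (Suc j))) ` pts (snd (rs ! j)))"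
    by (auto simp: alp_pts_def)
  then show "finite (grid_events rs)" by (simp add: grid_events_def)
qed (simp add: row_events_def)

lemma pts_snoc: "pts (xs @ [y]) = pts xs \<union> (if y then {real (Suc (length xs))} else {})"
proof (rule pts_eqI[symmetric])
  show "real (Suc i) \<in> pts xs \<union> (if y then {real (Suc (length xs))} else {}) \<longleftrightarrow> i <
      length (xs @ [y]) \<and> (xs @ [y]) ! i" for i
    by (cases "i < length xs") (auto simp: nth_append less_Suc_eq simp del: of_nat_Suc)
  show "pts xs \<union> (if y then {real (Suc (length xs))} else {}) \<subseteq> range (\<lambda>i. real (Suc i))"
    using pts_range[of xs] by auto
qed

lemma grid_events_snoc: "grid_events (rs @ [r]) = grid_events rs \<union> row_events (length rs) r"
proof -
  have "pts (map fst (rs @ [r])) = pts (map fst rs) \<union> (if fst r then {real (Suc (length rs))} else {})"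
    by (simp add: pts_snoc)
  moreover have "alp_pts (rs @ [r]) = alp_pts rs \<union> (\<lambda>u. (u, real (Suc (length rs)))) ` pts (snd r)"
  proof -
    have eq: "alp_pts qs = (\<Union>j<length qs. (\<lambda>u. (u, real (Suc j))) ` pts (snd (qs ! j)))" for qs
      by (auto simp: alp_pts_def)
    show ?thesis unfolding eq length_append_singleton lessThan_Suc by (auto simp: nth_append)
  qed
  ultimately show ?thesis by (auto simp: grid_events_def row_events_def)
qed

lemma chronological_grid_snoc:
  "chronological (grid_events (rs @ [r])) = chronological (grid_events rs) @ chronological
      (row_events (length rs) r)"
  unfolding grid_events_snoc
proof (rule chronological_append)
  fix e e' assume "e \<in> grid_events rs" "e' \<in> row_events (length rs) r"
  then have "snd e \<le> length rs" "snd e' = Suc (length rs)"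
    using pts_bounds[of _ "map fst rs"] by (auto simp: grid_events_def alp_pts_def row_events_def split:
        if_splits)
  then show "snd e < snd e'" by simp
qed auto

lemma chronological_simple: "chronological {} = []" "chronological {e} = [e]"
  by (rule chronological_eqI; simp)+

lemma jumps_row:
  assumes len: "length (snd r) = length xs" and simple: "ntrue (fst r # snd r) \<le> 1"
    and free: "\<And>i. i < length xs \<Longrightarrow> snd r ! i \<Longrightarrow> \<not> xs ! i"
  shows "jumps (chronological (row_events j r)) (pts xs) = pts (lrow (fst r) xs (snd r))"
proof (cases "\<exists>z\<in>set (snd r). z")
  case False
  have "\<not> snd r ! i" if "i < length (snd r)" for i
    using False nth_mem[OF that] by blast
  then have "pts (snd r) = {}" by (simp add: pts_def)
  then show ?thesis
    using lrow_no_points[OF False len]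
    by (cases "fst r") (simp_all add: row_events_def chronological_simple jump_def remove_next_0_pts)
next
  case True
  then obtain i where i: "i < length xs" "snd r ! i" using len by (auto simp: in_set_conv_nth)
  have "1 \<le> ntrue (snd r)" using True ntrue_pos by blast
  then have y: "\<not> fst r" "ntrue (snd r) \<le> 1" using simple by (cases "fst r"; simp)+
  have uniq: "\<not> snd r ! k" if "k < length xs" "k \<noteq> i" for k
    using ntrue_le_1_unique[OF y(2), of i k] i that len by auto
  have "j < length (snd r) \<and> snd r ! j \<longleftrightarrow> j = i" for j using i uniq len by auto
  then have "pts (snd r) = {real (Suc i)}" by (simp add: pts_def)
  then show ?thesis
    using y jump_pts[OF len i uniq free[OF i]]
        by (simp add: row_events_def chronological_simple del: of_nat_Suc)
qed

text \<open>Induction on the last row: its events come last in time, and by \<open>lrows_nth\<close>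
  for the rows before it, its point falls on a free cell.\<close>

lemma jumps_grid:
  assumes "no_ties xs rs" "\<And>r. r \<in> set rs \<Longrightarrow> length (snd r) = length xs"
  shows "jumps (chronological (grid_events rs)) (pts xs) = pts (lrows rs xs)"
  using assms
proof (induction rs rule: rev_induct)
  case Nil
  have "grid_events [] = {}" by (auto simp: grid_events_def alp_pts_def pts_def)
  then show ?case by (simp add: chronological_simple)
next
  case (snoc r rs)
  have col: "ntrue (xs ! i # map (\<lambda>r. snd r ! i) rs) + of_bool (snd r ! i) \<le> 1" if "i < length xs" for i
    using snoc.prems(1) that by (auto simp: no_ties_def)
  have "no_ties xs rs"
    unfolding no_ties_def
  proof (intro conjI ballI allI impI)
    show "ntrue (fst q # snd q) \<le> 1" if "q \<in> set rs" for q using snoc.prems(1) that by (auto simp: no_ties_def)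
    show "ntrue (xs ! i # map (\<lambda>r. snd r ! i) rs) \<le> 1" if "i < length xs" for i
      using col[OF that] by (simp add: of_bool_def split: if_splits)
  qed
  then have IH: "jumps (chronological (grid_events rs)) (pts xs) = pts (lrows rs xs)"
    using snoc by auto
  have "jumps (chronological (row_events (length rs) r)) (pts (lrows rs xs)) =
      pts (lrow (fst r) (lrows rs xs) (snd r))"
  proof (rule jumps_row)
    show "length (snd r) = length (lrows rs xs)" using snoc.prems by simp
    show "ntrue (fst r # snd r) \<le> 1" using snoc.prems by (simp add: no_ties_def)
    fix i assume "i < length (lrows rs xs)" "snd r ! i"
    then show "\<not> lrows rs xs ! i"
      using col[of i] lrows_nth[of rs xs i] snoc.prems(2) by fastforce
  qed
  then show ?case by (simp add: chronological_grid_snoc IH)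
qed

lemma no_ties_drop_first: "no_ties xs rs \<Longrightarrow> no_ties (drop_first xs) rs"
proof -
  assume *: "no_ties xs rs"
  show ?thesis
    unfolding no_ties_def
  proof (intro conjI ballI allI impI)
    show "ntrue (fst q # snd q) \<le> 1" if "q \<in> set rs" for q using * that by (auto simp: no_ties_def)
    fix i assume i: "i < length (drop_first xs)"
    then have "ntrue (xs ! i # map (\<lambda>r. snd r ! i) rs) \<le> 1" using * by (simp add: no_ties_def)
    moreover have "drop_first xs ! i \<Longrightarrow> xs ! i" using i by (simp add: nth_drop_first)
    ultimately show "ntrue (drop_first xs ! i # map (\<lambda>r. snd r ! i) rs) \<le> 1"
        by (auto simp: of_bool_def split: if_splits)
  qed
qed

text \<open>Halfway between \<open>merged\<close> and the lattice: the data are bits, the dynamics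
  is \<open>jumps\<close>. Agreement with \<open>merged\<close> is a pathwise matter, and
  disagreement with \<open>lrows\<close> requires a tie.\<close>

definition grid_merged :: "bool list \<Rightarrow> (bool \<times> bool list) list \<Rightarrow> bool" where
  "grid_merged xs rs \<longleftrightarrow> jumps (chronological (grid_events rs)) (pts xs) =
      jumps (chronological (grid_events rs)) (remove_next 0 (pts xs))"

lemma grid_merged_iff:
  assumes "no_ties xs rs" "\<And>r. r \<in> set rs \<Longrightarrow> length (snd r) = length xs"
  shows "grid_merged xs rs \<longleftrightarrow> lrows rs xs = lrows rs (drop_first xs)"
  unfolding grid_merged_def remove_next_0_pts
  using assms by (subst (1 2) jumps_grid) (auto simp: no_ties_drop_first pts_inject)

subsection \<open>Discretization\<close>

definition mesh_cell :: "nat \<Rightarrow> nat \<Rightarrow> real set" where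
  "mesh_cell N i = {real i / real N <.. real (Suc i) / real N}"

definition src_bits :: "nat \<Rightarrow> nat \<Rightarrow> real set \<Rightarrow> bool list" where
  "src_bits N m A = map (\<lambda>i. A \<inter> mesh_cell N i \<noteq> {}) [0..<m]"

definition row_bits :: "nat \<Rightarrow> nat \<Rightarrow> nat \<Rightarrow> real set \<Rightarrow> (real \<times> real) set \<Rightarrow> (bool \<times> bool list) list" where
  "row_bits N m n snk alp =
     map (\<lambda>j. (snk \<inter> mesh_cell N j \<noteq> {}, map (\<lambda>i. alp \<inter> mesh_cell N i \<times> mesh_cell N j \<noteq> {}) [0..<m])) [0..<n]"

abbreviation rgrid :: "nat \<Rightarrow> real \<Rightarrow> real" where
  "rgrid N z \<equiv> real (grid z N)"

lemma mesh_cell_iff: "0 < N \<Longrightarrow> 0 < z \<Longrightarrow> z \<in> mesh_cell N i \<longleftrightarrow> grid z N = Suc i"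
proof -
  assume N: "0 < N" and z: "0 < z"
  have "z \<in> mesh_cell N i \<longleftrightarrow> real i < z * real N \<and> z * real N \<le> real i + 1"
    using N by (simp add: mesh_cell_def field_simps)
  also have "\<dots> \<longleftrightarrow> \<lceil>z * real N\<rceil> = int (Suc i)"
    by (simp add: ceiling_eq_iff add.commute)
  also have "\<dots> \<longleftrightarrow> grid z N = Suc i" unfolding grid_def by linarith
  finally show ?thesis .
qed

lemma grid_pos: "0 < N \<Longrightarrow> 0 < z \<Longrightarrow> 0 < grid z N"
  by (simp add: grid_def)

lemma grid_0 [simp]: "grid 0 N = 0"
  by (simp add: grid_def)

text \<open>The occupied cells are the image of the points under the mesh map, which makes
  discretization accessible to the equivariance of the dynamics.\<close>

lemma pts_src_bits:
  assumes "0 < N" "A \<subseteq> {0<..}"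
  shows "pts (src_bits N m A) = {u \<in> rgrid N ` A. u \<le> real m}"
proof -
  have "u \<in> pts (src_bits N m A) \<longleftrightarrow> u \<in> rgrid N ` A \<and> u \<le> real m" for u
  proof
    assume "u \<in> pts (src_bits N m A)"
    then obtain i where i: "u = real (Suc i)" "i < m" "A \<inter> mesh_cell N i \<noteq> {}"
      by (auto simp: pts_def src_bits_def)
    then obtain z where u: "u = real (Suc i)" "i < m" "z \<in> A" "z \<in> mesh_cell N i" by blast
    then have "grid z N = Suc i" using mesh_cell_iff[OF assms(1), of z i] assms(2) by auto
    then show "u \<in> rgrid N ` A \<and> u \<le> real m" using u by (intro conjI image_eqI[of _ _ z]) auto
  next
    assume "u \<in> rgrid N ` A \<and> u \<le> real m"
    then obtain z where z: "z \<in> A" "u = rgrid N z" "grid z N \<le> m" by auto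
    then have "0 < z" using assms by auto
    then obtain i where i: "grid z N = Suc i" using grid_pos[OF assms(1), of z] by (cases "grid z N") auto
    then have "z \<in> mesh_cell N i" using mesh_cell_iff[OF assms(1) \<open>0 < z\<close>] by simp
    then have "i < length (src_bits N m A)" "src_bits N m A ! i" using z i by (auto simp: src_bits_def)
    then show "u \<in> pts (src_bits N m A)" unfolding z(2) i by (simp del: of_nat_Suc)
  qed
  then show ?thesis by blast
qed

lemma length_bits [simp]: "length (src_bits N m A) = m" "length (row_bits N m n snk alp) = n"
  "r \<in> set (row_bits N m n snk alp) \<Longrightarrow> length (snd r) = m"
  by (auto simp: src_bits_def row_bits_def)

lemma pts_fst_row_bits:
  assumes "0 < N" "snk \<subseteq> {0<..}"
  shows "pts (map fst (row_bits N m n snk alp)) = {s \<in> rgrid N ` snk. s \<le> real n}"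
proof -
  have "map fst (row_bits N m n snk alp) = src_bits N n snk"
    by (auto simp: row_bits_def src_bits_def)
  then show ?thesis using pts_src_bits[OF assms] by simp
qed

lemma alp_pts_row_bits:
  assumes "0 < N" "alp \<subseteq> {0<..} \<times> {0<..}"
  shows "alp_pts (row_bits N m n snk alp) = {e \<in> map_prod (rgrid N) (rgrid N) ` alp. fst e \<le>
      real m \<and> snd e \<le> real n}"
proof -
  have eq: "alp_pts (row_bits N m n snk alp) = {(real (Suc i), real (Suc j)) |i j. i < m \<and> j <
      n \<and> alp \<inter> mesh_cell N i \<times> mesh_cell N j \<noteq> {}}"
    by (auto simp: alp_pts_def row_bits_def pts_def)
  have iff: "(u, s) \<in> {(real (Suc i), real (Suc j)) |i j. i < m \<and> j <
      n \<and> alp \<inter> mesh_cell N i \<times> mesh_cell N j \<noteq> {}} \<longleftrightarrow>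
     (u, s) \<in> map_prod (rgrid N) (rgrid N) ` alp \<and> u \<le> real m \<and> s \<le> real n" for u s
  proof
    assume "(u, s) \<in> {(real (Suc i), real (Suc j)) |i j. i < m \<and> j <
        n \<and> alp \<inter> mesh_cell N i \<times> mesh_cell N j \<noteq> {}}"
    then obtain i j y z where u: "u = real (Suc i)" "s = real (Suc j)" "i < m" "j < n" "(y, z) \<in> alp"
        "y \<in> mesh_cell N i" "z \<in> mesh_cell N j"
      by auto
    then have "grid y N = Suc i" "grid z N = Suc j" using mesh_cell_iff[OF assms(1)] assms(2) by auto
    then show "(u, s) \<in> map_prod (rgrid N) (rgrid N) ` alp \<and> u \<le> real m \<and> s \<le> real n"
      using u by (intro conjI image_eqI[of _ _ "(y, z)"]) auto
  next
    assume "(u, s) \<in> map_prod (rgrid N) (rgrid N) ` alp \<and> u \<le> real m \<and> s \<le> real n"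
    then obtain y z where z: "(y, z) \<in> alp" "u = rgrid N y" "s = rgrid N z" "grid y N \<le> m" "grid z N \<le> n"
        by auto
    then have pos: "0 < y" "0 < z" using assms by auto
    obtain i j where ij: "grid y N = Suc i" "grid z N = Suc j"
      using grid_pos[OF assms(1) pos(1)] grid_pos[OF assms(1) pos(2)]
          by (cases "grid y N"; cases "grid z N") auto
    then have "(y, z) \<in> mesh_cell N i \<times> mesh_cell N j" using mesh_cell_iff[OF assms(1)] pos by simp
    then show "(u, s) \<in> {(real (Suc i), real (Suc j)) |i j. i < m \<and> j <
        n \<and> alp \<inter> mesh_cell N i \<times> mesh_cell N j \<noteq> {}}"
      using z ij by (intro CollectI exI[of _ i] exI[of _ j]) auto
  qed
  show ?thesis unfolding eq
  proof (rule set_eqI)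
    fix e :: "real \<times> real"
    obtain u s where e: "e = (u, s)" by (cases e)
    show "e \<in> {(real (Suc i), real (Suc j)) |i j. i < m \<and> j < n \<and> alp \<inter> mesh_cell N i \<times> mesh_cell N j \<noteq> {}} \<longleftrightarrow>
      e \<in> {e \<in> map_prod (rgrid N) (rgrid N) ` alp. fst e \<le> real m \<and> snd e \<le> real n}"
      unfolding e iff by simp
  qed
qed

lemma rgrid_bounds: "0 \<le> z \<Longrightarrow> z * real N \<le> rgrid N z" "0 \<le> z \<Longrightarrow> rgrid N z < z * real N + 1"
  by (auto simp: grid_def) linarith

text \<open>Rounding up errs by less than one cell, so two points are separated once 1 / N is below
  their distance; finitely many pairs allow a common threshold.\<close>

lemma eventually_strict_mono_rgrid:
  assumes "finite S" "S \<subseteq> {0..}"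
  shows "eventually (\<lambda>N. strict_mono_on S (rgrid N)) sequentially"
proof -
  have "eventually (\<lambda>N. rgrid N a < rgrid N b) sequentially" if "a \<in> S" "b \<in> S" "a < b" for a b
  proof -
    obtain k where k: "1 / (b - a) < real k" using reals_Archimedean2 by blast
    show ?thesis using eventually_ge_at_top[of k]
    proof eventually_elim
      case (elim N)
      have "1 / (b - a) < real N" using k elim by linarith
      then have "1 < (b - a) * real N" using that by (simp add: field_simps)
      then show ?case using rgrid_bounds(2)[of a N] rgrid_bounds(1)[of b N] that assms
          by (auto simp: algebra_simps)
    qed
  qed
  then have "eventually (\<lambda>N. \<forall>p\<in>{p \<in> S \<times> S. fst p < snd p}. rgrid N (fst p) < rgrid N (snd p)) sequentially"
    using assms by (intro eventually_ball_finite) auto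
  then show ?thesis by eventually_elim (auto simp: strict_mono_on_def)
qed

context configuration
begin

text \<open>The mesh map is eventually an order isomorphism on the relevant coordinates and it respects ties.  No
  genericity is assumed, so this gives measurability even when the probability space is not complete.\<close>

lemma eventually_merged_iff:
  assumes x: "0 < x" and t: "0 \<le> t"
  shows "eventually (\<lambda>N. merged x t \<longleftrightarrow>
     grid_merged (src_bits N (grid x N) src) (row_bits N (grid x N) (grid t N) snk alp)) sequentially"
proof -
  \<comment> \<open>Rounding up may give points just beyond \<open>x\<close> or \<open>t\<close> the
    index of the boundary. They lie within distance 1 by \<open>near\<close>, hence in this larger
    box, and strict monotonicity on \<open>S\<close>, which contains \<open>x\<close> and
    \<open>t\<close>, tells them apart from the boundary.\<close>
  let ?F = "box_events (x + 1) snk alp (t + 1)"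
  define S where "S = {0, x, t} \<union> (src \<inter> {0<..x + 1}) \<union> fst ` ?F \<union> snd ` ?F"
  have S: "finite S" "S \<subseteq> {0..}"
    using finite_src finite_events x t by (auto simp: S_def box_events_def)
  show ?thesis
    using eventually_strict_mono_rgrid[OF S] eventually_gt_at_top[of 0]
  proof eventually_elim
    case (elim N)
    define f where "f = rgrid N"
    have mono: "strict_mono_on S f" using elim by (simp add: f_def)
    have f0: "f 0 = 0" by (simp add: f_def)
    have near: "z \<le> y + 1" if "f z \<le> f y" "0 < z" "0 \<le> y" for z y
    proof -
      have "z * real N < y * real N + 1" using rgrid_bounds[of z N] rgrid_bounds[of y N] that
          by (simp add: f_def)
      also have "\<dots> \<le> (y + 1) * real N" using elim by (simp add: algebra_simps)
      finally show ?thesis using elim by simp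
    qed
    have le: "f z \<le> f y \<longleftrightarrow> z \<le> y" if "z \<in> S" "y \<in> S" for z y
      using strict_mono_on_less_eq[OF mono that] .
    have S0: "0 \<in> S" "x \<in> S" "t \<in> S" by (auto simp: S_def)
    have src_le: "f z \<le> f x \<longleftrightarrow> z \<le> x" if "z \<in> src" for z
    proof -
      have "0 < z" using that src by auto
      then have "z \<in> S" if "z \<le> x + 1" using that \<open>z \<in> src\<close> by (auto simp: S_def)
      then show ?thesis using near[of z x] le[of z x] \<open>0 < z\<close> x S0 by fastforce
    qed
    have snk_le: "f s \<le> f t \<longleftrightarrow> s \<le> t" if "s \<in> snk" for s
    proof -
      have "0 < s" using that snk by auto
      then have "(0, s) \<in> ?F" if "s \<le> t + 1" using that \<open>s \<in> snk\<close> x by (auto simp: box_events_def)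
      then have "s \<in> S" if "s \<le> t + 1" using that by (force simp: S_def)
      then show ?thesis using near[of s t] le[of s t] \<open>0 < s\<close> t S0 by fastforce
    qed
    have alp_le: "f u \<le> f x \<and> f s \<le> f t \<longleftrightarrow> u \<le> x \<and> s \<le> t" if "(u, s) \<in> alp" for u s
    proof -
      have pos: "0 < u" "0 < s" using that alp by auto
      have "(u, s) \<in> ?F" if "u \<le> x + 1" "s \<le> t + 1" using that pos \<open>(u, s) \<in> alp\<close> by (auto simp: box_events_def)
      then have "u \<in> S \<and> s \<in> S" if "u \<le> x + 1" "s \<le> t + 1" using that by (force simp: S_def)
      then show ?thesis using near[of u x] near[of s t] le[of u x] le[of s t] pos x t S0 by fastforce
    qed
    let ?A = "src \<inter> {0<..x}" and ?E = "box_events x snk alp t"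
    let ?xs = "src_bits N (grid x N) src" and ?rs = "row_bits N (grid x N) (grid t N) snk alp"
    have EF: "?E \<subseteq> ?F" by (auto simp: box_events_def)
    have A: "pts ?xs = f ` ?A"
      using pts_src_bits[OF elim(2) src(1), of "grid x N"] src_le src(1) by (auto simp: f_def)
    have K: "pts (map fst ?rs) = f ` (snk \<inter> {0<..t})"
      using pts_fst_row_bits[OF elim(2) snk(1), of "grid x N" "grid t N" alp] snk_le snk(1)
          by (auto simp: f_def)
    have L: "alp_pts ?rs = map_prod f f ` (alp \<inter> {0..x} \<times> {0<..t})"
    proof -
      have "alp_pts ?rs = map_prod f f ` {e \<in> alp. f (fst e) \<le> f x \<and> f (snd e) \<le> f t}"
        unfolding alp_pts_row_bits[OF elim(2) alp(1)] by (auto simp: f_def)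
      also have "{e \<in> alp. f (fst e) \<le> f x \<and> f (snd e) \<le> f t} = alp \<inter> {0..x} \<times> {0<..t}"
      proof (rule set_eqI)
        fix e :: "real \<times> real"
        obtain u s where e: "e = (u, s)" by (cases e)
        show "e \<in> {e \<in> alp. f (fst e) \<le> f x \<and> f (snd e) \<le> f t} \<longleftrightarrow> e \<in> alp \<inter> {0..x} \<times> {0<..t}"
          using alp_le[of u s] alp(1) by (auto simp: e)
      qed
      finally show ?thesis .
    qed
    have "?E = {0} \<times> (snk \<inter> {0<..t}) \<union> (alp \<inter> {0..x} \<times> {0<..t})" using x by (auto simp: box_events_def)
    then have E: "grid_events ?rs = map_prod f f ` ?E"
    proof -
      have "map_prod f f ` ({0} \<times> B) = {0} \<times> f ` B" for B using f0 by force
      then show ?thesis unfolding grid_events_def K L \<open>?E = _\<close> image_Un by simp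
    qed
    have ES: "fst ` ?E \<subseteq> S" "snd ` ?E \<subseteq> S" using EF by (auto simp: S_def)
    have AS: "?A \<subseteq> S" by (auto simp: S_def)
    have chron: "chronological (map_prod f f ` ?E) = map (map_prod f f) (chronological ?E)"
      using finite_events ES mono by (intro chronological_map) (auto intro: monotone_on_subset)
    have es: "fst e \<in> S \<and> 0 \<le> fst e" if "e \<in> set (chronological ?E)" for e
      using that ES S(2) unfolding chronological(1)[OF finite_events] by (auto simp: box_events_def)
    have R: "remove_next 0 (f ` ?A) = f ` remove_next 0 ?A"
      using remove_next_image[OF mono AS S0(1)] f0 by simp
    have RS: "remove_next 0 ?A \<subseteq> S" using AS by (auto simp: remove_next_def)
    have sub: "jumps (chronological ?E) B \<subseteq> S" if "B \<subseteq> S" for B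
      using jumps_subset[of "chronological ?E" B] that es by fastforce
    have "grid_merged ?xs ?rs \<longleftrightarrow> f ` jumps (chronological ?E) ?A =
        f ` jumps (chronological ?E) (remove_next 0 ?A)"
      unfolding grid_merged_def A E chron R
      using jumps_image[OF mono S0(1) f0 es AS] jumps_image[OF mono S0(1) f0 es RS] by simp
    also have "\<dots> \<longleftrightarrow> merged x t"
      unfolding merged_def particles_eq
      using strict_mono_on_imp_inj_on[OF mono] sub[OF AS] sub[OF RS] by (intro inj_on_image_eq_iff)
    finally show "merged x t \<longleftrightarrow> grid_merged ?xs ?rs" by simp
  qed
qed

end

subsection \<open>The law of the occupied cells\<close>

lemma space_configurations: "space configurations = {A. locally_finite A}"
  by (simp add: configurations_def space_measure_of_conv)

lemma sets_configurations:
  "B \<in> sets borel \<Longrightarrow> bounded B \<Longrightarrow> {A. locally_finite A \<and> card (A \<inter> B) = k} \<in> sets configurations"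
  unfolding configurations_def by (subst sets_measure_of) (auto intro!: sigma_sets.Basic)

context prob_space
begin

text \<open>Occupation of disjoint cells is independent and determined by void probabilities.
  Membership in \<open>process_events\<close> prepares the use of independence between the three
  processes.\<close>

lemma poisson_cells:
  fixes S :: "'a \<Rightarrow> 'b::euclidean_space set" and B :: "nat \<Rightarrow> 'b set" and v :: "nat \<Rightarrow> bool"
  assumes pp: "poisson_process M c D S"
    and B: "\<And>k. B k \<in> sets borel" "\<And>k. bounded (B k)" "\<And>k. B k \<subseteq> D" "disjoint_family B"
    and I: "finite I"
  defines "E \<equiv> {\<omega> \<in> space M. \<forall>k\<in>I. (S \<omega> \<inter> B k \<noteq> {}) = v k}"
  shows "E \<in> process_events M S" and "E \<in> events"
    and "prob E = (\<Prod>k\<in>I. if v k then 1 - exp (- (c * measure lborel (B k))) else exp (- (c *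
        measure lborel (B k))))"
proof -
  let ?V = "vimage_algebra (space M) S configurations"
  let ?X = "\<lambda>k \<omega>. card (S \<omega> \<inter> B k)"
  have meas: "S \<in> measurable M configurations" using pp by (simp add: poisson_process_def)
  have fin: "finite (S \<omega> \<inter> B k)" if "\<omega> \<in> space M" for \<omega> k
    using measurable_space[OF meas that] B(2)[of k] by (simp add: space_configurations locally_finite_def)
  have Z_eq: "{\<omega> \<in> space M. S \<omega> \<inter> B k = {}} = S -` {A. locally_finite A \<and> card (A \<inter> B k) = 0} \<inter> space M" for k
    using fin measurable_space[OF meas] by (auto simp: space_configurations)
  have Z: "{\<omega> \<in> space ?V. S \<omega> \<inter> B k = {}} \<in> sets ?V" for k
    unfolding space_vimage_algebra Z_eq using B by (intro in_vimage_algebra sets_configurations)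
  then have Z': "{\<omega> \<in> space ?V. (S \<omega> \<inter> B k \<noteq> {}) = v k} \<in> sets ?V" for k
  proof (cases "v k")
    case True
    have "{\<omega> \<in> space ?V. S \<omega> \<inter> B k \<noteq> {}} = space ?V - {\<omega> \<in> space ?V. S \<omega> \<inter> B k = {}}" by auto
    then show ?thesis using sets.compl_sets[OF Z[of k]] True by simp
  qed (use Z in simp)
  have "{\<omega> \<in> space ?V. \<forall>k\<in>I. (S \<omega> \<inter> B k \<noteq> {}) = v k} \<in> sets ?V"
    using Z' I by (intro sets.sets_Collect_finite_All) auto
  then show E: "E \<in> process_events M S" by (simp add: process_events_def E_def)
  have sub: "process_events M S \<subseteq> events"
    unfolding process_events_def using meas
    by (subst sets_vimage_algebra2) (auto dest: measurable_space intro: measurable_sets)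
  then show "E \<in> events" using E by blast
  have Zev: "{\<omega> \<in> space M. S \<omega> \<inter> B k = {}} \<in> events" for k
    using Z[of k] sub by (auto simp: process_events_def)
  have void: "prob {\<omega> \<in> space M. S \<omega> \<inter> B k = {}} = exp (- (c * measure lborel (B k)))" for k
  proof -
    have "{\<omega> \<in> space M. S \<omega> \<inter> B k = {}} = {\<omega> \<in> space M. ?X k \<omega> = 0}" using fin by auto
    also have "prob \<dots> = (c * measure lborel (B k)) ^ 0 / fact 0 * exp (- (c * measure lborel (B k)))"
      using B by (intro pp[unfolded poisson_process_def, THEN conjunct2, THEN conjunct2, THEN conjunct1,
          rule_format]) auto
    finally show ?thesis by simp
  qed
  have nonvoid: "prob {\<omega> \<in> space M. S \<omega> \<inter> B k \<noteq> {}} = 1 - exp (- (c * measure lborel (B k)))" for k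
  proof -
    have "{\<omega> \<in> space M. S \<omega> \<inter> B k \<noteq> {}} = space M - {\<omega> \<in> space M. S \<omega> \<inter> B k = {}}" by auto
    then show ?thesis using prob_compl[OF Zev[of k]] void[of k] by simp
  qed
  show "prob E = (\<Prod>k\<in>I. if v k then 1 - exp (- (c * measure lborel (B k))) else exp (- (c *
      measure lborel (B k))))"
  proof (cases "I = {}")
    case False
    have indep: "indep_vars (\<lambda>_. count_space UNIV) ?X UNIV"
      using B by (intro pp[unfolded poisson_process_def, THEN conjunct2, THEN conjunct2, THEN conjunct2,
          rule_format]) auto
    define A :: "nat \<Rightarrow> nat set" where "A k = (if v k then - {0} else {0})" for k
    have A: "?X k -` A k \<inter> space M = {\<omega> \<in> space M. (S \<omega> \<inter> B k \<noteq> {}) = v k}" for k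
      using fin[of _ k] by (auto simp: A_def)
    have "E = (\<Inter>k\<in>I. ?X k -` A k \<inter> space M)" unfolding A E_def using False by auto
    then have "prob E = (\<Prod>k\<in>I. prob (?X k -` A k \<inter> space M))"
      using indep_varsD[OF indep False I, of A] by simp
    also have "\<dots> = (\<Prod>k\<in>I. if v k then 1 - exp (- (c * measure lborel (B k))) else exp (- (c *
        measure lborel (B k))))"
      unfolding A using void nonvoid by (intro prod.cong) auto
    finally show ?thesis .
  qed (simp add: E_def prob_space)
qed

end

lemma mesh_cell_facts:
  assumes "0 < N"
  shows "mesh_cell N i \<in> sets borel" "bounded (mesh_cell N i)" "mesh_cell N i \<subseteq> {0<..}"
    "measure lborel (mesh_cell N i) = 1 / real N" "emeasure lborel (mesh_cell N i) = ennreal (1 / real N)"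
proof -
  have le: "real i / real N \<le> real (Suc i) / real N" by (simp add: divide_right_mono)
  have diff: "real (Suc i) / real N - real i / real N = 1 / real N" using assms by (simp add: field_simps)
  show "mesh_cell N i \<in> sets borel" by (simp add: mesh_cell_def)
  show "bounded (mesh_cell N i)" by (simp add: mesh_cell_def)
  have "0 < z" if "z \<in> mesh_cell N i" for z
  proof -
    have "0 \<le> real i / real N" by simp
    then show ?thesis using that unfolding mesh_cell_def by (auto simp del: divide_nonneg_nonneg)
  qed
  then show "mesh_cell N i \<subseteq> {0<..}" by auto
  show "measure lborel (mesh_cell N i) = 1 / real N" "emeasure lborel (mesh_cell N i) = ennreal (1 / real N)"
    unfolding mesh_cell_def using le diff by simp_all
qed

lemma disjoint_mesh_cell:
  assumes "0 < N" "z \<in> mesh_cell N i" "z \<in> mesh_cell N j" shows "i = j"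
proof -
  have "0 < z" using mesh_cell_facts(3)[OF assms(1), of i] assms(2) by auto
  then show ?thesis using mesh_cell_iff[OF assms(1), of z] assms by simp
qed

text \<open>The squares are enumerated by one natural number because independence in
  \<open>poisson_process\<close> is stated for sequences of sets. The row index comes first, as in
  the lists of rows.\<close>

definition square_cell :: "nat \<Rightarrow> nat \<Rightarrow> (real \<times> real) set" where
  "square_cell N k = (case prod_decode k of (j, i) \<Rightarrow> mesh_cell N i \<times> mesh_cell N j)"

lemma square_cell_facts:
  assumes "0 < N"
  shows "square_cell N k \<in> sets borel" "bounded (square_cell N k)" "square_cell N k \<subseteq> {0<..} \<times> {0<..}"
    "measure lborel (square_cell N k) = 1 / (real N)\<^sup>2" "disjoint_family (square_cell N)"
proof -
  obtain j i where k: "prod_decode k = (j, i)" by (cases "prod_decode k")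
  have eq: "square_cell N k = mesh_cell N i \<times> mesh_cell N j" by (simp add: square_cell_def k)
  show "square_cell N k \<in> sets borel" "bounded (square_cell N k)" "square_cell N k \<subseteq> {0<..} \<times> {0<..}"
    unfolding eq using mesh_cell_facts[OF assms] by (auto intro: bounded_Times borel_Times)
  have "emeasure lborel (square_cell N k) = emeasure (lborel \<Otimes>\<^sub>M lborel) (mesh_cell N i \<times> mesh_cell N j)"
    by (simp add: eq lborel_prod)
  also have "\<dots> = ennreal (1 / real N) * ennreal (1 / real N)"
    using mesh_cell_facts[OF assms] by (subst lborel.emeasure_pair_measure_Times) auto
  also have "\<dots> = ennreal (1 / (real N)\<^sup>2)" by (simp add: power2_eq_square flip: ennreal_mult)
  finally show "measure lborel (square_cell N k) = 1 / (real N)\<^sup>2" by (simp add: measure_def)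
  show "disjoint_family (square_cell N)"
    unfolding disjoint_family_on_def
  proof (intro ballI impI)
    fix k l :: nat assume "k \<noteq> l"
    obtain j i j' i' where d: "prod_decode k = (j, i)" "prod_decode l = (j', i')"
        by (cases "prod_decode k"; cases "prod_decode l")
    have "(j, i) \<noteq> (j', i')" using \<open>k \<noteq> l\<close> d by (metis prod_decode_inverse)
    then show "square_cell N k \<inter> square_cell N l = {}"
      using disjoint_mesh_cell[OF assms] by (auto simp: square_cell_def d)
  qed
qed

lemma pmf_replicate_pmf: "length xs = n \<Longrightarrow> pmf (replicate_pmf n p) xs = (\<Prod>i<n. pmf p (xs ! i))"
proof (induction n arbitrary: xs)
  case (Suc n)
  then obtain x ys where xs: "xs = x # ys" "length ys = n" by (cases xs) auto
  have "replicate_pmf (Suc n) p = map_pmf (\<lambda>(x, xs). x # xs) (pair_pmf p (replicate_pmf n p))"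
    by (simp add: pair_pmf_def map_bind_pmf bind_assoc_pmf bind_return_pmf)
  moreover have "inj (\<lambda>(x :: 'a, xs). x # xs)" by (auto simp: inj_def)
  ultimately have "pmf (replicate_pmf (Suc n) p) xs = pmf (pair_pmf p (replicate_pmf n p)) (x, ys)"
    using pmf_map_inj'[of "\<lambda>(x :: 'a, xs). x # xs" "pair_pmf p (replicate_pmf n p)" "(x, ys)"] by (simp add: xs)
  also have "\<dots> = (\<Prod>i<Suc n. pmf p (xs ! i))"
    using Suc.IH[OF xs(2)] by (simp add: pmf_pair xs prod.lessThan_Suc_shift del: prod.lessThan_Suc)
  finally show ?case .
qed simp

lemma pmf_conf_pmf:
  assumes "0 \<le> q" "q \<le> 1" "length xs = m"
  shows "pmf (conf_pmf q m) xs = (\<Prod>i<m. if xs ! i then q else 1 - q)"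
  unfolding conf_pmf_def pmf_replicate_pmf[OF assms(3)] using assms by (intro prod.cong) auto

definition lattices :: "nat \<Rightarrow> nat \<Rightarrow> (bool list \<times> (bool \<times> bool list) list) set" where
  "lattices m n = {(xs, rs). length xs = m \<and> length rs = n \<and> (\<forall>r\<in>set rs. length (snd r) = m)}"

lemma finite_lattices: "finite (lattices m n)"
proof -
  have fin: "finite {xs :: bool list. set xs \<subseteq> UNIV \<and> length xs = m}" by (rule finite_lists_length_eq) simp
  then have "finite ((UNIV :: bool set) \<times> {xs :: bool list. length xs = m})"
      by (intro finite_cartesian_product) auto
  then have "finite {rs. set rs \<subseteq> (UNIV :: bool set) \<times> {xs :: bool list. length xs = m} \<and> length rs = n}"
      by (rule finite_lists_length_eq)
  with fin have "finite ({xs :: bool list. set xs \<subseteq> UNIV \<and> length xs =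
      m} \<times> {rs. set rs \<subseteq> (UNIV :: bool set) \<times> {xs :: bool list. length xs = m} \<and> length rs = n})"
    by (rule finite_cartesian_product)
  then show ?thesis by (rule rev_finite_subset) (auto simp: lattices_def)
qed

lemma set_lattice_pmf: "v \<in> set_pmf (lattice_pmf a b p m n) \<Longrightarrow> v \<in> lattices m n"
proof -
  assume v: "v \<in> set_pmf (lattice_pmf a b p m n)"
  obtain xs rs where v_eq: "v = (xs, rs)" by (cases v)
  have "xs \<in> set_pmf (conf_pmf a m)" "rs \<in> set_pmf (rows_pmf b p m n)" using v
      by (auto simp: lattice_pmf_def v_eq)
  from length_conf_pmf[OF this(1)] length_rows_pmf[OF this(2)] show ?thesis by (simp add: lattices_def v_eq)
qed

lemma pmf_lattice:
  assumes "0 \<le> a" "a \<le> 1" "0 \<le> b" "b \<le> 1" "0 \<le> p" "p \<le> 1" "(xs, rs) \<in> lattices m n"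
  shows "pmf (lattice_pmf a b p m n) (xs, rs) = (\<Prod>i<m. if xs ! i then a else 1 - a) *
    ((\<Prod>j<n. if fst (rs ! j) then b else 1 - b) * (\<Prod>j<n. \<Prod>i<m. if snd (rs ! j) ! i then p else 1 - p))"
proof -
  have len: "length xs = m" "length rs = n" "\<And>j. j < n \<Longrightarrow> length (snd (rs ! j)) = m"
    using assms by (auto simp: lattices_def)
  have "pmf (rows_pmf b p m n) rs = (\<Prod>j<n. pmf (pair_pmf (bernoulli_pmf b) (conf_pmf p m)) (rs ! j))"
    by (simp add: rows_pmf_def pmf_replicate_pmf[OF len(2)])
  also have "\<dots> = (\<Prod>j<n. (if fst (rs ! j) then b else 1 - b) * (\<Prod>i<m. if snd (rs ! j) ! i then p else 1 - p))"
  proof (intro prod.cong refl)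
    fix j assume "j \<in> {..<n}"
    then show "pmf (pair_pmf (bernoulli_pmf b) (conf_pmf p m)) (rs ! j) =
        (if fst (rs ! j) then b else 1 - b) * (\<Prod>i<m. if snd (rs ! j) ! i then p else 1 - p)"
      using assms len(3)[of j] by (cases "rs ! j"; cases "fst (rs ! j)") (simp_all add: pmf_pair pmf_conf_pmf)
  qed
  finally show ?thesis using assms len by (simp add: lattice_pmf_def pmf_pair pmf_conf_pmf prod.distrib)
qed

context hammersley_sources_sinks
begin

definition bits :: "nat \<Rightarrow> nat \<Rightarrow> nat \<Rightarrow> 'w \<Rightarrow> bool list \<times> (bool \<times> bool list) list" where
  "bits N m n \<omega> = (src_bits N m (Src \<omega>), row_bits N m n (Snk \<omega>) (Alp \<omega>))"

lemma bits_in_lattices: "bits N m n \<omega> \<in> lattices m n"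
  by (auto simp: bits_def lattices_def)

text \<open>Independence of the three processes and of disjoint cells makes the occupation bits a
  product of Bernoulli variables.\<close>

lemma bits_law:
  assumes N: "0 < N" and pos: "0 < lambda" "0 < mu" and v: "v \<in> lattices m n"
  shows "{\<omega> \<in> space M. bits N m n \<omega> = v} \<in> events"
    and "prob {\<omega> \<in> space M. bits N m n \<omega> = v} = pmf (lattice_pmf (occ lambda N) (occ mu N) (occ2 N) m n) v"
proof -
  obtain xs rs where v_eq: "v = (xs, rs)" by (cases v)
  have len: "length xs = m" "length rs = n" "\<And>j. j < n \<Longrightarrow> length (snd (rs ! j)) = m"
    using v by (auto simp: lattices_def v_eq)
  define I where "I = prod_encode ` ({..<n} \<times> {..<m})"
  define A1 where "A1 = {\<omega> \<in> space M. \<forall>k\<in>{..<m}. (Src \<omega> \<inter> mesh_cell N k \<noteq> {}) = xs ! k}"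
  define A2 where "A2 = {\<omega> \<in> space M. \<forall>k\<in>{..<n}. (Snk \<omega> \<inter> mesh_cell N k \<noteq> {}) = fst (rs ! k)}"
  define A3 where "A3 = {\<omega> \<in> space M. \<forall>k\<in>I. (Alp \<omega> \<inter> square_cell N k \<noteq> {}) =
      (case prod_decode k of (j, i) \<Rightarrow> snd (rs ! j) ! i)}"
  have disj: "disjoint_family (mesh_cell N)"
    using disjoint_mesh_cell[OF N] by (fastforce simp: disjoint_family_on_def)
  note c1 = poisson_cells[OF sources mesh_cell_facts(1-3)[OF N] disj, of "{..<m}" "\<lambda>k. xs ! k", folded A1_def]
  note c2 = poisson_cells[OF sinks mesh_cell_facts(1-3)[OF N] disj, of "{..<n}"
      "\<lambda>k. fst (rs ! k)", folded A2_def]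
  have fI: "finite I" by (simp add: I_def)
  note c3 = poisson_cells[OF alpha_points square_cell_facts(1-3)[OF N] square_cell_facts(5)[OF N] fI,
      of "\<lambda>k. case prod_decode k of (j, i) \<Rightarrow> snd (rs ! j) ! i", folded A3_def]
  have set_eq: "{\<omega> \<in> space M. bits N m n \<omega> = v} = A1 \<inter> A2 \<inter> A3"
  proof -
    have map_eq: "map Q [0..<l] = ys \<longleftrightarrow> (\<forall>i<l. Q i = ys ! i)" if "length ys = l" for Q and ys :: "'x list" and l
      using that by (simp add: list_eq_iff_nth_eq)
    have "src_bits N m (Src \<omega>) = xs \<longleftrightarrow> (\<forall>k<m. (Src \<omega> \<inter> mesh_cell N k \<noteq> {}) = xs ! k)" for \<omega>
      unfolding src_bits_def by (rule map_eq[OF len(1)])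
    moreover have "row_bits N m n (Snk \<omega>) (Alp \<omega>) = rs \<longleftrightarrow>
       (\<forall>j<n. (Snk \<omega> \<inter> mesh_cell N j \<noteq> {}) = fst (rs ! j)) \<and>
           (\<forall>j<n. \<forall>i<m. (Alp \<omega> \<inter> mesh_cell N i \<times> mesh_cell N j \<noteq> {}) = snd (rs ! j) ! i)" for \<omega>
    proof -
      have "row_bits N m n (Snk \<omega>) (Alp \<omega>) = rs \<longleftrightarrow>
         (\<forall>j<n. (Snk \<omega> \<inter> mesh_cell N j \<noteq> {}, map (\<lambda>i. Alp \<omega> \<inter> mesh_cell N i \<times> mesh_cell N j \<noteq> {}) [0..<m]) =
             rs ! j)"
        unfolding row_bits_def by (rule map_eq[OF len(2)])
      also have "\<dots> \<longleftrightarrow> (\<forall>j<n. (Snk \<omega> \<inter> mesh_cell N j \<noteq> {}) = fst (rs ! j) \<and>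
          (\<forall>i<m. (Alp \<omega> \<inter> mesh_cell N i \<times> mesh_cell N j \<noteq> {}) = snd (rs ! j) ! i))"
        unfolding prod_eq_iff fst_conv snd_conv using map_eq[OF len(3)] by (simp only: cong: conj_cong imp_cong)
      finally show ?thesis by blast
    qed
    moreover have "(\<forall>k\<in>I. (Alp \<omega> \<inter> square_cell N k \<noteq> {}) = (case prod_decode k of (j, i) \<Rightarrow> snd (rs ! j) ! i)) \<longleftrightarrow>
       (\<forall>j<n. \<forall>i<m. (Alp \<omega> \<inter> mesh_cell N i \<times> mesh_cell N j \<noteq> {}) = snd (rs ! j) ! i)" for \<omega>
    proof -
      have "(\<forall>k\<in>I. Q k) \<longleftrightarrow> (\<forall>j<n. \<forall>i<m. Q (prod_encode (j, i)))" for Q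
        by (auto simp: I_def)
      then show ?thesis by (simp add: square_cell_def)
    qed
    ultimately have iff: "bits N m n \<omega> = v \<longleftrightarrow> (\<forall>k\<in>{..<m}. (Src \<omega> \<inter> mesh_cell N k \<noteq> {}) = xs ! k) \<and>
        (\<forall>k\<in>{..<n}. (Snk \<omega> \<inter> mesh_cell N k \<noteq> {}) = fst (rs ! k)) \<and>
        (\<forall>k\<in>I. (Alp \<omega> \<inter> square_cell N k \<noteq> {}) = (case prod_decode k of (j, i) \<Rightarrow> snd (rs ! j) ! i))" for \<omega>
      unfolding bits_def v_eq prod.inject lessThan_iff Ball_def by (simp only:)
    show ?thesis unfolding A1_def A2_def A3_def iff Collect_conj_eq
        by (simp only: Int_ac Int_absorb Int_left_absorb)
  qed
  show "{\<omega> \<in> space M. bits N m n \<omega> = v} \<in> events" unfolding set_eq using c1(2) c2(2) c3(2) by auto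
  have three: "{..<3::nat} = {0, 1, 2}" by auto
  have "prob (\<Inter>j\<in>{..<3::nat}. [A1, A2, A3] ! j) = (\<Prod>j\<in>{..<3}. prob ([A1, A2, A3] ! j))"
    by (rule indep_setsD[OF independent]) (use c1(1) c2(1) c3(1) in \<open>auto simp: three\<close>)
  then have "prob (A1 \<inter> A2 \<inter> A3) = prob A1 * (prob A2 * prob A3)"
    unfolding three by (simp add: Int_assoc mult.assoc)
  also have "prob A1 = (\<Prod>i<m. if xs ! i then occ lambda N else 1 - occ lambda N)"
    unfolding c1(3)[OF finite_lessThan] by (intro prod.cong) (simp_all add: mesh_cell_facts[OF N] occ_def)
  also have "prob A2 = (\<Prod>j<n. if fst (rs ! j) then occ mu N else 1 - occ mu N)"
    unfolding c2(3)[OF finite_lessThan] by (intro prod.cong) (simp_all add: mesh_cell_facts[OF N] occ_def)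
  also have "prob A3 = (\<Prod>j<n. \<Prod>i<m. if snd (rs ! j) ! i then occ2 N else 1 - occ2 N)"
    unfolding c3(3) I_def
    by (subst prod.reindex) (auto simp: inj_on_def square_cell_facts[OF N] occ2_def prod.cartesian_product
        intro!: prod.cong)
  also have "(\<Prod>i<m. if xs ! i then occ lambda N else 1 - occ lambda N) *
      ((\<Prod>j<n. if fst (rs ! j) then occ mu N else 1 - occ mu N) *
      (\<Prod>j<n. \<Prod>i<m. if snd (rs ! j) ! i then occ2 N else 1 - occ2 N)) =
          pmf (lattice_pmf (occ lambda N) (occ mu N) (occ2 N) m n) v"
    using v pos unfolding v_eq by (subst pmf_lattice) (auto simp: occ_bounds)
  finally show "prob {\<omega> \<in> space M. bits N m n \<omega> = v} =
      pmf (lattice_pmf (occ lambda N) (occ mu N) (occ2 N) m n) v"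
    by (simp only: set_eq)
qed

lemma bits_prob:
  assumes N: "0 < N" and pos: "0 < lambda" "0 < mu"
  shows "{\<omega> \<in> space M. \<Phi> (bits N m n \<omega>)} \<in> events"
    and "prob {\<omega> \<in> space M. \<Phi> (bits N m n \<omega>)} =
        pprob (lattice_pmf (occ lambda N) (occ mu N) (occ2 N) m n) {v. \<Phi> v}"
proof -
  let ?L = "{v \<in> lattices m n. \<Phi> v}"
  let ?p = "lattice_pmf (occ lambda N) (occ mu N) (occ2 N) m n"
  have fin: "finite ?L" using finite_lattices by simp
  have eq: "{\<omega> \<in> space M. \<Phi> (bits N m n \<omega>)} = (\<Union>v\<in>?L. {\<omega> \<in> space M. bits N m n \<omega> = v})"
    using bits_in_lattices by auto
  show "{\<omega> \<in> space M. \<Phi> (bits N m n \<omega>)} \<in> events"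
    unfolding eq using bits_law(1)[OF N pos] fin by (intro sets.finite_UN) auto
  have "prob {\<omega> \<in> space M. \<Phi> (bits N m n \<omega>)} = (\<Sum>v\<in>?L. prob {\<omega> \<in> space M. bits N m n \<omega> = v})"
    unfolding eq using bits_law(1)[OF N pos] fin
    by (intro finite_measure_finite_Union) (auto simp: disjoint_family_on_def)
  also have "\<dots> = (\<Sum>v\<in>?L. pmf ?p v)" using bits_law(2)[OF N pos] by (intro sum.cong) auto
  also have "\<dots> = pprob ?p ?L" by (rule measure_measure_pmf_finite[OF fin, symmetric])
  also have "\<dots> = pprob ?p {v. \<Phi> v}"
    by (intro antisym prob_mono_pmf) (auto dest: set_lattice_pmf)
  finally show "prob {\<omega> \<in> space M. \<Phi> (bits N m n \<omega>)} = pprob ?p {v. \<Phi> v}" .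
qed

end

subsection \<open>Ties\<close>

lemma map_nth_replicate_pmf: "j < n \<Longrightarrow> map_pmf (\<lambda>xs. xs ! j) (replicate_pmf n p) = p"
proof (induction n arbitrary: j)
  case (Suc n)
  show ?case
  proof (cases j)
    case 0
    then show ?thesis by (simp add: map_bind_pmf bind_return_pmf')
  next
    case (Suc i)
    then have "map_pmf (\<lambda>xs. xs ! i) (replicate_pmf n p) = p" using Suc.prems by (intro Suc.IH) simp
    then show ?thesis by (simp add: Suc map_bind_pmf) (simp add: map_pmf_def)
  qed
qed simp

text \<open>With S points in the list, the indicator of at least two marks is at most y S + S (S -
  1), whose mean follows from the first two moments.\<close>

lemma two_points_prob:
  fixes a q :: real
  assumes "0 \<le> a" "a \<le> 1" "0 \<le> q" "q \<le> 1"
  shows "pprob (pair_pmf (bernoulli_pmf a) (conf_pmf q m)) {(y, zs). \<not> ntrue (y # zs) \<le> 1} \<le>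
      a * (m * q) + (m * q)\<^sup>2"
proof -
  let ?E = "pexp (conf_pmf q m)"
  let ?S = "\<lambda>zs. real_of_int (ntrue zs)"
  have S: "?E ?S = m * q" using assms by (intro expectation_ntrue_conf)
  have S2: "?E (\<lambda>zs. ?S zs * (?S zs - 1)) = m * q * (1 - q) + (m * q)\<^sup>2 - m * q"
  proof -
    have "?E (\<lambda>zs. ?S zs * (?S zs - 1)) = ?E (\<lambda>zs. (?S zs - m * q)\<^sup>2 + ((2 * (m * q) - 1) * ?S zs - (m * q)\<^sup>2))"
      by (intro expectation_cong_pmf) (simp add: power2_eq_square algebra_simps)
    also have "\<dots> = ?E (\<lambda>zs. (?S zs - m * q)\<^sup>2) + ((2 * (m * q) - 1) * ?E ?S - (m * q)\<^sup>2)"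
      by (simp add: Bochner_Integration.integral_add Bochner_Integration.integral_diff)
    also have "\<dots> = m * q * (1 - q) + (m * q)\<^sup>2 - m * q"
      using variance_ntrue_conf[of q m] assms by (simp add: S power2_eq_square algebra_simps)
    finally show ?thesis .
  qed
  have "pprob (pair_pmf (bernoulli_pmf a) (conf_pmf q m)) {(y, zs). \<not> ntrue (y # zs) \<le> 1} \<le>
      pexp (pair_pmf (bernoulli_pmf a) (conf_pmf q m)) (\<lambda>(y, zs). of_bool y * ?S zs + ?S zs * (?S zs - 1))"
  proof (rule prob_le_expectation)
    fix w :: "bool \<times> bool list"
    obtain y zs where w: "w = (y, zs)" by (cases w)
    have "0 \<le> ntrue zs" by simp
    then have "ntrue zs = 0 \<or> 1 \<le> ntrue zs" by linarith
    then have nn: "0 \<le> ntrue zs * (ntrue zs - 1)" by auto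
    have "(of_bool (\<not> ntrue (y # zs) \<le> 1) :: int) \<le> of_bool y * ntrue zs + ntrue zs * (ntrue zs - 1)"
    proof (cases y)
      case False
      have "1 * 1 \<le> ntrue zs * (ntrue zs - 1)" if "2 \<le> ntrue zs" using that by (intro mult_mono) auto
      then show ?thesis using False nn by auto
    qed (use nn in auto)
    then have "(real_of_int (of_bool (\<not> ntrue (y # zs) \<le> 1))) \<le>
        real_of_int (of_bool y * ntrue zs + ntrue zs * (ntrue zs - 1))"
      by (rule of_int_le_iff[THEN iffD2])
    then show "indicator {(y, zs). \<not> ntrue (y # zs) \<le> 1} w \<le>
        (case w of (y, zs) \<Rightarrow> of_bool y * ?S zs + ?S zs * (?S zs - 1))"
      by (simp add: w indicator_def split: if_splits)
  qed simp
  also have "\<dots> = a * (m * q) + (m * q * (1 - q) + (m * q)\<^sup>2 - m * q)"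
    using assms by (simp add: expectation_pair S S2 Bochner_Integration.integral_add)
  also have "\<dots> \<le> a * (m * q) + (m * q)\<^sup>2" using assms by (simp add: mult_left_le)
  finally show ?thesis .
qed

lemma ties_prob:
  fixes a b p :: real
  assumes "0 \<le> a" "a \<le> 1" "0 \<le> b" "b \<le> 1" "0 \<le> p" "p \<le> 1"
  shows "pprob (lattice_pmf a b p m n) {(xs, rs). \<not> no_ties xs rs} \<le>
    n * (b * (m * p) + (m * p)\<^sup>2) + m * (a * (n * p) + (n * p)\<^sup>2)"
proof -
  let ?P = "pprob (lattice_pmf a b p m n)"
  let ?row = "\<lambda>j. {w :: bool list \<times> (bool \<times> bool list) list. \<not> ntrue (fst (snd w ! j) # snd (snd w ! j)) \<le> 1}"
  let ?col = "\<lambda>i. {w :: bool list \<times> (bool \<times> bool list) list.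
      \<not> ntrue (fst w ! i # map (\<lambda>r. snd r ! i) (snd w)) \<le> 1}"
  have row: "?P (?row j) \<le> b * (m * p) + (m * p)\<^sup>2" if "j < n" for j
  proof -
    have "?P (?row j) = pprob (map_pmf (\<lambda>rs. rs ! j) (rows_pmf b p m n)) {(y, zs). \<not> ntrue (y # zs) \<le> 1}"
      unfolding lattice_pmf_def prob_pair_snd[of _ _ "\<lambda>rs. \<not> ntrue (fst (rs ! j) # snd (rs ! j)) \<le> 1"]
      by (simp add: vimage_def case_prod_unfold)
    also have "\<dots> \<le> b * (m * p) + (m * p)\<^sup>2"
      unfolding rows_pmf_def map_nth_replicate_pmf[OF that] by (rule two_points_prob) (use assms in auto)
    finally show ?thesis .
  qed
  have col: "?P (?col i) \<le> a * (n * p) + (n * p)\<^sup>2" if "i < m" for i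
  proof -
    have "map_pmf (\<lambda>r. snd r ! i) (pair_pmf (bernoulli_pmf b) (conf_pmf p m)) =
        map_pmf (\<lambda>zs. zs ! i) (map_pmf snd (pair_pmf (bernoulli_pmf b) (conf_pmf p m)))"
      by (simp add: pmf.map_comp comp_def)
    also have "\<dots> = bernoulli_pmf p" unfolding map_snd_pair_pmf conf_pmf_def
        by (rule map_nth_replicate_pmf[OF that])
    finally have r: "map_pmf (map (\<lambda>r. snd r ! i)) (rows_pmf b p m n) = conf_pmf p n"
      by (simp add: rows_pmf_def map_replicate_pmf conf_pmf_def)
    have "map_pmf (\<lambda>(xs, rs). (xs ! i, map (\<lambda>r. snd r ! i) rs)) (lattice_pmf a b p m n) =
        pair_pmf (bernoulli_pmf a) (conf_pmf p n)"
      unfolding lattice_pmf_def map_pair r conf_pmf_def map_nth_replicate_pmf[OF that] ..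
    then have "pprob (pair_pmf (bernoulli_pmf a) (conf_pmf p n)) {(y, zs). \<not> ntrue (y # zs) \<le> 1} =
       pprob (map_pmf (\<lambda>(xs, rs). (xs ! i, map (\<lambda>r. snd r ! i) rs)) (lattice_pmf a b p m n)) {(y, zs).
           \<not> ntrue (y # zs) \<le> 1}"
      by simp
    also have "\<dots> = ?P (?col i)" by (simp add: vimage_def case_prod_unfold)
    finally show ?thesis using two_points_prob[of a p n] assms by simp
  qed
  have "?P {(xs, rs). \<not> no_ties xs rs} \<le> ?P ((\<Union>j\<in>{..<n}. ?row j) \<union> (\<Union>i\<in>{..<m}. ?col i))"
  proof (rule prob_mono_pmf)
    fix w assume w: "w \<in> set_pmf (lattice_pmf a b p m n)" "w \<in> {(xs, rs). \<not> no_ties xs rs}"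
    obtain xs rs where w_eq: "w = (xs, rs)" by (cases w)
    have len: "length xs = m" "length rs = n" using set_lattice_pmf[OF w(1)] by (auto simp: lattices_def w_eq)
    then show "w \<in> (\<Union>j\<in>{..<n}. ?row j) \<union> (\<Union>i\<in>{..<m}. ?col i)"
      using w(2) by (force simp: w_eq no_ties_def in_set_conv_nth)
  qed
  also have "\<dots> \<le> ?P (\<Union>j\<in>{..<n}. ?row j) + ?P (\<Union>i\<in>{..<m}. ?col i)" by (rule measure_Un_le) auto
  also have "?P (\<Union>j\<in>{..<n}. ?row j) \<le> (\<Sum>j<n. ?P (?row j))" by (rule measure_UNION_le) auto
  also have "\<dots> \<le> (\<Sum>j<n. b * (m * p) + (m * p)\<^sup>2)" by (intro sum_mono row) auto
  also have "?P (\<Union>i\<in>{..<m}. ?col i) \<le> (\<Sum>i<m. ?P (?col i))" by (rule measure_UNION_le) auto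
  also have "\<dots> \<le> (\<Sum>i<m. a * (n * p) + (n * p)\<^sup>2)" by (intro sum_mono col) auto
  finally show ?thesis by simp
qed

text \<open>There are order N rows and columns, each with a tie of probability of order 1 / N^2: a
  boundary bit and a point have probability of order 1 / N each, and so have the two points of a
  pair.\<close>

lemma ties_limit:
  assumes "0 \<le> x" "0 \<le> t" and ab: "0 \<le> a" "0 \<le> b"
  shows "(\<lambda>N. pprob (lattice_pmf (occ a N) (occ b N) (occ2 N) (grid x N) (grid t N)) {(xs, rs).
      \<not> no_ties xs rs}) \<longlonglongrightarrow> 0"
proof (rule tendsto_sandwich[OF _ _ tendsto_const])
  let ?m = "\<lambda>N. real (grid x N)" and ?n = "\<lambda>N. real (grid t N)"
  show "eventually (\<lambda>N. pprob (lattice_pmf (occ a N) (occ b N) (occ2 N) (grid x N) (grid t N)) {(xs, rs).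
      \<not> no_ties xs rs} \<le>
     ?n N * (occ b N * (?m N * occ2 N) + (?m N * occ2 N)\<^sup>2) + ?m N *
         (occ a N * (?n N * occ2 N) + (?n N * occ2 N)\<^sup>2)) sequentially"
    using ab by (intro always_eventually allI ties_prob occ_bounds)
  have N3: "(\<lambda>N. real N * ((real N)\<^sup>2 * occ2 N * occ2 N)) \<longlonglongrightarrow> 0"
  proof -
    have "(\<lambda>N. ((real N)\<^sup>2 * occ2 N) * (real N * occ2 N)) \<longlonglongrightarrow> 1 * 0"
      by (intro tendsto_mult occ2_limit occ2_tendsto_0)
    then show ?thesis by (simp add: algebra_simps)
  qed
  have one: "(\<lambda>N. real (k N) * (occ c N * (real (l N) * occ2 N) + (real (l N) * occ2 N)\<^sup>2)) \<longlonglongrightarrow> 0"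
    if k: "(\<lambda>N. real (k N) / real N) \<longlonglongrightarrow> y" and l: "(\<lambda>N. real (l N) / real N) \<longlonglongrightarrow> z" for k l y z c
  proof -
    have "(\<lambda>N. (real (k N) * occ c N) * (real (l N) * occ2 N) + (real (l N) / real N)\<^sup>2 *
        (real (k N) * ((real N)\<^sup>2 * occ2 N * occ2 N))) \<longlonglongrightarrow>
       (y * c) * (z * 0) + z\<^sup>2 * (y * 0)"
      by (intro tendsto_add tendsto_mult tendsto_power scaled_limit[OF k] scaled_limit[OF l] occ_limit
          occ2_tendsto_0 N3 l)
    moreover have "eventually (\<lambda>N. (real (k N) * occ c N) * (real (l N) * occ2 N) +
        (real (l N) / real N)\<^sup>2 * (real (k N) * ((real N)\<^sup>2 * occ2 N * occ2 N)) =
       real (k N) * (occ c N * (real (l N) * occ2 N) + (real (l N) * occ2 N)\<^sup>2)) sequentially"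
      using eventually_gt_at_top[of 0] by eventually_elim (simp add: power2_eq_square algebra_simps)
    ultimately show ?thesis by (simp add: tendsto_cong)
  qed
  show "(\<lambda>N. ?n N * (occ b N * (?m N * occ2 N) + (?m N * occ2 N)\<^sup>2) + ?m N *
      (occ a N * (?n N * occ2 N) + (?n N * occ2 N)\<^sup>2)) \<longlonglongrightarrow> 0"
    using tendsto_add[OF one[OF grid_limit[OF assms(2)] grid_limit[OF assms(1)],
        of b] one[OF grid_limit[OF assms(1)] grid_limit[OF assms(2)], of a]]
    by simp
qed auto

subsection \<open>The continuous process\<close>

context hammersley_sources_sinks
begin

definition merged_at :: "real \<Rightarrow> real \<Rightarrow> 'w \<Rightarrow> bool" where
  "merged_at x t \<omega> = configuration.merged (Src \<omega>) (Snk \<omega>) (Alp \<omega>) x t"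

lemma configuration: "\<omega> \<in> space M \<Longrightarrow> configuration (Src \<omega>) (Snk \<omega>) (Alp \<omega>)"
  using sources sinks alpha_points unfolding configuration_def poisson_process_def
  by (auto dest!: measurable_space simp: space_configurations)

lemma eventually_merged_at:
  assumes "\<omega> \<in> space M" "0 < x" "0 \<le> t"
  shows "eventually (\<lambda>N. merged_at x t \<omega> \<longleftrightarrow> case_prod grid_merged (bits N (grid x N) (grid t N) \<omega>)) sequentially"
  using configuration.eventually_merged_iff[OF configuration[OF assms(1)] assms(2,3)]
  by (simp add: merged_at_def bits_def)

text \<open>The event says that \<open>grid_merged\<close> holds for all sufficiently fine meshes, a
  countable combination of events about finitely many bits.\<close>

lemma merged_at_events:
  assumes pos: "0 < lambda" "0 < mu" and "0 < x" "0 \<le> t"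
  shows "{\<omega> \<in> space M. merged_at x t \<omega>} \<in> events"
proof -
  \<comment> \<open>\<open>Suc N\<close> avoids the degenerate mesh N = 0.\<close>
  let ?W = "\<lambda>N \<omega>. case_prod grid_merged (bits (Suc N) (grid x (Suc N)) (grid t (Suc N)) \<omega>)"
  have "merged_at x t \<omega> \<longleftrightarrow> eventually (\<lambda>N. ?W N \<omega>) sequentially" if "\<omega> \<in> space M" for \<omega>
  proof -
    have ev: "eventually (\<lambda>N. merged_at x t \<omega> \<longleftrightarrow> ?W N \<omega>) sequentially"
      using eventually_merged_at[OF that assms(3,4)] by (rule eventually_sequentially_Suc[THEN iffD2])
    show ?thesis
    proof
      assume "merged_at x t \<omega>"
      then show "eventually (\<lambda>N. ?W N \<omega>) sequentially" using ev by (auto elim: eventually_mono)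
    next
      assume "eventually (\<lambda>N. ?W N \<omega>) sequentially"
      with ev have "eventually (\<lambda>N. merged_at x t \<omega>) sequentially" by eventually_elim simp
      then show "merged_at x t \<omega>" by simp
    qed
  qed
  then have "{\<omega> \<in> space M. merged_at x t \<omega>} = {\<omega> \<in> space M. eventually (\<lambda>N. ?W N \<omega>) sequentially}" by auto
  also have "\<dots> \<in> events"
    unfolding eventually_sequentially using bits_prob(1)[OF _ pos, of "Suc N" for N]
    by (intro sets.sets_Collect_countable_Ex sets.sets_Collect_countable_All sets.sets_Collect_imp) auto
  finally show ?thesis .
qed

text \<open>Dominated convergence carries the pathwise approximation of \<open>merged_at\<close> by
  \<open>grid_merged\<close> over to probabilities; the probability of a tie bounds the distance
  from \<open>grid_merged\<close> to the lattice event.\<close>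

lemma merge_prob_limit:
  assumes pos: "0 < lambda" "0 < mu" and xt: "0 < x" "0 \<le> t"
  shows "(\<lambda>N. merge_prob (occ lambda N) (occ mu N) (occ2 N) (grid x N) (grid t N)) \<longlonglongrightarrow>
      prob {\<omega> \<in> space M. merged_at x t \<omega>}"
proof -
  let ?p = "\<lambda>N. lattice_pmf (occ lambda N) (occ mu N) (occ2 N) (grid x N) (grid t N)"
  let ?W = "\<lambda>N. {\<omega> \<in> space M. case_prod grid_merged (bits N (grid x N) (grid t N) \<omega>)}"
  let ?E = "{\<omega> \<in> space M. merged_at x t \<omega>}"
  have W: "?W (Suc N) \<in> events" for N by (rule bits_prob(1)[OF _ pos]) simp
  have "(\<lambda>N. prob (?W (Suc N))) \<longlonglongrightarrow> prob ?E"
  proof -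
    have "(\<lambda>N. integral\<^sup>L M (indicator (?W (Suc N)) :: _ \<Rightarrow> real)) \<longlonglongrightarrow> integral\<^sup>L M (indicator ?E)"
    proof (rule integral_dominated_convergence[where w = "\<lambda>_. 1"])
      show "AE \<omega> in M. (\<lambda>N. indicator (?W (Suc N)) \<omega> :: real) \<longlonglongrightarrow> indicator ?E \<omega>"
      proof (rule AE_I2)
        fix \<omega> assume \<omega>: "\<omega> \<in> space M"
        have "eventually (\<lambda>N. merged_at x t \<omega> \<longleftrightarrow>
            case_prod grid_merged (bits (Suc N) (grid x (Suc N)) (grid t (Suc N)) \<omega>)) sequentially"
          using eventually_merged_at[OF \<omega> xt] by (rule eventually_sequentially_Suc[THEN iffD2])
        then have "eventually (\<lambda>N. indicator (?W (Suc N)) \<omega> = (indicator ?E \<omega> :: real)) sequentially"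
          by eventually_elim (simp add: indicator_def \<omega>)
        then show "(\<lambda>N. indicator (?W (Suc N)) \<omega> :: real) \<longlonglongrightarrow> indicator ?E \<omega>" by (rule tendsto_eventually)
      qed
    qed (use W merged_at_events[OF pos xt] in \<open>auto simp: indicator_def\<close>)
    then show ?thesis using W merged_at_events[OF pos xt] by simp
  qed
  then have lim: "(\<lambda>N. prob (?W N)) \<longlonglongrightarrow> prob ?E" by (rule LIMSEQ_imp_Suc)
  have ties: "(\<lambda>N. pprob (?p N) {(xs, rs). \<not> no_ties xs rs}) \<longlonglongrightarrow> 0"
    using pos xt by (intro ties_limit) auto
  have "eventually (\<lambda>N. \<bar>merge_prob (occ lambda N) (occ mu N) (occ2 N) (grid x N) (grid t N) - prob (?W N)\<bar> \<le>
      pprob (?p N) {(xs, rs). \<not> no_ties xs rs}) sequentially"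
    using eventually_gt_at_top[of 0]
  proof eventually_elim
    case (elim N)
    let ?A = "{(xs, rs). lrows rs xs = lrows rs (drop_first xs)}" and ?B = "{v. case_prod grid_merged v}"
        and ?T = "{(xs, rs). \<not> no_ties xs rs}"
    have iff: "v \<in> ?A \<longleftrightarrow> v \<in> ?B" if "v \<in> set_pmf (?p N)" "v \<notin> ?T" for v
    proof -
      obtain xs rs where v: "v = (xs, rs)" by (cases v)
      show ?thesis using grid_merged_iff[of xs rs] set_lattice_pmf[OF that(1)] that(2)
          by (auto simp: v lattices_def)
    qed
    have "pprob (?p N) ?A \<le> pprob (?p N) (?B \<union> ?T)" using iff by (intro prob_mono_pmf) blast
    also have "\<dots> \<le> pprob (?p N) ?B + pprob (?p N) ?T" by (rule measure_Un_le) auto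
    finally have 1: "pprob (?p N) ?A \<le> pprob (?p N) ?B + pprob (?p N) ?T" .
    have "pprob (?p N) ?B \<le> pprob (?p N) (?A \<union> ?T)" using iff by (intro prob_mono_pmf) blast
    also have "\<dots> \<le> pprob (?p N) ?A + pprob (?p N) ?T" by (rule measure_Un_le) auto
    finally show ?case using 1 bits_prob(2)[OF elim pos, of "case_prod grid_merged" "grid x N" "grid t N"]
      by (simp add: merge_prob_def abs_le_iff)
  qed
  then have "(\<lambda>N. merge_prob (occ lambda N) (occ mu N) (occ2 N) (grid x N) (grid t N) - prob (?W N)) \<longlonglongrightarrow> 0"
    by (intro Lim_null_comparison[OF _ ties]) simp
  from tendsto_add[OF this lim] show ?thesis by simp
qed

lemma dual_second_class_limit:
  assumes pos: "0 < lambda" "0 < mu" "lambda * mu < 1" and a: "0 \<le> a"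
  shows "((\<lambda>x. prob {\<omega> \<in> space M. x < dual_second_class (Src \<omega>) (Snk \<omega>) (Alp \<omega>) (a * x)}) \<longlongrightarrow>
    (if a \<ge> 1 / mu\<^sup>2 then 1
     else if a \<ge> lambda\<^sup>2 then (1 / lambda - sqrt (1 / a)) / (1 / lambda - mu) else 0)) at_top"
proof -
  define P where "P x t = prob {\<omega> \<in> space M. merged_at x t \<omega>}" for x t
  have P: "(\<lambda>N. merge_prob (occ lambda N) (occ mu N) (occ2 N) (grid x N) (grid t N)) \<longlonglongrightarrow> P x t"
      if "0 < x" "0 \<le> t" for x t
    unfolding P_def by (rule merge_prob_limit[OF pos(1,2) that])
  have limit: "((\<lambda>x. P x (a * x)) \<longlongrightarrow> (if a \<ge> 1 / mu\<^sup>2 then 1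
      else if a \<ge> lambda\<^sup>2 then (1 / lambda - sqrt (1 / a)) / (1 / lambda - mu) else 0)) at_top"
      if "0 \<le> a" for a
    by (rule P_limit[OF pos _ that]) (rule P)
  \<comment> \<open>The second class particle has not escaped to infinity.\<close>
  have null: "prob {\<omega> \<in> space M. \<forall>k. merged_at (real (Suc k)) t \<omega>} = 0" if t: "0 \<le> t" for t
  proof -
    let ?Z = "{\<omega> \<in> space M. \<forall>k. merged_at (real (Suc k)) t \<omega>}"
    \<comment> \<open>Any positive value below \<open>lambda\<^sup>2\<close> serves: for fixed
      \<open>t\<close> eventually t \<le> a0 (k + 1), and along this ray \<open>P\<close> tends to
      0.\<close>
    define a0 where "a0 = lambda\<^sup>2 / 2"
    have a0: "0 < a0" "a0 < lambda\<^sup>2" using pos by (auto simp: a0_def)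
    have "lambda < 1 / mu" using pos by (simp add: field_simps)
    then have "lambda\<^sup>2 < (1 / mu)\<^sup>2" using pos by (intro power_strict_mono) auto
    then have a0': "a0 < 1 / mu\<^sup>2" using a0 by (simp add: power_divide)
    have "((\<lambda>x. P x (a0 * x)) \<longlongrightarrow> 0) at_top" using limit[of a0] a0 a0' by simp
    then have lim: "((\<lambda>k. P (real (Suc k)) (a0 * real (Suc k))) \<longlonglongrightarrow> 0)"
      by (rule filterlim_compose) (rule filterlim_compose[OF filterlim_real_sequentially filterlim_Suc])
    have "eventually (\<lambda>k. prob ?Z \<le> P (real (Suc k)) (a0 * real (Suc k))) sequentially"
    proof -
      obtain k0 where k0: "t / a0 < real k0" using reals_Archimedean2 by blast
      show ?thesis using eventually_ge_at_top[of k0]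
      proof eventually_elim
        case (elim k)
        have "t / a0 \<le> real (Suc k)" using k0 elim by linarith
        then have t': "t \<le> a0 * real (Suc k)" using a0 by (simp add: field_simps)
        have "prob ?Z \<le> P (real (Suc k)) t"
          unfolding P_def using merged_at_events[OF pos(1,2) _ t, of "real (Suc k)"]
              by (intro finite_measure_mono) auto
        also have "\<dots> \<le> P (real (Suc k)) (a0 * real (Suc k))" by (rule P_mono[OF pos, where P = P])
            (use P t t' in auto)
        finally show ?case .
      qed
    qed
    then have "prob ?Z \<le> 0" by (intro tendsto_lowerbound[OF lim]) auto
    then show ?thesis using measure_nonneg[of M ?Z] by linarith
  qed
  have Z: "{\<omega> \<in> space M. \<forall>k. merged_at (real (Suc k)) t \<omega>} \<in> events" if "0 \<le> t" for t
    using merged_at_events[OF pos(1,2) _ that] by (intro sets.sets_Collect_countable_All) auto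
  have "eventually (\<lambda>x. prob {\<omega> \<in> space M. x < dual_second_class (Src \<omega>) (Snk \<omega>) (Alp \<omega>) (a * x)} =
      P x (a * x)) at_top"
    \<comment> \<open>Once \<open>x\<close> is at least the default value
      \<open>THE y. False\<close>, outcomes without a second class particle lie outside the
      event.\<close>
    using eventually_gt_at_top[of 0] eventually_ge_at_top[of "THE y. False"]
  proof eventually_elim
    case (elim x)
    have t: "0 \<le> a * x" using a elim by simp
    let ?Z = "{\<omega> \<in> space M. \<forall>k. merged_at (real (Suc k)) (a * x) \<omega>}"
        and ?E = "{\<omega> \<in> space M. merged_at x (a * x) \<omega>}"
    have "{\<omega> \<in> space M. x < dual_second_class (Src \<omega>) (Snk \<omega>) (Alp \<omega>) (a * x)} = ?E - ?Z"
    proof (intro set_eqI)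
      fix \<omega>
      show "\<omega> \<in> {\<omega> \<in> space M. x < dual_second_class (Src \<omega>) (Snk \<omega>) (Alp \<omega>) (a * x)} \<longleftrightarrow> \<omega> \<in> ?E - ?Z"
      proof (cases "\<omega> \<in> space M")
        case True
        interpret configuration "Src \<omega>" "Snk \<omega>" "Alp \<omega>" by (rule configuration[OF True])
        show ?thesis
        proof (cases "\<forall>k. merged_at (real (Suc k)) (a * x) \<omega>")
          case all: True
          have "merged R (a * x)" for R
          proof -
            obtain k where "R < real k" using reals_Archimedean2 by blast
            then have "R \<le> real (Suc k)" by simp
            then show ?thesis using all merged_antimono by (auto simp: merged_at_def)
          qed
          then have "dual_second_class (Src \<omega>) (Snk \<omega>) (Alp \<omega>) (a * x) = (THE y. False)"
              by (rule dual_second_class_merged)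
          then show ?thesis using all True elim by simp
        next
          case False
          then obtain k where "\<not> merged (real (Suc k)) (a * x)" by (auto simp: merged_at_def)
          then have "x < dual_second_class (Src \<omega>) (Snk \<omega>) (Alp \<omega>) (a * x) \<longleftrightarrow> merged x (a * x)"
            using elim(1) by (intro dual_second_class_iff[of "real (Suc k)"]) auto
          then show ?thesis using False True by (simp add: merged_at_def)
        qed
      qed simp
    qed
    also have "prob (?E - ?Z) = prob ?E - prob (?E \<inter> ?Z)"
      using merged_at_events[OF pos(1,2) elim(1) t] Z[OF t] by (rule finite_measure_Diff')
    also have "prob (?E \<inter> ?Z) = 0"
    proof -
      have "prob (?E \<inter> ?Z) \<le> prob ?Z" using Z[OF t] by (intro finite_measure_mono) auto
      then show ?thesis using null[OF t] measure_nonneg[of M "?E \<inter> ?Z"] by linarith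
    qed
    finally show ?case by (simp add: P_def)
  qed
  then show ?thesis using limit[OF a] by (simp add: tendsto_cong)
qed

end

theorem corollary2p6:
  fixes M :: "'w measure" and lambda mu a :: real
    and Src Snk :: "'w \<Rightarrow> real set" and Alp :: "'w \<Rightarrow> (real \<times> real) set"
  assumes "hammersley_sources_sinks M lambda mu Src Snk Alp"
    and "lambda > 0" and "mu > 0" and "lambda * mu < 1"
    and "a \<ge> 0"
  shows "((\<lambda>x::real. measure M
             {\<omega> \<in> space M. dual_second_class (Src \<omega>) (Snk \<omega>) (Alp \<omega>) (a * x) > x})
          \<longlongrightarrow> (if a \<ge> 1 / mu\<^sup>2 then 1
               else if a \<ge> lambda\<^sup>2 then (1 / lambda - sqrt (1 / a)) / (1 / lambda - mu)
               else 0)) at_top"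
  using assms by (intro hammersley_sources_sinks.dual_second_class_limit)

end
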